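(* There is an algorithm for Odd Cycle Transversal by CVD running in time $2^{{\mathcal O}(k)} n^{{\mathcal O}(1)}$ that, given an $n$-vertex graph $G$ and integer $k$, either returns a minimum odd cycle transversal of $G$ or concludes that there is no chordal vertex deletion set of size $k$ in $G$.
   Context: Odd Cycle Transversal by CVD: given a graph $G$ and integers $k,\ell$, with parameter $k$ being the size of a chordal vertex deletion set of $G$ (a vertex set whose deletion leaves a chordal graph), which is not given as input, decide whether there is a set $X$ of at most $\ell$ vertices such that $G - X$ is bipartite. *)

theory Defs
  imports Main
begin

section \<open>Finite simple graphs\<close>

text \<open>A graph is given by its vertex set \<open>V\<close> and its set \<open>E\<close> of two-element edges.\<close>

definition simple_graph :: "'a set \<Rightarrow> 'a set set \<Rightarrow> bool" where
  "simple_graph V E \<longleftrightarrow> finite V \<and> (\<forall>e\<in>E. e \<subseteq> V \<and> card e = 2)"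

text \<open>The edge set of \<open>G - X\<close>; its vertex set is \<open>V - X\<close>.\<close>

definition del_edges :: "'a set set \<Rightarrow> 'a set \<Rightarrow> 'a set set" where
  "del_edges E X = {e \<in> E. e \<inter> X = {}}"

definition bipartite :: "'a set \<Rightarrow> 'a set set \<Rightarrow> bool" where
  "bipartite V E \<longleftrightarrow>
     (\<exists>A B. A \<union> B = V \<and> A \<inter> B = {} \<and> (\<forall>e\<in>E. \<not> e \<subseteq> A \<and> \<not> e \<subseteq> B))"

definition is_cycle :: "'a set \<Rightarrow> 'a set set \<Rightarrow> 'a list \<Rightarrow> bool" where
  "is_cycle V E c \<longleftrightarrow> length c \<ge> 3 \<and> distinct c \<and> set c \<subseteq> V \<and>
     (\<forall>i < length c. {c ! i, c ! (Suc i mod length c)} \<in> E)"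

definition has_chord :: "'a set set \<Rightarrow> 'a list \<Rightarrow> bool" where
  "has_chord E c \<longleftrightarrow>
     (\<exists>i < length c. \<exists>j < length c.
        i \<noteq> j \<and> j \<noteq> Suc i mod length c \<and> i \<noteq> Suc j mod length c \<and> {c ! i, c ! j} \<in> E)"

definition chordal :: "'a set \<Rightarrow> 'a set set \<Rightarrow> bool" where
  "chordal V E \<longleftrightarrow> (\<forall>c. is_cycle V E c \<and> length c \<ge> 4 \<longrightarrow> has_chord E c)"

definition chordal_vertex_deletion_set :: "'a set \<Rightarrow> 'a set set \<Rightarrow> 'a set \<Rightarrow> bool" where
  "chordal_vertex_deletion_set V E S \<longleftrightarrow> S \<subseteq> V \<and> chordal (V - S) (del_edges E S)"

definition odd_cycle_transversal :: "'a set \<Rightarrow> 'a set set \<Rightarrow> 'a set \<Rightarrow> bool" where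
  "odd_cycle_transversal V E X \<longleftrightarrow> X \<subseteq> V \<and> bipartite (V - X) (del_edges E X)"

definition minimum_odd_cycle_transversal :: "'a set \<Rightarrow> 'a set set \<Rightarrow> 'a set \<Rightarrow> bool" where
  "minimum_odd_cycle_transversal V E X \<longleftrightarrow>
     odd_cycle_transversal V E X \<and>
     (\<forall>Y. odd_cycle_transversal V E Y \<longrightarrow> card X \<le> card Y)"


section \<open>Model of computation\<close>

text \<open>
  Algorithms are programs of a first-order, call-by-value functional language whose only data are
  binary trees (pure Lisp; cf. the language F in N. D. Jones, Computability and Complexity from a
  Programming Perspective).  Every evaluation rule costs one time unit.  Every rule is
  a constant number of pointer operations for a fixed program, since environments have bounded
  length and trees are shared, never copied; the model is therefore related to Turing machines and
  random access machines by polynomial-time simulations, and bounds of the form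
  \<open>2^O(k) * n^O(1)\<close> do not depend on which of these models is used.
\<close>

datatype tree = Leaf | Node tree tree

text \<open>
  Variables are de Bruijn indices.  \<open>Case e e1 e2\<close> continues with \<open>e1\<close> if \<open>e\<close> yields \<open>Leaf\<close>; if it
  yields \<open>Node l r\<close>, it continues with \<open>e2\<close>, in which \<open>l\<close> is variable 0 and \<open>r\<close> is variable 1.
  \<open>Call f es\<close> evaluates the body of the function number \<open>f\<close> in the environment that consists of
  exactly the argument values.
\<close>

datatype expr =
    Var nat
  | LeafE
  | NodeE expr expr
  | Case expr expr expr
  | LetIn expr expr
  | Call nat "expr list"

text \<open>
  \<open>eval P \<rho> e v t\<close>: with the function bodies \<open>P\<close>, which may be mutually recursive, and in
  environment \<open>\<rho>\<close>, the expression \<open>e\<close> terminates with value \<open>v\<close> after \<open>t\<close> time units.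
\<close>

inductive eval :: "expr list \<Rightarrow> tree list \<Rightarrow> expr \<Rightarrow> tree \<Rightarrow> nat \<Rightarrow> bool"
  and evals :: "expr list \<Rightarrow> tree list \<Rightarrow> expr list \<Rightarrow> tree list \<Rightarrow> nat \<Rightarrow> bool"
  for P :: "expr list" where
  eval_Var: "i < length \<rho> \<Longrightarrow> eval P \<rho> (Var i) (\<rho> ! i) 1"
| eval_LeafE: "eval P \<rho> LeafE Leaf 1"
| eval_NodeE: "eval P \<rho> e1 v1 t1 \<Longrightarrow> eval P \<rho> e2 v2 t2 \<Longrightarrow>
    eval P \<rho> (NodeE e1 e2) (Node v1 v2) (t1 + t2 + 1)"
| eval_Case_Leaf: "eval P \<rho> e Leaf t \<Longrightarrow> eval P \<rho> e1 v t1 \<Longrightarrow>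
    eval P \<rho> (Case e e1 e2) v (t + t1 + 1)"
| eval_Case_Node: "eval P \<rho> e (Node l r) t \<Longrightarrow> eval P (l # r # \<rho>) e2 v t2 \<Longrightarrow>
    eval P \<rho> (Case e e1 e2) v (t + t2 + 1)"
| eval_Let: "eval P \<rho> e1 v1 t1 \<Longrightarrow> eval P (v1 # \<rho>) e2 v t2 \<Longrightarrow>
    eval P \<rho> (LetIn e1 e2) v (t1 + t2 + 1)"
| eval_Call: "evals P \<rho> es vs t1 \<Longrightarrow> f < length P \<Longrightarrow> eval P vs (P ! f) v t2 \<Longrightarrow>
    eval P \<rho> (Call f es) v (t1 + t2 + 1)"
| evals_Nil: "evals P \<rho> [] [] 1"
| evals_Cons: "eval P \<rho> e v t1 \<Longrightarrow> evals P \<rho> es vs t2 \<Longrightarrow>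
    evals P \<rho> (e # es) (v # vs) (t1 + t2 + 1)"

inductive_cases eval_VarE: "eval P \<rho> (Var i) v t"
inductive_cases eval_LeafEE: "eval P \<rho> LeafE v t"
inductive_cases eval_NodeEE: "eval P \<rho> (NodeE e1 e2) v t"
inductive_cases eval_CaseE: "eval P \<rho> (Case e e1 e2) v t"
inductive_cases eval_LetE: "eval P \<rho> (LetIn e1 e2) v t"
inductive_cases eval_CallE: "eval P \<rho> (Call f es) v t"
inductive_cases evals_NilE: "evals P \<rho> [] vs t"
inductive_cases evals_ConsE: "evals P \<rho> (e # es) vs t"

text \<open>Evaluation is deterministic, so result and running time are functions of the input.\<close>

lemma eval_deterministic:
  "eval P \<rho> e v t \<Longrightarrow> eval P \<rho> e v' t' \<Longrightarrow> v = v' \<and> t = t'"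
  and evals_deterministic:
  "evals P \<rho> es vs t \<Longrightarrow> evals P \<rho> es vs' t' \<Longrightarrow> vs = vs' \<and> t = t'"
proof (induction arbitrary: v' t' and vs' t' rule: eval_evals.inducts)
  case eval_Var then show ?case by (auto elim: eval_VarE)
next
  case eval_LeafE then show ?case by (auto elim: eval_LeafEE)
next
  case eval_NodeE from eval_NodeE.prems show ?case
    by (rule eval_NodeEE) (auto dest!: eval_NodeE.IH(2) eval_NodeE.IH(4))
next
  case eval_Case_Leaf from eval_Case_Leaf.prems show ?case
    by (rule eval_CaseE) (auto dest!: eval_Case_Leaf.IH(2) eval_Case_Leaf.IH(4))
next
  case eval_Case_Node from eval_Case_Node.prems show ?case
    by (rule eval_CaseE) (auto dest!: eval_Case_Node.IH(2) eval_Case_Node.IH(4))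
next
  case eval_Let from eval_Let.prems show ?case
    by (rule eval_LetE) (auto dest!: eval_Let.IH(2) eval_Let.IH(4))
next
  case eval_Call from eval_Call.prems show ?case
    by (rule eval_CallE) (auto dest!: eval_Call.IH(2) eval_Call.IH(5))
next
  case evals_Nil then show ?case by (auto elim: evals_NilE)
next
  case evals_Cons from evals_Cons.prems show ?case
    by (rule evals_ConsE) (auto dest!: evals_Cons.IH(2) evals_Cons.IH(4))
qed


section \<open>Encoding of inputs and outputs\<close>

text \<open>
  Numbers are encoded in unary, which is harmless here: vertices are smaller than \<open>n\<close>, and a
  running time of \<open>2^O(k)\<close> exceeds the length of \<open>k\<close> in unary.
\<close>

fun enc_nat :: "nat \<Rightarrow> tree" where
  "enc_nat 0 = Leaf"
| "enc_nat (Suc n) = Node Leaf (enc_nat n)"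

fun enc_bool :: "bool \<Rightarrow> tree" where
  "enc_bool False = Leaf"
| "enc_bool True = Node Leaf Leaf"

fun enc_list :: "('a \<Rightarrow> tree) \<Rightarrow> 'a list \<Rightarrow> tree" where
  "enc_list enc [] = Leaf"
| "enc_list enc (x # xs) = Node (enc x) (enc_list enc xs)"

fun enc_option :: "('a \<Rightarrow> tree) \<Rightarrow> 'a option \<Rightarrow> tree" where
  "enc_option enc None = Leaf"
| "enc_option enc (Some x) = Node Leaf (enc x)"

text \<open>An \<open>n\<close>-vertex graph on the vertices \<open>0, \<dots>, n - 1\<close> is encoded by its adjacency matrix.\<close>

definition enc_graph :: "nat \<Rightarrow> nat set set \<Rightarrow> tree" where
  "enc_graph n E =
     enc_list (enc_list enc_bool) (map (\<lambda>u. map (\<lambda>v. {u, v} \<in> E) [0..<n]) [0..<n])"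

end

theory Submission
  imports Defs
begin

text \<open>
  If \<open>S\<close> is a chordal vertex deletion set of size at most \<open>k\<close>, every set of weighted cliques has a balanced
  separator of the form \<open>C \<union> S\<close> with a clique \<open>C\<close> of \<open>G - S\<close>.  Although \<open>S\<close> is unknown, \<open>C\<close> lies in one
  of the at most \<open>2^k (n + 1)\<close> maximal cliques of \<open>G\<close>; once this clique and the two sides of the separation
  are guessed, at most \<open>k\<close> further separating vertices are found by bipartite matching.  As in the algorithm of
  Robertson and Seymour for treewidth, this gives a tree decomposition in which each bag is the union
  of at most six cliques and \<open>6 k + 6\<close> vertices.  A bipartite subgraph contains at most two vertices of each clique,
  so the number of partial solutions on a bag is \<open>2^O(k) n^O(1)\<close>, which makes dynamic programming possible.  All
  of this takes polynomial time in the input padded by the number \<open>2^k\<close> in unary, so that only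
  closure properties of polynomial time are needed to bound the cost of the program.
\<close>

text \<open>The constants come from a balance. Let \<open>W\<close> bound the weight of a bag, where
  a clique weighs \<open>k + 1\<close> and a single vertex 1. A separator leaves at most two thirds
  of the bag on either side and adds one clique, at most \<open>k\<close> further vertices and one
  vertex that guarantees progress, of weight \<open>2 k + 2\<close> together. The bound reproduces
  itself if \<open>2 W / 3 + 2 k + 2 \<le> W\<close>, and \<open>W = 6 k + 6\<close> is the least
  solution. It allows six cliques, whence the exponent 12 of \<open>n + 1\<close> in the table
  bound.

  The set \<open>S\<close> never occurs in the program. A split is accepted just because its bags
  are light, and the tables are exact for every decomposition into light bags; \<open>S\<close> only
  proves that a light split exists. So an answer \<open>Some\<close> is right for every graph, and a
  failed decomposition is itself the refutation of \<open>S\<close>.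

  Polynomial time is a claim about all inputs, meaningful or not. Therefore tables and search states
  need size bounds that do not rest on correctness: a cap \<open>L\<close> on the number of entries,
  polynomial in \<open>n\<close> and in the padding, and a bound on each entry.\<close>

section \<open>Polynomial-time functions\<close>

lemma eval_VarI: "i < length \<rho> \<Longrightarrow> v = \<rho> ! i \<Longrightarrow> t = 1 \<Longrightarrow> eval P \<rho> (Var i) v t"
  using eval_Var by simp

lemma eval_LeafI: "v = Leaf \<Longrightarrow> t = 1 \<Longrightarrow> eval P \<rho> LeafE v t"
  using eval_LeafE by simp

lemma eval_NodeI: "eval P \<rho> e1 v1 t1 \<Longrightarrow> eval P \<rho> e2 v2 t2 \<Longrightarrow> v = Node v1 v2 \<Longrightarrow> t = t1 + t2 + 1 \<Longrightarrow>
    eval P \<rho> (NodeE e1 e2) v t"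
  using eval_NodeE by simp

lemma eval_Case_LeafI: "eval P \<rho> e Leaf t' \<Longrightarrow> eval P \<rho> e1 v t1 \<Longrightarrow> t = t' + t1 + 1 \<Longrightarrow>
    eval P \<rho> (Case e e1 e2) v t"
  using eval_Case_Leaf by simp

lemma eval_Case_NodeI: "eval P \<rho> e (Node l r) t' \<Longrightarrow> eval P (l # r # \<rho>) e2 v t2 \<Longrightarrow> t = t' + t2 + 1 \<Longrightarrow>
    eval P \<rho> (Case e e1 e2) v t"
  using eval_Case_Node by simp

lemma eval_LetI: "eval P \<rho> e1 v1 t1 \<Longrightarrow> eval P (v1 # \<rho>) e2 v t2 \<Longrightarrow> t = t1 + t2 + 1 \<Longrightarrow>
    eval P \<rho> (LetIn e1 e2) v t"
  using eval_Let by simp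

lemma eval_CallI: "evals P \<rho> es vs t1 \<Longrightarrow> f < length P \<Longrightarrow> eval P vs (P ! f) v t2 \<Longrightarrow> t = t1 + t2 + 1 \<Longrightarrow>
    eval P \<rho> (Call f es) v t"
  using eval_Call by simp

lemma evals_NilI: "vs = [] \<Longrightarrow> t = 1 \<Longrightarrow> evals P \<rho> [] vs t"
  using evals_Nil by simp

lemma evals_ConsI: "eval P \<rho> e v t1 \<Longrightarrow> evals P \<rho> es vs t2 \<Longrightarrow> ws = v # vs \<Longrightarrow> t = t1 + t2 + 1 \<Longrightarrow>
    evals P \<rho> (e # es) ws t"
  using evals_Cons by simp

lemmas eval_rules = eval_VarI eval_LeafI eval_NodeI eval_Case_LeafI eval_Case_NodeI eval_LetI
  eval_CallI evals_NilI evals_ConsI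

text \<open>A call starts from its argument values alone, and variables count from the front, so
  values appended at the end of the environment are invisible. Hence code compiled for
  \<open>[code x]\<close> runs unchanged wherever \<open>code x\<close> is variable 0.\<close>

lemma eval_weaken:
  "eval P \<rho> e v t \<Longrightarrow> eval P (\<rho> @ \<sigma>) e v t"
  and evals_weaken: "evals P \<rho> es vs t \<Longrightarrow> evals P (\<rho> @ \<sigma>) es vs t"
proof (induction rule: eval_evals.inducts)
  case (eval_Var i \<rho>)
  then show ?case by (intro eval_VarI) (auto simp: nth_append)
next
  case (eval_Call \<rho> es vs t1 f v t2)
  then show ?case using eval_CallI by blast
qed (auto intro: eval_rules)

lemma eval_in_singleton:
  "eval P [w] e v t \<Longrightarrow> eval P (w # \<rho>) e v t"
  using eval_weaken[of P "[w]" e v t \<rho>] by simp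

section \<open>Codes of data and their sizes\<close>

class encodable = fixes code :: "'a \<Rightarrow> tree"

instantiation nat :: encodable begin
definition "code_nat = enc_nat"
instance ..
end

instantiation bool :: encodable begin
definition "code_bool = enc_bool"
instance ..
end

instantiation unit :: encodable begin
definition "code_unit (u::unit) = Leaf"
instance ..
end

instantiation list :: (encodable) encodable begin
definition "code_list = enc_list code"
instance ..
end

instantiation option :: (encodable) encodable begin
definition "code_option = enc_option code"
instance ..
end

instantiation prod :: (encodable, encodable) encodable begin
definition "code_prod p = Node (code (fst p)) (code (snd p))"
instance ..
end

lemma code_simps [simp]:
  "code False = Leaf" "code True = Node Leaf Leaf" "code () = Leaf"
  "code (0::nat) = Leaf" "code (Suc n) = Node Leaf (code n)"
  "code [] = Leaf" "code (x # xs) = Node (code x) (code xs)"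
  "code None = Leaf" "code (Some x) = Node Leaf (code x)"
  "code (x, y) = Node (code x) (code y)"
  by (simp_all add: code_bool_def code_unit_def code_nat_def code_list_def code_option_def code_prod_def)

lemma code_nat_replicate: "code (n::nat) = code (replicate n ())"
  by (induction n) auto

text \<open>\<open>size\<close> counts the \<open>Node\<close>s of a tree, so a unary number has
  itself as size, and a list is larger than each of its entries.\<close>

definition sz :: "'a::encodable \<Rightarrow> nat" where "sz x = size (code x)"

lemma sz_simps [simp]:
  "sz False = 0" "sz True = 1" "sz () = 0" "sz (n::nat) = n"
  "sz [] = 0" "sz (x # xs) = sz x + sz xs + 1"
  "sz None = 0" "sz (Some x) = sz x + 1" "sz (x, y) = sz x + sz y + 1"
proof -
  show "sz (n::nat) = n" by (induction n) (auto simp: sz_def)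
qed (auto simp: sz_def)

lemma sz_prod: "sz p = sz (fst p) + sz (snd p) + 1"
  by (cases p) simp

lemma sz_append [simp]: "sz (xs @ ys) = sz xs + sz ys"
  by (induction xs) auto

lemma length_le_sz: "length xs \<le> sz xs"
  by (induction xs) auto

lemma sz_member: "x \<in> set xs \<Longrightarrow> sz x < sz xs"
  by (induction xs) auto

lemma sz_list_le: "(\<And>x. x \<in> set xs \<Longrightarrow> sz x \<le> m) \<Longrightarrow> sz xs \<le> length xs * (m + 1)"
proof (induction xs)
  case (Cons a xs)
  then have "sz a \<le> m" "sz xs \<le> length xs * (m + 1)" by auto
  then show ?case by simp
qed simp

lemma sz_bool: "sz (b::bool) \<le> 1" by (cases b) auto

text \<open>A base of at least 2 lets a single exponent absorb constants and coefficients as well as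
  degrees.\<close>

definition poly_bounded :: "('a::encodable \<Rightarrow> nat) \<Rightarrow> bool" where
  "poly_bounded T \<longleftrightarrow> (\<exists>c. \<forall>x. T x \<le> (sz x + 2) ^ c)"

lemma poly_boundedI: "(\<And>x. T x \<le> (sz x + 2) ^ c) \<Longrightarrow> poly_bounded T"
  unfolding poly_bounded_def by blast

lemma poly_bounded_mono: "poly_bounded T \<Longrightarrow> (\<And>x. T' x \<le> T x) \<Longrightarrow> poly_bounded T'"
  unfolding poly_bounded_def by (meson le_trans)

lemma poly_bounded_const: "poly_bounded (\<lambda>x. c)"
proof (rule poly_boundedI)
  fix x :: 'a
  have "c \<le> 2 ^ c" by (simp add: less_imp_le)
  also have "\<dots> \<le> (sz x + 2) ^ c" by (rule power_mono) auto
  finally show "c \<le> (sz x + 2) ^ c" .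
qed

lemma poly_bounded_add:
  assumes "poly_bounded S" "poly_bounded T" shows "poly_bounded (\<lambda>x. S x + T x)"
proof -
  obtain a b where a: "\<And>x. S x \<le> (sz x + 2) ^ a" and b: "\<And>x. T x \<le> (sz x + 2) ^ b"
    using assms unfolding poly_bounded_def by blast
  show ?thesis
  proof (rule poly_boundedI)
    fix x :: 'a
    let ?s = "sz x + 2"
    have "?s ^ a \<le> ?s ^ (a + b)" "?s ^ b \<le> ?s ^ (a + b)" by (auto intro: power_increasing)
    then have "S x + T x \<le> 2 * ?s ^ (a + b)" using a[of x] b[of x] by linarith
    also have "\<dots> \<le> ?s * ?s ^ (a + b)" by (rule mult_le_mono1) simp
    finally show "S x + T x \<le> ?s ^ Suc (a + b)" by simp
  qed
qed

lemma poly_bounded_mult: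
  assumes "poly_bounded S" "poly_bounded T" shows "poly_bounded (\<lambda>x. S x * T x)"
proof -
  obtain a b where a: "\<And>x. S x \<le> (sz x + 2) ^ a" and b: "\<And>x. T x \<le> (sz x + 2) ^ b"
    using assms unfolding poly_bounded_def by blast
  show ?thesis
  proof (rule poly_boundedI)
    fix x show "S x * T x \<le> (sz x + 2) ^ (a + b)"
      unfolding power_add by (rule mult_le_mono) (use a b in auto)
  qed
qed

lemma poly_bounded_power:
  assumes "poly_bounded T" shows "poly_bounded (\<lambda>x. T x ^ c)"
  by (induction c) (auto intro: poly_bounded_const poly_bounded_mult assms)

lemma poly_bounded_Suc: "poly_bounded T \<Longrightarrow> poly_bounded (\<lambda>x. Suc (T x))"
  using poly_bounded_add[OF _ poly_bounded_const[of 1]] by simp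

lemma poly_bounded_sz: "poly_bounded (\<lambda>x. sz x)"
  by (rule poly_boundedI[where c=1]) simp

lemma poly_bounded_comp:
  assumes "poly_bounded T" "poly_bounded (\<lambda>x. sz (f x))" shows "poly_bounded (\<lambda>x. T (f x))"
proof -
  obtain c where c: "\<And>y. T y \<le> (sz y + 2) ^ c"
    using assms unfolding poly_bounded_def by blast
  have "poly_bounded (\<lambda>x. (sz (f x) + 2) ^ c)"
    by (intro poly_bounded_power poly_bounded_add poly_bounded_const assms)
  then show ?thesis by (rule poly_bounded_mono) (rule c)
qed

definition runs :: "expr list \<Rightarrow> expr \<Rightarrow> ('a::encodable \<Rightarrow> 'b::encodable) \<Rightarrow> ('a \<Rightarrow> nat) \<Rightarrow> bool" where
  "runs P e f T \<longleftrightarrow> (\<forall>Q x. \<exists>t \<le> T x. eval (P @ Q) [code x] e (code (f x)) t)"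

text \<open>
  The quantification over all program prefixes \<open>P\<close> makes it possible to compose functions without
  renumbering calls: programs only ever grow at their end.
\<close>

definition polytime :: "('a::encodable \<Rightarrow> 'b::encodable) \<Rightarrow> bool" where
  "polytime f \<longleftrightarrow> poly_bounded (\<lambda>x. sz (f x)) \<and>
     (\<forall>P. \<exists>P' e T. poly_bounded T \<and> runs (P @ P') e f T)"

lemma runsE:
  assumes "runs P e f T"
  obtains t where "t \<le> T x" "eval (P @ Q) [code x] e (code (f x)) t"
  using assms unfolding runs_def by blast

lemma polytimeE:
  assumes "polytime f"
  obtains P' e T where "poly_bounded T" "runs (P @ P') e f T"
  using assms unfolding polytime_def by blast

text \<open>The size bound does not follow from the time bound: trees are shared, so
  \<open>t\<close> repetitions of \<open>Node v v\<close> build a tree of size about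
  \<open>2 ^ t\<close> in time linear in \<open>t\<close>. It belongs to \<open>polytime\<close>
  because composition would fail without it.\<close>

lemma polytime_sz: "polytime f \<Longrightarrow> poly_bounded (\<lambda>x. sz (f x))"
  unfolding polytime_def by blast

lemma polytimeI:
  assumes "poly_bounded (\<lambda>x. sz (f x))"
    and "\<And>P. \<exists>P' e T. poly_bounded T \<and> runs (P @ P') e f T"
  shows "polytime f"
  using assms unfolding polytime_def by blast

text \<open>Programs see only codes, so polynomial time passes between types with equal codes:
  \<open>True\<close> is coded like \<open>[()]\<close>, a number like a list of units,
  \<open>Some x\<close> like \<open>((), x)\<close>, and \<open>x # xs\<close> like
  \<open>(x, xs)\<close>.\<close>

lemma polytime_recode:
  assumes "polytime f" "\<And>x. code (f x) = code (g x)" shows "polytime g"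
  using assms unfolding polytime_def runs_def sz_def by auto

lemma polytime_id: "polytime (\<lambda>x. x)"
proof (rule polytimeI)
  fix P
  have "runs (P @ []) (Var 0) (\<lambda>x::'a. x) (\<lambda>x. 1)"
    unfolding runs_def by (auto intro!: eval_VarI)
  then show "\<exists>P' e T. poly_bounded T \<and> runs (P @ P') e (\<lambda>x::'a. x) T"
    using poly_bounded_const by blast
qed (rule poly_bounded_sz)

primrec quote :: "tree \<Rightarrow> expr" where
  "quote Leaf = LeafE"
| "quote (Node l r) = NodeE (quote l) (quote r)"

lemma eval_quote: "eval P \<rho> (quote v) v (2 * size v + 1)"
proof (induction v)
  case (Node l r)
  then show ?case using eval_NodeE[OF Node] by (simp add: algebra_simps)
qed (simp add: eval_LeafI)

lemma polytime_const: "polytime (\<lambda>x. c)"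
proof (rule polytimeI)
  fix P
  have "runs (P @ []) (quote (code c)) (\<lambda>x::'a. c) (\<lambda>x. 2 * size (code c) + 1)"
    unfolding runs_def using eval_quote by blast
  then show "\<exists>P' e T. poly_bounded T \<and> runs (P @ P') e (\<lambda>x::'a. c) T"
    using poly_bounded_const by blast
qed (rule poly_bounded_const)

lemma polytime_comp:
  assumes f: "polytime f" and g: "polytime g" shows "polytime (\<lambda>x. g (f x))"
proof (rule polytimeI)
  show "poly_bounded (\<lambda>x. sz (g (f x)))"
    by (rule poly_bounded_comp[OF polytime_sz[OF g] polytime_sz[OF f]])
  fix P
  obtain P1 e1 T1 where 1: "poly_bounded T1" "runs (P @ P1) e1 f T1" using f by (rule polytimeE)
  obtain P2 e2 T2 where 2: "poly_bounded T2" "runs ((P @ P1) @ P2) e2 g T2" using g by (rule polytimeE)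
  have "runs (P @ P1 @ P2) (LetIn e1 e2) (\<lambda>x. g (f x)) (\<lambda>x. T1 x + T2 (f x) + 1)"
    unfolding runs_def
  proof (intro allI)
    fix Q x
    obtain t1 where t1: "t1 \<le> T1 x" "eval ((P @ P1) @ P2 @ Q) [code x] e1 (code (f x)) t1"
      using 1(2) by (rule runsE)
    obtain t2 where t2: "t2 \<le> T2 (f x)" "eval (((P @ P1) @ P2) @ Q) [code (f x)] e2 (code (g (f x))) t2"
      using 2(2) by (rule runsE)
    have "eval ((P @ P1 @ P2) @ Q) [code x] (LetIn e1 e2) (code (g (f x))) (t1 + t2 + 1)"
      by (rule eval_LetI) (use t1(2) eval_in_singleton[OF t2(2)] in auto)
    then show "\<exists>t\<le>T1 x + T2 (f x) + 1. eval ((P @ P1 @ P2) @ Q) [code x] (LetIn e1 e2) (code (g (f x))) t"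
      using t1(1) t2(1) by (intro exI[of _ "t1 + t2 + 1"]) auto
  qed
  moreover have "poly_bounded (\<lambda>x. T1 x + T2 (f x) + 1)"
    by (intro poly_bounded_add poly_bounded_const 1 poly_bounded_comp[OF 2(1)] polytime_sz f)
  ultimately show "\<exists>P' e T. poly_bounded T \<and> runs (P @ P') e (\<lambda>x. g (f x)) T" by blast
qed

lemma polytime_Pair:
  assumes f: "polytime f" and g: "polytime g" shows "polytime (\<lambda>x. (f x, g x))"
proof (rule polytimeI)
  show "poly_bounded (\<lambda>x. sz (f x, g x))"
    by (simp, intro poly_bounded_Suc poly_bounded_add polytime_sz f g)
  fix P
  obtain P1 e1 T1 where 1: "poly_bounded T1" "runs (P @ P1) e1 f T1" using f by (rule polytimeE)
  obtain P2 e2 T2 where 2: "poly_bounded T2" "runs ((P @ P1) @ P2) e2 g T2" using g by (rule polytimeE)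
  have "runs (P @ P1 @ P2) (NodeE e1 e2) (\<lambda>x. (f x, g x)) (\<lambda>x. T1 x + T2 x + 1)"
    unfolding runs_def
  proof (intro allI)
    fix Q x
    obtain t1 where t1: "t1 \<le> T1 x" "eval ((P @ P1) @ P2 @ Q) [code x] e1 (code (f x)) t1"
      using 1(2) by (rule runsE)
    obtain t2 where t2: "t2 \<le> T2 x" "eval (((P @ P1) @ P2) @ Q) [code x] e2 (code (g x)) t2"
      using 2(2) by (rule runsE)
    have "eval ((P @ P1 @ P2) @ Q) [code x] (NodeE e1 e2) (code (f x, g x)) (t1 + t2 + 1)"
      by (rule eval_NodeI) (use t1(2) t2(2) in auto)
    then show "\<exists>t\<le>T1 x + T2 x + 1. eval ((P @ P1 @ P2) @ Q) [code x] (NodeE e1 e2) (code (f x, g x)) t"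
      using t1(1) t2(1) by (intro exI[of _ "t1 + t2 + 1"]) auto
  qed
  moreover have "poly_bounded (\<lambda>x. T1 x + T2 x + 1)"
    by (intro poly_bounded_add poly_bounded_const 1 2)
  ultimately show "\<exists>P' e T. poly_bounded T \<and> runs (P @ P') e (\<lambda>x. (f x, g x)) T" by blast
qed

lemma polytime_fst_prim: "polytime (fst :: 'a::encodable \<times> 'b::encodable \<Rightarrow> 'a)"
proof (rule polytimeI)
  show "poly_bounded (\<lambda>x::'a \<times> 'b. sz (fst x))"
    by (rule poly_bounded_mono[OF poly_bounded_sz]) (simp add: sz_prod)
  fix P
  have "runs (P @ []) (Case (Var 0) LeafE (Var 0)) (fst :: 'a \<times> 'b \<Rightarrow> 'a) (\<lambda>x. 3)"
    unfolding runs_def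
  proof (intro allI)
    fix Q and x :: "'a \<times> 'b"
    have "eval ((P @ []) @ Q) [code x] (Case (Var 0) LeafE (Var 0)) (code (fst x)) (1 + 1 + 1)"
      by (rule eval_Case_NodeI[where l="code (fst x)" and r="code (snd x)"])
        (auto intro!: eval_VarI simp: code_prod_def)
    then show "\<exists>t\<le>3. eval ((P @ []) @ Q) [code x] (Case (Var 0) LeafE (Var 0)) (code (fst x)) t"
      by (intro exI[of _ 3]) (simp add: numeral_3_eq_3)
  qed
  then show "\<exists>P' e T. poly_bounded T \<and> runs (P @ P') e (fst :: 'a \<times> 'b \<Rightarrow> 'a) T"
    using poly_bounded_const by blast
qed

lemma polytime_snd_prim: "polytime (snd :: 'a::encodable \<times> 'b::encodable \<Rightarrow> 'b)"
proof (rule polytimeI)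
  show "poly_bounded (\<lambda>x::'a \<times> 'b. sz (snd x))"
    by (rule poly_bounded_mono[OF poly_bounded_sz]) (simp add: sz_prod)
  fix P
  have "runs (P @ []) (Case (Var 0) LeafE (Var 1)) (snd :: 'a \<times> 'b \<Rightarrow> 'b) (\<lambda>x. 3)"
    unfolding runs_def
  proof (intro allI)
    fix Q and x :: "'a \<times> 'b"
    have "eval ((P @ []) @ Q) [code x] (Case (Var 0) LeafE (Var 1)) (code (snd x)) (1 + 1 + 1)"
      by (rule eval_Case_NodeI[where l="code (fst x)" and r="code (snd x)"])
        (auto intro!: eval_VarI simp: code_prod_def)
    then show "\<exists>t\<le>3. eval ((P @ []) @ Q) [code x] (Case (Var 0) LeafE (Var 1)) (code (snd x)) t"
      by (intro exI[of _ 3]) (simp add: numeral_3_eq_3)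
  qed
  then show "\<exists>P' e T. poly_bounded T \<and> runs (P @ P') e (snd :: 'a \<times> 'b \<Rightarrow> 'b) T"
    using poly_bounded_const by blast
qed

lemmas polytime_fst = polytime_comp[OF _ polytime_fst_prim]
lemmas polytime_snd = polytime_comp[OF _ polytime_snd_prim]

section \<open>Case distinction and recursion schemes\<close>

lemma polytime_case:
  fixes s :: "'a::encodable \<Rightarrow> 'b::encodable" and f F :: "'a \<Rightarrow> 'c::encodable"
    and g :: "'a \<Rightarrow> 'h::encodable \<Rightarrow> 't::encodable \<Rightarrow> 'c"
  assumes s: "polytime s" and f: "polytime f"
    and g: "polytime (\<lambda>p. g (fst p) (fst (snd p)) (snd (snd p)))"
    and Leaf: "\<And>x. code (s x) = Leaf \<Longrightarrow> F x = f x"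
    and Node: "\<And>x. code (s x) \<noteq> Leaf \<Longrightarrow> \<exists>h t. code (s x) = Node (code h) (code t) \<and> F x = g x h t"
  shows "polytime F"
proof (rule polytimeI)
  let ?g = "\<lambda>p. g (fst p) (fst (snd p)) (snd (snd p))"
  have node: "sz (x, h, t) + 2 = sz x + sz (s x) + 3" if "code (s x) = Node (code h) (code t)" for x h t
    using that by (simp add: sz_def)
  obtain cg where cg: "\<And>p. sz (?g p) \<le> (sz p + 2) ^ cg"
    using polytime_sz[OF g] unfolding poly_bounded_def by blast
  have "poly_bounded (\<lambda>x. sz (f x) + (sz x + sz (s x) + 3) ^ cg)"
    by (intro poly_bounded_add poly_bounded_power poly_bounded_const poly_bounded_sz polytime_sz f s)
  then show "poly_bounded (\<lambda>x. sz (F x))"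
  proof (rule poly_bounded_mono)
    fix x
    show "sz (F x) \<le> sz (f x) + (sz x + sz (s x) + 3) ^ cg"
    proof (cases "code (s x) = Leaf")
      case False
      then obtain h t where ht: "code (s x) = Node (code h) (code t)" "F x = g x h t" using Node by blast
      show ?thesis using cg[of "(x, h, t)"] unfolding node[OF ht(1)] ht(2) by simp
    qed (simp add: Leaf)
  qed
  fix P
  obtain P1 e1 T1 where 1: "poly_bounded T1" "runs (P @ P1) e1 s T1" using s by (rule polytimeE)
  obtain P2 e2 T2 where 2: "poly_bounded T2" "runs ((P @ P1) @ P2) e2 f T2" using f by (rule polytimeE)
  obtain P3 e3 T3 where 3: "poly_bounded T3" "runs (((P @ P1) @ P2) @ P3) e3 ?g T3"
    using g by (rule polytimeE)
  obtain c where c: "\<And>p. T3 p \<le> (sz p + 2) ^ c" using 3(1) unfolding poly_bounded_def by blast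
  \<comment> \<open>In the second branch the environment is head, tail, \<open>x\<close>, but
    \<open>e3\<close> was compiled for one argument. So the triple of \<open>x\<close>, head and
    tail is built first and becomes variable 0.\<close>
  let ?e = "Case e1 e2 (LetIn (NodeE (Var 2) (NodeE (Var 0) (Var 1))) e3)"
  let ?T = "\<lambda>x. T1 x + T2 x + (sz x + sz (s x) + 3) ^ c + 10"
  have "runs (P @ P1 @ P2 @ P3) ?e F ?T"
    unfolding runs_def
  proof (intro allI)
    fix Q x
    let ?P = "(P @ P1 @ P2 @ P3) @ Q"
    obtain t1 where t1: "t1 \<le> T1 x" "eval ((P @ P1) @ P2 @ P3 @ Q) [code x] e1 (code (s x)) t1"
      using 1(2) by (rule runsE)
    show "\<exists>t\<le>?T x. eval ?P [code x] ?e (code (F x)) t"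
    proof (cases "code (s x) = Leaf")
      case True
      obtain t2 where t2: "t2 \<le> T2 x" "eval (((P @ P1) @ P2) @ P3 @ Q) [code x] e2 (code (f x)) t2"
        using 2(2) by (rule runsE)
      have "eval ?P [code x] ?e (code (F x)) (t1 + t2 + 1)"
        by (rule eval_Case_LeafI) (use t1 t2 True Leaf[OF True] in auto)
      then show ?thesis using t1(1) t2(1) by (intro exI[of _ "t1 + t2 + 1"]) auto
    next
      case False
      then obtain h t where ht: "code (s x) = Node (code h) (code t)" "F x = g x h t" using Node by blast
      obtain t3 where t3: "t3 \<le> T3 (x, h, t)"
        "eval ((((P @ P1) @ P2) @ P3) @ Q) [code (x, h, t)] e3 (code (?g (x, h, t))) t3"
        using 3(2) by (rule runsE)
      have tup: "eval ?P (code h # code t # [code x]) (NodeE (Var 2) (NodeE (Var 0) (Var 1)))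
          (code (x, h, t)) 5"
        by (rule eval_NodeI[OF eval_VarI eval_NodeI[OF eval_VarI eval_VarI]]) auto
      have "eval ?P [code x] ?e (code (F x)) (t1 + (5 + t3 + 1) + 1)"
      proof (rule eval_Case_NodeI[OF _ _ refl])
        show "eval ?P [code x] e1 (Node (code h) (code t)) t1" using t1 ht by simp
        show "eval ?P (code h # code t # [code x]) (LetIn (NodeE (Var 2) (NodeE (Var 0) (Var 1))) e3) (code (F x))
          (5 + t3 + 1)"
          by (rule eval_LetI[OF tup eval_in_singleton refl]) (use t3 ht in simp)
      qed
      moreover have "t3 \<le> (sz x + sz (s x) + 3) ^ c"
        using t3(1) c[of "(x, h, t)"] unfolding node[OF ht(1)] by linarith
      ultimately show ?thesis using t1(1)
        by (intro exI[of _ "t1 + (5 + t3 + 1) + 1"]) auto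
    qed
  qed
  moreover have "poly_bounded ?T"
    by (intro poly_bounded_add poly_bounded_power poly_bounded_const poly_bounded_sz polytime_sz 1 2 s)
  ultimately show "\<exists>P' e T. poly_bounded T \<and> runs (P @ P') e F T" by blast
qed

lemma polytime_case_list:
  assumes "polytime xs" "polytime f" "polytime (\<lambda>p. g (fst p) (fst (snd p)) (snd (snd p)))"
  shows "polytime (\<lambda>x. case xs x of [] \<Rightarrow> f x | h # t \<Rightarrow> g x h t)"
  by (rule polytime_case[OF assms]) (auto split: list.splits)

text \<open>Arithmetic on unary numbers becomes list processing, and an \<open>n\<close>-fold loop
  becomes a \<open>foldr\<close> over \<open>n\<close> units.\<close>

lemma polytime_as_unit_list: "polytime n \<longleftrightarrow> polytime (\<lambda>x. replicate (n x) ())"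
  using polytime_recode[of n "\<lambda>x. replicate (n x) ()"] polytime_recode[of "\<lambda>x. replicate (n x) ()" n]
  by (auto simp: code_nat_replicate)

lemma polytime_If:
  assumes b: "polytime b" and f: "polytime f" and g: "polytime g"
  shows "polytime (\<lambda>x. if b x then f x else g x)"
proof -
  have "polytime (\<lambda>x. if b x then [()] else [])" by (rule polytime_recode[OF b]) auto
  then have "polytime (\<lambda>x. case if b x then [()] else [] of [] \<Rightarrow> g x | h # t \<Rightarrow> f x)"
    by (rule polytime_case_list) (intro g polytime_comp[OF polytime_fst_prim f])+
  moreover have "(case if b x then [()] else [] of [] \<Rightarrow> g x | h # t \<Rightarrow> f x)
      = (if b x then f x else g x)" for x by auto
  ultimately show ?thesis by simp
qed

lemma polytime_Cons:
  assumes "polytime f" "polytime g" shows "polytime (\<lambda>x. f x # g x)"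
  by (rule polytime_recode[OF polytime_Pair[OF assms]]) simp

lemma polytime_Some:
  assumes "polytime f" shows "polytime (\<lambda>x. Some (f x))"
  by (rule polytime_recode[OF polytime_Pair[OF polytime_const[of "()"] assms]]) simp

text \<open>Function \<open>m\<close> recurses along the list and hands on \<open>x\<close>
  unchanged. The cost of a step is assumed only for accumulators that occur, those of the suffixes
  \<open>zs\<close>, so \<open>K\<close> may depend on a bound for just these.\<close>

lemma eval_foldr:
  assumes m: "m < length P" "P ! m = Case (Var 0) (LetIn (Var 1) e_init)
      (LetIn (Call m [Var 1, Var 3]) (LetIn (NodeE (Var 4) (NodeE (Var 1) (Var 0))) e_step))"
    and init: "eval P [code x] e_init (code a) t_init" "t_init \<le> K"
    and step: "\<And>ys h zs. xs = ys @ h # zs \<Longrightarrow>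
      \<exists>t \<le> K. eval P [code (x, h, foldr f zs a)] e_step (code (f h (foldr f zs a))) t"
  shows "\<exists>t \<le> (length xs + 1) * (K + 20). eval P [code xs, code x] (P ! m) (code (foldr f xs a)) t"
  using step
proof (induction xs)
  case Nil
  have "eval P [code ([]::'b list), code x] (P ! m) (code (foldr f [] a)) (1 + (1 + t_init + 1) + 1)"
    unfolding m(2) using init(1)
    by (intro eval_Case_LeafI[OF eval_VarI eval_LetI[OF eval_VarI eval_in_singleton]]) auto
  then show ?case using init(2) by (intro exI[of _ "1 + (1 + t_init + 1) + 1"]) auto
next
  case (Cons h zs)
  obtain t1 where t1: "t1 \<le> (length zs + 1) * (K + 20)"
    "eval P [code zs, code x] (P ! m) (code (foldr f zs a)) t1"
    using Cons.IH Cons.prems by (metis append_Cons)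
  obtain t2 where t2: "t2 \<le> K" "eval P [code (x, h, foldr f zs a)] e_step (code (f h (foldr f zs a))) t2"
    using Cons.prems[of "[]" h zs] by auto
  let ?env = "[code h, code zs, code (h # zs), code x]"
  have call: "eval P ?env (Call m [Var 1, Var 3]) (code (foldr f zs a)) (5 + t1 + 1)"
    by (rule eval_CallI[OF _ m(1) t1(2)], (rule evals_ConsI evals_NilI eval_VarI refl | simp)+)
  have tup: "eval P (code (foldr f zs a) # ?env) (NodeE (Var 4) (NodeE (Var 1) (Var 0)))
      (code (x, h, foldr f zs a)) 5"
    by (rule eval_NodeI[OF eval_VarI eval_NodeI[OF eval_VarI eval_VarI]]) auto
  have "eval P [code (h # zs), code x] (P ! m) (code (foldr f (h # zs) a))
      (1 + ((5 + t1 + 1) + (5 + t2 + 1) + 1) + 1)"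
    unfolding m(2)
  proof (rule eval_Case_NodeI[OF _ _ refl])
    show "eval P [code (h # zs), code x] (Var 0) (Node (code h) (code zs)) 1"
      by (rule eval_VarI) auto
    show "eval P (code h # code zs # [code (h # zs), code x])
      (LetIn (Call m [Var 1, Var 3]) (LetIn (NodeE (Var 4) (NodeE (Var 1) (Var 0))) e_step))
      (code (foldr f (h # zs) a)) ((5 + t1 + 1) + (5 + t2 + 1) + 1)"
      by (rule eval_LetI[OF call eval_LetI[OF tup eval_in_singleton refl] refl]) (use t2(2) in simp)
  qed
  moreover have "(length (h # zs) + 1) * (K + 20) = (length zs + 1) * (K + 20) + (K + 20)" by simp
  then have "1 + ((5 + t1 + 1) + (5 + t2 + 1) + 1) + 1 \<le> (length (h # zs) + 1) * (K + 20)"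
    using add_le_mono[OF t1(1) t2(1)] by presburger
  ultimately show ?case by blast
qed

text \<open>A polynomial-time step may square its accumulator, so iterating it can leave polynomial
  time. The bound \<open>B\<close> on all intermediate accumulators excludes this; to find it is the
  real work for every loop below.\<close>

lemma polytime_foldr:
  fixes xs :: "'a::encodable \<Rightarrow> 'b::encodable list" and init :: "'a \<Rightarrow> 'c::encodable"
  assumes xs: "polytime xs" and init: "polytime init"
    and step: "polytime (\<lambda>p. f (fst p) (fst (snd p)) (snd (snd p)))"
    and B: "poly_bounded B" "\<And>x ys zs. xs x = ys @ zs \<Longrightarrow> sz (foldr (f x) zs (init x)) \<le> B x"
  shows "polytime (\<lambda>x. foldr (f x) (xs x) (init x))" (is "polytime ?F")
proof (rule polytimeI)
  show "poly_bounded (\<lambda>x. sz (?F x))"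
    by (rule poly_bounded_mono[OF B(1)]) (use B(2)[of _ "[]"] in auto)
  fix P
  let ?f = "\<lambda>p. f (fst p) (fst (snd p)) (snd (snd p))"
  obtain P1 e1 T1 where 1: "poly_bounded T1" "runs (P @ P1) e1 xs T1" using xs by (rule polytimeE)
  obtain P2 e2 T2 where 2: "poly_bounded T2" "runs ((P @ P1) @ P2) e2 init T2" using init by (rule polytimeE)
  obtain P3 e3 T3 where 3: "poly_bounded T3" "runs (((P @ P1) @ P2) @ P3) e3 ?f T3"
    using step by (rule polytimeE)
  obtain c where c: "\<And>p. T3 p \<le> (sz p + 2) ^ c" using 3(1) unfolding poly_bounded_def by blast
  let ?P = "P @ P1 @ P2 @ P3"
  let ?m = "length ?P"
  let ?body = "Case (Var 0) (LetIn (Var 1) e2)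
      (LetIn (Call ?m [Var 1, Var 3]) (LetIn (NodeE (Var 4) (NodeE (Var 1) (Var 0))) e3))"
  let ?K = "\<lambda>x. T2 x + (sz x + sz (xs x) + B x + 4) ^ c"
  let ?T = "\<lambda>x. T1 x + (sz (xs x) + 1) * (?K x + 20) + 10"
  let ?e = "LetIn e1 (Call ?m [Var 0, Var 1])"
  have "runs (P @ P1 @ P2 @ P3 @ [?body]) ?e ?F ?T"
    unfolding runs_def
  proof (intro allI)
    fix Q x
    let ?PQ = "(P @ P1 @ P2 @ P3 @ [?body]) @ Q"
    obtain t1 where t1: "t1 \<le> T1 x" "eval ((P @ P1) @ P2 @ P3 @ [?body] @ Q) [code x] e1 (code (xs x)) t1"
      using 1(2) by (rule runsE)
    obtain t2 where t2: "t2 \<le> T2 x" "eval (((P @ P1) @ P2) @ P3 @ [?body] @ Q) [code x] e2 (code (init x)) t2"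
      using 2(2) by (rule runsE)
    have m: "?m < length ?PQ" "?PQ ! ?m = ?body" by (auto simp: nth_append)
    have "\<exists>t \<le> (length (xs x) + 1) * (?K x + 20). eval ?PQ [code (xs x), code x] (?PQ ! ?m) (code (?F x)) t"
    proof (rule eval_foldr[OF m])
      show "eval ?PQ [code x] e2 (code (init x)) t2" using t2 by simp
      show "t2 \<le> ?K x" using t2 by simp
    next
      fix ys h zs assume e: "xs x = ys @ h # zs"
      let ?acc = "foldr (f x) zs (init x)"
      obtain t3 where t3: "t3 \<le> T3 (x, h, ?acc)"
        "eval ((((P @ P1) @ P2) @ P3) @ [?body] @ Q) [code (x, h, ?acc)] e3 (code (?f (x, h, ?acc))) t3"
        using 3(2) by (rule runsE)
      have "sz ?acc \<le> B x" using B(2)[of x "ys @ [h]" zs] e by simp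
      moreover have "sz h < sz (xs x)" by (rule sz_member) (simp add: e)
      ultimately have "(sz (x, h, ?acc) + 2) ^ c \<le> (sz x + sz (xs x) + B x + 4) ^ c"
        by (intro power_mono) auto
      then have "t3 \<le> ?K x" using t3(1) c[of "(x, h, ?acc)"] by linarith
      then show "\<exists>t \<le> ?K x. eval ?PQ [code (x, h, ?acc)] e3 (code (f x h ?acc)) t"
        using t3(2) by auto
    qed
    then obtain t3 where t3: "t3 \<le> (length (xs x) + 1) * (?K x + 20)"
      "eval ?PQ [code (xs x), code x] (?PQ ! ?m) (code (?F x)) t3" by blast
    have "eval ?PQ [code x] ?e (code (?F x)) (t1 + (5 + t3 + 1) + 1)"
    proof (rule eval_LetI[OF _ _ refl])
      show "eval ?PQ [code x] e1 (code (xs x)) t1" using t1 by simp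
      show "eval ?PQ (code (xs x) # [code x]) (Call ?m [Var 0, Var 1]) (code (?F x)) (5 + t3 + 1)"
        by (rule eval_CallI[OF _ m(1) t3(2)], (rule evals_ConsI evals_NilI eval_VarI refl | simp)+)
    qed
    moreover have "t3 \<le> (sz (xs x) + 1) * (?K x + 20)"
      using t3(1) mult_le_mono1[of "length (xs x) + 1" "sz (xs x) + 1" "?K x + 20"] length_le_sz[of "xs x"]
      by linarith
    ultimately show "\<exists>t\<le>?T x. eval ?PQ [code x] ?e (code (?F x)) t"
      using t1(1) by (intro exI[of _ "t1 + (5 + t3 + 1) + 1"]) auto
  qed
  moreover have "poly_bounded ?T"
    by (intro poly_bounded_add poly_bounded_mult poly_bounded_power poly_bounded_const poly_bounded_sz
        polytime_sz 1 2 xs B(1))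
  ultimately show "\<exists>P' e T. poly_bounded T \<and> runs (P @ P') e ?F T" by blast
qed

text \<open>The measures of the two parts add up to less than the measure of the whole. Hence the
  recursion tree below \<open>a\<close> has at most \<open>2 * \<mu> a + 1\<close> nodes, and each
  of them costs two evaluations of at most \<open>K\<close> and a constant overhead.\<close>

lemma eval_divide:
  assumes m: "m < length P" "P ! m = LetIn (NodeE (Var 1) (Var 0)) (LetIn e_split
      (Case (Var 0) (LetIn (Var 1) e_base)
        (Case (Var 1) LeafE (LetIn (Call m [Var 0, Var 7]) (LetIn (Call m [Var 2, Var 8])
          (LetIn (NodeE (Var 9) (NodeE (Var 8) (NodeE (Var 5) (NodeE (Var 1) (Var 0))))) e_comb))))))"
    and F: "\<And>a. a \<in> I \<Longrightarrow> F a = (case split a of None \<Rightarrow> base a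
        | Some lr \<Rightarrow> comb a lr (F (fst lr)) (F (snd lr)))"
    and I: "\<And>a l r. a \<in> I \<Longrightarrow> split a = Some (l, r) \<Longrightarrow> l \<in> I \<and> r \<in> I \<and> \<mu> l + \<mu> r < \<mu> a"
    and split: "\<And>a. a \<in> I \<Longrightarrow> \<exists>t \<le> K. eval P [code (g, a)] e_split (code (split a)) t"
    and base: "\<And>a. a \<in> I \<Longrightarrow> \<exists>t \<le> K. eval P [code (g, a)] e_base (code (base a)) t"
    and comb: "\<And>a l r. a \<in> I \<Longrightarrow> l \<in> I \<Longrightarrow> r \<in> I \<Longrightarrow> \<exists>t \<le> K.
        eval P [code (g, a, (l, r), F l, F r)] e_comb (code (comb a (l, r) (F l) (F r))) t"
  shows "a \<in> I \<Longrightarrow> \<exists>t \<le> (2 * \<mu> a + 1) * (2 * K + 60). eval P [code a, code g] (P ! m) (code (F a)) t"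
proof (induction "\<mu> a" arbitrary: a rule: less_induct)
  case less
  obtain t1 where t1: "t1 \<le> K" "eval P [code (g, a)] e_split (code (split a)) t1"
    using split less.prems by blast
  have tup: "eval P [code a, code g] (NodeE (Var 1) (Var 0)) (code (g, a)) 3"
    by (rule eval_NodeI[OF eval_VarI eval_VarI]) auto
  show ?case
  proof (cases "split a")
    case None
    obtain t2 where t2: "t2 \<le> K" "eval P [code (g, a)] e_base (code (base a)) t2"
      using base less.prems by blast
    have "eval P [code a, code g] (P ! m) (code (F a)) (3 + (t1 + (1 + (1 + t2 + 1) + 1) + 1) + 1)"
      unfolding m(2)
    proof (rule eval_LetI[OF tup _ refl], rule eval_LetI[OF _ _ refl], rule eval_in_singleton, rule t1,
        rule eval_Case_LeafI[OF _ _ refl])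
      show "eval P (code (split a) # code (g, a) # [code a, code g]) (Var 0) Leaf 1"
        by (rule eval_VarI) (auto simp: None)
      show "eval P (code (split a) # code (g, a) # [code a, code g]) (LetIn (Var 1) e_base) (code (F a)) (1 + t2 + 1)"
        using t2 F[OF less.prems] None by (intro eval_LetI[OF eval_VarI eval_in_singleton]) auto
    qed
    then show ?thesis using t1 t2 by (intro exI[of _ "3 + (t1 + (1 + (1 + t2 + 1) + 1) + 1) + 1"]) auto
  next
    case (Some lr)
    obtain l r where lr: "lr = (l, r)" by fastforce
    have I': "l \<in> I" "r \<in> I" "\<mu> l + \<mu> r < \<mu> a" using I[OF less.prems] Some lr by auto
    obtain tl where tl: "tl \<le> (2 * \<mu> l + 1) * (2 * K + 60)" "eval P [code l, code g] (P ! m) (code (F l)) tl"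
      using less.hyps[of l] I' by auto
    obtain tr where tr: "tr \<le> (2 * \<mu> r + 1) * (2 * K + 60)" "eval P [code r, code g] (P ! m) (code (F r)) tr"
      using less.hyps[of r] I' by auto
    obtain t2 where t2: "t2 \<le> K"
      "eval P [code (g, a, (l, r), F l, F r)] e_comb (code (comb a (l, r) (F l) (F r))) t2"
      using comb less.prems I' by blast
    \<comment> \<open>The two \<open>Case\<close>s unpack \<open>Some\<close> and the pair and push
      two values each. So \<open>g\<close> is variable 7 in \<open>?e2\<close>, and variable 8 and
      then 9 after the results of the two calls have been pushed.\<close>
    let ?e0 = "[code (split a), code (g, a), code a, code g]"
    let ?e1 = "Leaf # code lr # ?e0"
    let ?e2 = "code l # code r # ?e1"
    have c1: "eval P ?e2 (Call m [Var 0, Var 7]) (code (F l)) (5 + tl + 1)"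
      by (rule eval_CallI[OF _ m(1) tl(2)], (rule evals_ConsI evals_NilI eval_VarI refl | simp)+)
    have c2: "eval P (code (F l) # ?e2) (Call m [Var 2, Var 8]) (code (F r)) (5 + tr + 1)"
      by (rule eval_CallI[OF _ m(1) tr(2)], (rule evals_ConsI evals_NilI eval_VarI refl | simp)+)
    have c3: "eval P (code (F r) # code (F l) # ?e2)
      (NodeE (Var 9) (NodeE (Var 8) (NodeE (Var 5) (NodeE (Var 1) (Var 0))))) (code (g, a, (l, r), F l, F r)) 9"
      by ((rule eval_NodeI eval_VarI refl | simp add: lr)+)
    let ?t = "3 + (t1 + (1 + (1 + ((5 + tl + 1) + ((5 + tr + 1) + (9 + t2 + 1) + 1) + 1) + 1) + 1) + 1) + 1"
    have "eval P [code a, code g] (P ! m) (code (F a)) ?t"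
      unfolding m(2)
    proof (rule eval_LetI[OF tup _ refl], rule eval_LetI[OF _ _ refl], rule eval_in_singleton, rule t1,
        rule eval_Case_NodeI[OF _ _ refl])
      show "eval P ?e0 (Var 0) (Node Leaf (code lr)) 1" by (rule eval_VarI) (auto simp: Some)
      show "eval P ?e1 (Case (Var 1) LeafE (LetIn (Call m [Var 0, Var 7]) (LetIn (Call m [Var 2, Var 8])
          (LetIn (NodeE (Var 9) (NodeE (Var 8) (NodeE (Var 5) (NodeE (Var 1) (Var 0))))) e_comb))))
         (code (F a)) (1 + ((5 + tl + 1) + ((5 + tr + 1) + (9 + t2 + 1) + 1) + 1) + 1)"
      proof (rule eval_Case_NodeI[OF _ _ refl])
        show "eval P ?e1 (Var 1) (Node (code l) (code r)) 1" by (rule eval_VarI) (auto simp: lr)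
        have "F a = comb a (l, r) (F l) (F r)" using F[OF less.prems] Some lr by simp
        then show "eval P ?e2 (LetIn (Call m [Var 0, Var 7]) (LetIn (Call m [Var 2, Var 8])
          (LetIn (NodeE (Var 9) (NodeE (Var 8) (NodeE (Var 5) (NodeE (Var 1) (Var 0))))) e_comb)))
         (code (F a)) ((5 + tl + 1) + ((5 + tr + 1) + (9 + t2 + 1) + 1) + 1)"
          by (intro eval_LetI[OF c1 eval_LetI[OF c2 eval_LetI[OF c3 eval_in_singleton refl] refl] refl])
            (use t2(2) in simp)
      qed
    qed
    moreover have "?t \<le> (2 * \<mu> a + 1) * (2 * K + 60)"
    proof -
      have "?t \<le> (2 * \<mu> l + 1) * (2 * K + 60) + (2 * \<mu> r + 1) * (2 * K + 60) + (2 * K + 60)"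
        using add_le_mono[OF add_le_mono[OF tl(1) tr(1)] add_le_mono[OF t1(1) t2(1)]] by presburger
      also have "\<dots> = (2 * (\<mu> l + \<mu> r + 1) + 1) * (2 * K + 60)" by (simp add: algebra_simps)
      also have "\<dots> \<le> (2 * \<mu> a + 1) * (2 * K + 60)" using I'(3) by (intro mult_le_mono1) auto
      finally show ?thesis .
    qed
    ultimately show ?thesis by blast
  qed
qed

text \<open>All bounds refer to the global data \<open>g\<close>, since a bound relative to the
  parent would compound along a path of the recursion. The invariant \<open>I g\<close> carries them
  from the root to all arguments that occur.\<close>

lemma polytime_divide:
  fixes F :: "'g::encodable \<Rightarrow> 'a::encodable \<Rightarrow> 'b::encodable"
  assumes split: "polytime (\<lambda>p. split (fst p) (snd p))"
    and base: "polytime (\<lambda>p. base (fst p) (snd p))"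
    and comb: "polytime (\<lambda>p. comb (fst p) (fst (snd p)) (fst (snd (snd p)))
        (fst (snd (snd (snd p)))) (snd (snd (snd (snd p)))))"
    and init: "polytime init" "\<And>g. init g \<in> I g"
    and F: "\<And>g a. a \<in> I g \<Longrightarrow> F g a = (case split g a of None \<Rightarrow> base g a
        | Some lr \<Rightarrow> comb g a lr (F g (fst lr)) (F g (snd lr)))"
    and I: "\<And>g a l r. a \<in> I g \<Longrightarrow> split g a = Some (l, r) \<Longrightarrow> l \<in> I g \<and> r \<in> I g \<and> \<mu> l + \<mu> r < \<mu> a"
    and B: "poly_bounded B" "\<And>g a. a \<in> I g \<Longrightarrow> \<mu> a \<le> B g \<and> sz a \<le> B g \<and> sz (F g a) \<le> B g"
  shows "polytime (\<lambda>g. F g (init g))" (is "polytime ?F")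
proof (rule polytimeI)
  show "poly_bounded (\<lambda>g. sz (?F g))"
    by (rule poly_bounded_mono[OF B(1)]) (use B(2) init(2) in auto)
  fix P
  let ?split = "\<lambda>p. split (fst p) (snd p)" and ?base = "\<lambda>p. base (fst p) (snd p)"
  let ?comb = "\<lambda>p. comb (fst p) (fst (snd p)) (fst (snd (snd p)))
        (fst (snd (snd (snd p)))) (snd (snd (snd (snd p))))"
  obtain P1 e1 T1 where 1: "poly_bounded T1" "runs (P @ P1) e1 init T1" using init(1) by (rule polytimeE)
  obtain P2 e2 T2 where 2: "poly_bounded T2" "runs ((P @ P1) @ P2) e2 ?split T2" using split by (rule polytimeE)
  obtain P3 e3 T3 where 3: "poly_bounded T3" "runs (((P @ P1) @ P2) @ P3) e3 ?base T3"
    using base by (rule polytimeE)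
  obtain P4 e4 T4 where 4: "poly_bounded T4" "runs ((((P @ P1) @ P2) @ P3) @ P4) e4 ?comb T4"
    using comb by (rule polytimeE)
  obtain c2 where c2: "\<And>p. T2 p \<le> (sz p + 2) ^ c2" using 2(1) unfolding poly_bounded_def by blast
  obtain c3 where c3: "\<And>p. T3 p \<le> (sz p + 2) ^ c3" using 3(1) unfolding poly_bounded_def by blast
  obtain c4 where c4: "\<And>p. T4 p \<le> (sz p + 2) ^ c4" using 4(1) unfolding poly_bounded_def by blast
  let ?m = "length (P @ P1 @ P2 @ P3 @ P4)"
  let ?body = "LetIn (NodeE (Var 1) (Var 0)) (LetIn e2
      (Case (Var 0) (LetIn (Var 1) e3)
        (Case (Var 1) LeafE (LetIn (Call ?m [Var 0, Var 7]) (LetIn (Call ?m [Var 2, Var 8])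
          (LetIn (NodeE (Var 9) (NodeE (Var 8) (NodeE (Var 5) (NodeE (Var 1) (Var 0))))) e4))))))"
  \<comment> \<open>The largest argument consists of \<open>g\<close> and five values of size at
    most \<open>B g\<close>; the 10 covers the pairing and the \<open>+ 2\<close> of
    \<open>poly_bounded\<close>.\<close>
  let ?S = "\<lambda>g. sz g + 5 * B g + 10"
  let ?K = "\<lambda>g. ?S g ^ c2 + ?S g ^ c3 + ?S g ^ c4"
  let ?T = "\<lambda>g. T1 g + (2 * B g + 1) * (2 * ?K g + 60) + 10"
  let ?e = "LetIn e1 (Call ?m [Var 0, Var 1])"
  have "runs (P @ P1 @ P2 @ P3 @ P4 @ [?body]) ?e ?F ?T"
    unfolding runs_def
  proof (intro allI)
    fix Q g
    let ?PQ = "(P @ P1 @ P2 @ P3 @ P4 @ [?body]) @ Q"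
    obtain t1 where t1: "t1 \<le> T1 g" "eval ((P @ P1) @ P2 @ P3 @ P4 @ [?body] @ Q) [code g] e1 (code (init g)) t1"
      using 1(2) by (rule runsE)
    have m: "?m < length ?PQ" "?PQ ! ?m = ?body" by (auto simp: nth_append)
    have K: "t \<le> ?K g" if "t \<le> T" "T \<le> (s + 2) ^ c" "s + 2 \<le> ?S g" "c \<in> {c2, c3, c4}" for t T s c
    proof -
      have "(s + 2) ^ c \<le> ?S g ^ c" using that(3) by (intro power_mono) auto
      also have "\<dots> \<le> ?K g" using that(4) by auto
      finally show ?thesis using that by linarith
    qed
    have "\<exists>t \<le> (2 * \<mu> (init g) + 1) * (2 * ?K g + 60). eval ?PQ [code (init g), code g] (?PQ ! ?m) (code (?F g)) t"
    proof (rule eval_divide[OF m, where I="I g" and split="split g" and base="base g" and comb="comb g" and F="F g"])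
      fix a assume a: "a \<in> I g"
      have s: "sz (g, a) + 2 \<le> ?S g" using B(2)[OF a] by simp
      obtain t where t: "t \<le> T2 (g, a)"
        "eval (((P @ P1) @ P2) @ P3 @ P4 @ [?body] @ Q) [code (g, a)] e2 (code (?split (g, a))) t"
        using 2(2) by (rule runsE)
      show "\<exists>t \<le> ?K g. eval ?PQ [code (g, a)] e2 (code (split g a)) t"
        using t(2) K[OF t(1) c2 s] by auto
      obtain t where t: "t \<le> T3 (g, a)"
        "eval ((((P @ P1) @ P2) @ P3) @ P4 @ [?body] @ Q) [code (g, a)] e3 (code (?base (g, a))) t"
        using 3(2) by (rule runsE)
      show "\<exists>t \<le> ?K g. eval ?PQ [code (g, a)] e3 (code (base g a)) t"
        using t(2) K[OF t(1) c3 s] by auto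
      fix l r assume lr: "l \<in> I g" "r \<in> I g"
      let ?p = "(g, a, (l, r), F g l, F g r)"
      have s: "sz ?p + 2 \<le> ?S g" using B(2)[OF a] B(2)[OF lr(1)] B(2)[OF lr(2)] by simp
      obtain t where t: "t \<le> T4 ?p"
        "eval (((((P @ P1) @ P2) @ P3) @ P4) @ [?body] @ Q) [code ?p] e4 (code (?comb ?p)) t"
        using 4(2) by (rule runsE)
      show "\<exists>t \<le> ?K g. eval ?PQ [code ?p] e4 (code (comb g a (l, r) (F g l) (F g r))) t"
        using t(2) K[OF t(1) c4 s] by auto
    qed (fact F | use I in blast | fact init(2))+
    then obtain t3 where t3: "t3 \<le> (2 * \<mu> (init g) + 1) * (2 * ?K g + 60)"
      "eval ?PQ [code (init g), code g] (?PQ ! ?m) (code (?F g)) t3" by blast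
    have "eval ?PQ [code g] ?e (code (?F g)) (t1 + (5 + t3 + 1) + 1)"
    proof (rule eval_LetI[OF _ _ refl])
      show "eval ?PQ [code g] e1 (code (init g)) t1" using t1 by simp
      show "eval ?PQ (code (init g) # [code g]) (Call ?m [Var 0, Var 1]) (code (?F g)) (5 + t3 + 1)"
        by (rule eval_CallI[OF _ m(1) t3(2)], (rule evals_ConsI evals_NilI eval_VarI refl | simp)+)
    qed
    moreover have "t3 \<le> (2 * B g + 1) * (2 * ?K g + 60)"
      using t3(1) mult_le_mono1[of "2 * \<mu> (init g) + 1" "2 * B g + 1" "2 * ?K g + 60"] B(2)[OF init(2)[of g]]
      by linarith
    ultimately show "\<exists>t\<le>?T g. eval ?PQ [code g] ?e (code (?F g)) t"
      using t1(1) by (intro exI[of _ "t1 + (5 + t3 + 1) + 1"]) auto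
  qed
  moreover have "poly_bounded ?T"
    by (intro poly_bounded_add poly_bounded_mult poly_bounded_power poly_bounded_const poly_bounded_sz
        polytime_sz 1 B(1))
  ultimately show "\<exists>P' e T. poly_bounded T \<and> runs (P @ P') e ?F T" by blast
qed

section \<open>A library of polynomial-time functions\<close>

named_theorems polytime_intros
named_theorems poly_bounded_intros

lemmas [polytime_intros] = polytime_id polytime_const polytime_Pair polytime_fst polytime_snd
  polytime_case_list polytime_If polytime_Cons polytime_Some
lemmas [poly_bounded_intros] = poly_bounded_const poly_bounded_add poly_bounded_mult poly_bounded_power
  poly_bounded_Suc poly_bounded_sz polytime_sz

lemma polytime_Not [polytime_intros]: "polytime b \<Longrightarrow> polytime (\<lambda>x. \<not> b x)"
  by (rule polytime_recode[OF polytime_If[OF _ polytime_const[of False] polytime_const[of True]]]) auto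

lemma polytime_conj [polytime_intros]:
  assumes "polytime b" "polytime c" shows "polytime (\<lambda>x. b x \<and> c x)"
  by (rule polytime_recode[OF polytime_If[OF assms polytime_const[of False]]]) auto

lemma polytime_disj [polytime_intros]:
  assumes "polytime b" "polytime c" shows "polytime (\<lambda>x. b x \<or> c x)"
  by (rule polytime_recode[OF polytime_If[OF assms(1) polytime_const[of True] assms(2)]]) auto

lemma polytime_imp [polytime_intros]:
  assumes "polytime b" "polytime c" shows "polytime (\<lambda>x. b x \<longrightarrow> c x)"
  by (rule polytime_recode[OF polytime_If[OF assms polytime_const[of True]]]) auto

lemma polytime_eq_bool:
  assumes "polytime b" "polytime c" shows "polytime (\<lambda>x. b x = (c x :: bool))"
proof -
  have "polytime (\<lambda>x. if b x then c x else \<not> c x)" by (intro polytime_intros assms)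
  then show ?thesis by (rule polytime_recode) auto
qed

text \<open>A Boolean accumulator has size at most 1, so these loops get their bound for
  free.\<close>

lemma polytime_foldr_bool [polytime_intros]:
  assumes "polytime xs" "polytime init" "polytime (\<lambda>p. f (fst p) (fst (snd p)) (snd (snd p)))"
  shows "polytime (\<lambda>x. foldr (f x) (xs x) (init x) :: bool)"
  by (rule polytime_foldr[OF assms poly_bounded_const[of 1] sz_bool])

lemma polytime_Ball [polytime_intros]:
  assumes "polytime xs" "polytime (\<lambda>p. b (fst p) (snd p))"
  shows "polytime (\<lambda>x. \<forall>y\<in>set (xs x). b x y)"
proof -
  have "polytime (\<lambda>x. foldr (\<lambda>y acc. b x y \<and> acc) (xs x) True)"
    using polytime_comp[OF polytime_Pair[OF polytime_fst_prim polytime_fst[OF polytime_snd_prim]] assms(2)]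
    by (intro polytime_intros assms) auto
  moreover have "foldr (\<lambda>y acc. b x y \<and> acc) ys True \<longleftrightarrow> (\<forall>y\<in>set ys. b x y)" for x ys
    by (induction ys) auto
  ultimately show ?thesis by simp
qed

lemma polytime_Bex [polytime_intros]:
  assumes "polytime xs" "polytime (\<lambda>p. b (fst p) (snd p))"
  shows "polytime (\<lambda>x. \<exists>y\<in>set (xs x). b x y)"
proof -
  have "polytime (\<lambda>x. \<not> (\<forall>y\<in>set (xs x). \<not> b x y))" by (intro polytime_intros assms)
  then show ?thesis by (rule polytime_recode) auto
qed

lemma polytime_map [polytime_intros]:
  assumes xs: "polytime xs" and f: "polytime (\<lambda>p. f (fst p) (snd p))"
  shows "polytime (\<lambda>x. map (f x) (xs x))"
proof -
  obtain c where c: "\<And>p. sz (f (fst p) (snd p)) \<le> (sz p + 2) ^ c"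
    using polytime_sz[OF f] unfolding poly_bounded_def by blast
  let ?B = "\<lambda>x. sz (xs x) * ((sz x + sz (xs x) + 3) ^ c + 1)"
  have "polytime (\<lambda>x. foldr (\<lambda>y acc. f x y # acc) (xs x) [])"
  proof (rule polytime_foldr[where B="?B"])
    show "polytime (\<lambda>p. f (fst p) (fst (snd p)) # snd (snd p))"
      using polytime_comp[OF polytime_Pair[OF polytime_fst_prim polytime_fst[OF polytime_snd_prim]] f]
      by (intro polytime_intros) auto
    show "poly_bounded ?B" by (intro poly_bounded_intros xs)
    fix x ys zs assume e: "xs x = ys @ zs"
    have "foldr (\<lambda>y acc. f x y # acc) zs [] = map (f x) zs" by (induction zs) auto
    moreover have "sz (map (f x) zs) \<le> length zs * ((sz x + sz (xs x) + 3) ^ c + 1)"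
    proof -
      have "sz (f x h) \<le> (sz x + sz (xs x) + 3) ^ c" if "h \<in> set zs" for h
      proof -
        have "sz h < sz (xs x)" using that by (intro sz_member) (auto simp: e)
        then have "(sz (x, h) + 2) ^ c \<le> (sz x + sz (xs x) + 3) ^ c" by (intro power_mono) auto
        then show ?thesis using c[of "(x, h)"] by simp
      qed
      then show ?thesis using sz_list_le[of "map (f x) zs" "(sz x + sz (xs x) + 3) ^ c"] by auto
    qed
    moreover have "length zs \<le> sz (xs x)" using length_le_sz[of zs] e by simp
    ultimately show "sz (foldr (\<lambda>y acc. f x y # acc) zs []) \<le> ?B x"
      by (metis le_trans mult_le_mono1)
  qed (intro polytime_intros xs)+
  moreover have "foldr (\<lambda>y acc. f x y # acc) ys [] = map (f x) ys" for x ys by (induction ys) auto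
  ultimately show ?thesis by simp
qed

lemma polytime_append [polytime_intros]:
  assumes "polytime xs" "polytime ys"
  shows "polytime (\<lambda>x. xs x @ ys x)"
proof -
  have "polytime (\<lambda>x. foldr (\<lambda>y acc. y # acc) (xs x) (ys x))"
  proof (rule polytime_foldr[where B="\<lambda>x. sz (xs x) + sz (ys x)"])
    fix x us vs assume "xs x = us @ vs"
    moreover have "foldr (\<lambda>y acc. y # acc) vs (ys x) = vs @ ys x" by (induction vs) auto
    ultimately show "sz (foldr (\<lambda>y acc. y # acc) vs (ys x)) \<le> sz (xs x) + sz (ys x)" by simp
  qed (intro polytime_intros poly_bounded_intros assms)+
  moreover have "foldr (\<lambda>y acc. y # acc) us vs = us @ vs" for us vs :: "'b list" by (induction us) auto
  ultimately show ?thesis by simp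
qed

lemma sz_filter: "sz (filter P xs) \<le> sz xs"
  by (induction xs) auto

lemma polytime_filter [polytime_intros]:
  assumes xs: "polytime xs" and f: "polytime (\<lambda>p. f (fst p) (snd p))"
  shows "polytime (\<lambda>x. filter (f x) (xs x))"
proof -
  have e: "foldr (\<lambda>y acc. if f x y then y # acc else acc) ys [] = filter (f x) ys" for x ys
    by (induction ys) auto
  have "polytime (\<lambda>x. foldr (\<lambda>y acc. if f x y then y # acc else acc) (xs x) [])"
  proof (rule polytime_foldr[where B="\<lambda>x. sz (xs x)"])
    show "polytime (\<lambda>p. if f (fst p) (fst (snd p)) then fst (snd p) # snd (snd p) else snd (snd p))"
      using polytime_comp[OF polytime_Pair[OF polytime_fst_prim polytime_fst[OF polytime_snd_prim]] f]
      by (intro polytime_intros) auto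
    fix x ys zs assume "xs x = ys @ zs"
    then show "sz (foldr (\<lambda>y acc. if f x y then y # acc else acc) zs []) \<le> sz (xs x)"
      using sz_filter[of "f x" zs] by (simp add: e)
  qed (intro polytime_intros poly_bounded_intros xs)+
  then show ?thesis by (simp only: e length_replicate minus_nat.diff_0)
qed

lemma sz_concat: "sz (concat xs) \<le> sz xs"
  by (induction xs) auto

lemma polytime_concat [polytime_intros]:
  assumes xs: "polytime xs" shows "polytime (\<lambda>x. concat (xs x))"
proof -
  have e: "foldr (@) ys [] = concat ys" for ys :: "'b list list" by (induction ys) auto
  have "polytime (\<lambda>x. foldr (\<lambda>y acc. y @ acc) (xs x) [])"
  proof (rule polytime_foldr[where B="\<lambda>x. sz (xs x)"])
    fix x ys zs assume "xs x = ys @ zs"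
    then show "sz (foldr (@) zs []) \<le> sz (xs x)"
      using sz_concat[of zs] by (simp add: e)
  qed (intro polytime_intros poly_bounded_intros xs)+
  then show ?thesis by (simp only: e length_replicate minus_nat.diff_0)
qed

lemma polytime_length [polytime_intros]:
  assumes "polytime xs" shows "polytime (\<lambda>x. length (xs x))"
  unfolding polytime_as_unit_list map_replicate_const[symmetric] by (intro polytime_intros assms)

lemma polytime_add [polytime_intros]:
  assumes "polytime m" "polytime n" shows "polytime (\<lambda>x. m x + n x :: nat)"
  unfolding polytime_as_unit_list replicate_add using assms
  by (auto intro!: polytime_intros simp: polytime_as_unit_list[symmetric])

lemma polytime_tl [polytime_intros]:
  assumes "polytime xs" shows "polytime (\<lambda>x. tl (xs x))"
  unfolding tl_def by (intro polytime_intros assms)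

lemma polytime_pred:
  assumes "polytime n" shows "polytime (\<lambda>x. n x - Suc 0)"
proof -
  have "polytime (\<lambda>x. tl (replicate (n x) ()))"
    using assms by (intro polytime_intros) (simp add: polytime_as_unit_list)
  then show ?thesis by (simp add: polytime_as_unit_list tl_replicate)
qed

lemma polytime_diff [polytime_intros]:
  assumes "polytime m" "polytime n" shows "polytime (\<lambda>x. m x - n x :: nat)"
proof -
  have e: "foldr (\<lambda>y a. a - Suc 0) us a = a - length us" for us :: "unit list" and a
    by (induction us) auto
  have "polytime (\<lambda>x. foldr (\<lambda>y a. a - Suc 0) (replicate (n x) ()) (m x))"
  proof (rule polytime_foldr[where B="\<lambda>x. sz (m x)"])
    show "polytime (\<lambda>x. replicate (n x) ())" using assms(2) by (simp add: polytime_as_unit_list)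
  qed (intro polytime_intros polytime_pred poly_bounded_intros assms | simp add: e)+
  then show ?thesis by (simp only: e length_replicate minus_nat.diff_0)
qed

lemma polytime_mult [polytime_intros]:
  assumes "polytime m" "polytime n" shows "polytime (\<lambda>x. m x * n x :: nat)"
proof -
  have e: "foldr (\<lambda>y a. b + a) us 0 = length us * b" for us :: "unit list" and b
    by (induction us) auto
  have "polytime (\<lambda>x. foldr (\<lambda>y a. n x + a) (replicate (m x) ()) 0)"
  proof (rule polytime_foldr[where B="\<lambda>x. sz (m x) * sz (n x)"])
    show "polytime (\<lambda>x. replicate (m x) ())" using assms(1) by (simp add: polytime_as_unit_list)
    show "polytime (\<lambda>p :: 'a \<times> unit \<times> nat. n (fst p) + snd (snd p))"
      by (intro polytime_intros polytime_comp[OF polytime_fst_prim assms(2)])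
    fix x and us vs :: "unit list" assume "replicate (m x) () = us @ vs"
    then have "m x = length us + length vs" by (metis length_append length_replicate)
    then show "sz (foldr (\<lambda>y a. n x + a) vs 0) \<le> sz (m x) * sz (n x)" by (simp add: e)
  qed (intro polytime_intros poly_bounded_intros assms)+
  then show ?thesis by (simp only: e length_replicate minus_nat.diff_0)
qed

lemma polytime_power:
  assumes "polytime n" shows "polytime (\<lambda>x. n x ^ c :: nat)"
  by (induction c) (auto intro!: polytime_intros assms)

lemma polytime_le [polytime_intros]:
  assumes "polytime m" "polytime n" shows "polytime (\<lambda>x. m x \<le> (n x :: nat))"
proof -
  have "polytime (\<lambda>x. case replicate (m x - n x) () of [] \<Rightarrow> True | h # t \<Rightarrow> False)"
    by (intro polytime_intros, unfold polytime_as_unit_list[symmetric], intro polytime_intros assms)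
  moreover have "(case replicate (m x - n x) () of [] \<Rightarrow> True | h # t \<Rightarrow> False) \<longleftrightarrow> m x \<le> n x" for x
    by (cases "m x - n x") auto
  ultimately show ?thesis by simp
qed

lemma polytime_eq_nat [polytime_intros]:
  assumes "polytime m" "polytime n" shows "polytime (\<lambda>x. m x = (n x :: nat))"
  unfolding eq_iff by (intro polytime_intros assms)

lemma polytime_eq_nat_bool [polytime_intros]:
  assumes "polytime p" "polytime q" shows "polytime (\<lambda>x. p x = (q x :: nat \<times> bool))"
  unfolding prod_eq_iff by (intro polytime_intros polytime_eq_bool assms)

lemma polytime_member [polytime_intros]:
  assumes "polytime (\<lambda>p::'a \<times> 'a. fst p = snd p)" "polytime y" "polytime xs"
  shows "polytime (\<lambda>x. (y x :: 'a::encodable) \<in> set (xs x))"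
proof -
  have "polytime (\<lambda>p. fst (y (fst p), snd p) = snd (y (fst p), snd p))"
    by (rule polytime_comp[OF _ assms(1)]) (intro polytime_intros polytime_comp[OF polytime_fst_prim assms(2)])
  then have "polytime (\<lambda>p. y (fst p) = snd p)" by simp
  then have "polytime (\<lambda>x. \<exists>z\<in>set (xs x). y x = z)" by (intro polytime_intros assms)
  then show ?thesis by simp
qed

definition nth_default :: "'a \<Rightarrow> 'a list \<Rightarrow> nat \<Rightarrow> 'a" where
  "nth_default d xs n = (case drop n xs of [] \<Rightarrow> d | h # _ \<Rightarrow> h)"

lemma nth_default_eq: "n < length xs \<Longrightarrow> nth_default d xs n = xs ! n"
  by (simp add: nth_default_def Cons_nth_drop_Suc[symmetric])

lemma polytime_drop [polytime_intros]:
  assumes "polytime n" "polytime xs" shows "polytime (\<lambda>x. drop (n x) (xs x))"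
proof -
  have e: "foldr (\<lambda>y. tl) us ys = drop (length us) ys" for us :: "unit list" and ys :: "'b list"
    by (induction us) (auto simp: drop_Suc tl_drop)
  have "polytime (\<lambda>x. foldr (\<lambda>y ys. tl ys) (replicate (n x) ()) (xs x))"
  proof (rule polytime_foldr[where B="\<lambda>x. sz (xs x)"])
    show "polytime (\<lambda>x. replicate (n x) ())" using assms(1) by (simp add: polytime_as_unit_list)
    fix x and us vs :: "unit list"
    have "sz ys = sz (take m ys) + sz (drop m ys)" for m and ys :: "'b list"
      by (metis append_take_drop_id sz_append)
    then show "sz (foldr (\<lambda>y. tl) vs (xs x)) \<le> sz (xs x)" by (metis e le_add2)
  qed (intro polytime_intros poly_bounded_intros assms)+
  then show ?thesis by (simp only: e length_replicate minus_nat.diff_0)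
qed

lemma polytime_nth_default [polytime_intros]:
  assumes "polytime d" "polytime xs" "polytime n" shows "polytime (\<lambda>x. nth_default (d x) (xs x) (n x))"
  unfolding nth_default_def by (intro polytime_intros assms)

lemma polytime_upt [polytime_intros]:
  assumes "polytime n" shows "polytime (\<lambda>x. [0..<n x])"
proof -
  have e: "foldr (\<lambda>y acc. acc @ [length acc]) us [] = [0..<length us]" for us :: "unit list"
    by (induction us) auto
  have "polytime (\<lambda>x. foldr (\<lambda>y acc. acc @ [length acc]) (replicate (n x) ()) [])"
  proof (rule polytime_foldr[where B="\<lambda>x. sz (n x) * (sz (n x) + 1)"])
    show "polytime (\<lambda>x. replicate (n x) ())" using assms by (simp add: polytime_as_unit_list)
    fix x and us vs :: "unit list" assume "replicate (n x) () = us @ vs"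
    then have "n x = length us + length vs" by (metis length_append length_replicate)
    then have "sz [0..<length vs] \<le> length [0..<length vs] * (n x + 1)" by (intro sz_list_le) auto
    also have "\<dots> \<le> n x * (n x + 1)" using \<open>n x = _\<close> by (intro mult_le_mono1) auto
    finally show "sz (foldr (\<lambda>y acc. acc @ [length acc]) vs []) \<le> sz (n x) * (sz (n x) + 1)"
      by (simp add: e)
  qed (intro polytime_intros poly_bounded_intros assms)+
  then show ?thesis by (simp only: e length_replicate minus_nat.diff_0)
qed

section \<open>Chordal graphs\<close>

definition simplicial :: "('a \<Rightarrow> 'a \<Rightarrow> bool) \<Rightarrow> 'a set \<Rightarrow> 'a \<Rightarrow> bool" where
  "simplicial R A z \<longleftrightarrow> (\<forall>x\<in>A. \<forall>y\<in>A. R z x \<and> R z y \<and> x \<noteq> y \<longrightarrow> R x y)"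

definition clique :: "('a \<Rightarrow> 'a \<Rightarrow> bool) \<Rightarrow> 'a set \<Rightarrow> bool" where
  "clique R K \<longleftrightarrow> (\<forall>x\<in>K. \<forall>y\<in>K. x \<noteq> y \<longrightarrow> R x y)"

text \<open>Chordality of the subgraph induced by \<open>A\<close>. It restricts the cycles and not
  the relation, so it passes to subsets at once.\<close>

definition hole_free :: "('a \<Rightarrow> 'a \<Rightarrow> bool) \<Rightarrow> 'a set \<Rightarrow> bool" where
  "hole_free R A \<longleftrightarrow> (\<forall>c. length c \<ge> 4 \<and> distinct c \<and> set c \<subseteq> A \<and>
     (\<forall>i < length c. R (c ! i) (c ! (Suc i mod length c))) \<longrightarrow>
     (\<exists>i < length c. \<exists>j < length c.
        i \<noteq> j \<and> j \<noteq> Suc i mod length c \<and> i \<noteq> Suc j mod length c \<and> R (c ! i) (c ! j)))"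

lemma hole_free_subset: "hole_free R A \<Longrightarrow> B \<subseteq> A \<Longrightarrow> hole_free R B"
  unfolding hole_free_def by blast

definition walk_through :: "('a \<Rightarrow> 'a \<Rightarrow> bool) \<Rightarrow> 'a set \<Rightarrow> 'a \<Rightarrow> 'a \<Rightarrow> 'a list \<Rightarrow> bool" where
  "walk_through R C x y q \<longleftrightarrow> q \<noteq> [] \<and> set q \<subseteq> C \<and> successively R (x # q @ [y])"

text \<open>The excluded pair consists of the two ends, whose direct connection would leave no inner
  vertex. With \<open>walk_through_repeat\<close>, a shortest walk between nonadjacent ends outside
  \<open>C\<close> is an induced path.\<close>

lemma walk_through_shortcut:
  assumes w: "walk_through R C x y q" and ij: "i < j" "j < length q + 2" "\<not> (i = 0 \<and> j = length q + 1)"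
    and R: "R ((x # q @ [y]) ! i) ((x # q @ [y]) ! j)" and "j \<noteq> Suc i"
  shows "\<exists>q'. walk_through R C x y q' \<and> length q' < length q"
proof -
  let ?w = "x # q @ [y]"
  let ?w' = "take (Suc i) ?w @ drop j ?w"
  define q' where "q' = take i q @ take (length q + 1 - j) (drop (j - 1) q)"
  have j: "j \<ge> 1" using ij by simp
  have w': "?w' = x # q' @ [y]"
  proof (cases "j = length q + 1")
    case True
    then show ?thesis using ij by (simp add: q'_def drop_Cons')
  next
    case False
    then show ?thesis using ij j by (simp add: q'_def drop_Cons')
  qed
  have "successively R ?w" using w by (simp add: walk_through_def)
  then have s: "successively R (take (Suc i) ?w)" "successively R (drop j ?w)"
    by (metis append_take_drop_id successively_append_iff)+
  have l: "last (take (Suc i) ?w) = ?w ! i"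
    using ij take_Suc_conv_app_nth[of i ?w] by (simp del: take_Suc_Cons)
  have h: "hd (drop j ?w) = ?w ! j" using ij by (intro hd_drop_conv_nth) auto
  have "successively R ?w'" by (simp only: successively_append_iff s l h R simp_thms)
  moreover have "set q' \<subseteq> C"
    using w unfolding q'_def walk_through_def by (auto dest: in_set_takeD in_set_dropD)
  moreover have "length q' < length q" using ij \<open>j \<noteq> Suc i\<close> unfolding q'_def by auto
  moreover have "q' \<noteq> []" using ij by (auto simp: q'_def)
  ultimately show ?thesis unfolding walk_through_def w' by blast
qed

lemma walk_through_repeat:
  assumes w: "walk_through R C x y q" and ij: "i < j" "j < length q" and eq: "q ! i = q ! j"
  shows "\<exists>q'. walk_through R C x y q' \<and> length q' < length q"
proof -
  let ?q' = "take i q @ drop j q"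
  have s: "successively R (x # q @ [y])" using w by (simp add: walk_through_def)
  have e: "x # q @ [y] = (x # take i q) @ drop i q @ [y]" "x # q @ [y] = (x # take j q) @ drop j q @ [y]"
    by simp_all
  have h: "hd (drop i q @ [y]) = hd (drop j q @ [y])"
    using ij eq by (simp add: hd_append hd_drop_conv_nth)
  have "successively R ((x # take i q) @ drop j q @ [y])"
    using s h unfolding successively_append_iff
    by (metis e(1) e(2) append_is_Nil_conv not_Cons_self2 successively_append_iff)
  moreover have "set ?q' \<subseteq> C" using w unfolding walk_through_def by (auto dest: in_set_takeD in_set_dropD)
  ultimately have "walk_through R C x y ?q'" using ij unfolding walk_through_def by simp
  moreover have "length ?q' < length q" using ij by simp
  ultimately show ?thesis by blast
qed

text \<open>Close a shortest walk by \<open>v\<close>. A chord at \<open>v\<close> would end in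
  \<open>C\<close>, where \<open>v\<close> has no neighbours; \<open>x\<close> and \<open>y\<close>
  are not adjacent; any other chord would shorten the walk. So the cycle is a hole.\<close>

lemma hole_from_walk:
  assumes hf: "hole_free R A" and symR: "symp R"
    and w: "walk_through R C x y q" and C: "C \<subseteq> A" and A: "v \<in> A" "x \<in> A" "y \<in> A"
    and xy: "x \<noteq> y" "\<not> R x y" "x \<notin> C" "y \<notin> C" and v: "R v x" "R v y" "v \<noteq> x" "v \<noteq> y"
    and vC: "v \<notin> C" "\<And>c. c \<in> C \<Longrightarrow> \<not> R v c"
  shows False
proof -
  have sym: "\<And>x y. R x y \<Longrightarrow> R y x" using symR by (rule sympD)
  obtain q where w: "walk_through R C x y q"
    and min: "\<And>q'. walk_through R C x y q' \<Longrightarrow> length q \<le> length q'"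
    using ex_has_least_nat[of "walk_through R C x y" q length] w by blast
  have short: False if "\<exists>q'. walk_through R C x y q' \<and> length q' < length q"
    using that min by (meson leD)
  let ?w = "x # q @ [y]" and ?c = "v # x # q @ [y]"
  have q: "q \<noteq> []" "set q \<subseteq> C" "successively R ?w" using w by (auto simp: walk_through_def)
  have "distinct q"
    unfolding distinct_conv_nth
  proof (intro allI impI)
    fix i j assume "i < length q" "j < length q" "i \<noteq> j"
    then show "q ! i \<noteq> q ! j"
      using walk_through_repeat[OF w, of i j] walk_through_repeat[OF w, of j i] short
      by (metis linorder_neqE_nat)
  qed
  then have d: "distinct ?c" using q xy v vC by auto
  let ?n = "length ?c"
  have n: "?n = length q + 3" "?n \<ge> 4" using q(1) by (auto simp: Suc_le_eq)
  have wn: "R (?w ! i) (?w ! Suc i)" if "Suc i < length ?w" for i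
    using q(3) that by (auto simp: successively_conv_nth)
  have last: "?w ! (length q + 1) = y" by (simp add: nth_append)
  have inner: "?w ! i \<in> C" if "0 < i" "i < length q + 1" for i
    using that q(2) by (cases i) (auto simp: nth_append)
  have cyc: "R (?c ! i) (?c ! (Suc i mod ?n))" if i: "i < ?n" for i
  proof (cases "i = length q + 2")
    case True
    then show ?thesis using sym[OF v(2)] last by simp
  next
    case False
    then have m: "Suc i mod ?n = Suc i" using i by simp
    show ?thesis
    proof (cases i)
      case 0
      then show ?thesis using v(1) by simp
    next
      case (Suc i')
      then show ?thesis using wn[of i'] i False m by simp
    qed
  qed
  have no: False if a: "a < b" "b < ?n" "b \<noteq> Suc a mod ?n" "a \<noteq> Suc b mod ?n" "R (?c ! a) (?c ! b)" for a b
  proof (cases a)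
    case 0
    then have "b \<noteq> 1" using a n by auto
    moreover have "Suc (length q + 2) mod ?n = 0" using n(1) by simp
    then have "b \<noteq> length q + 2" using a(4) 0 by metis
    ultimately have "?w ! (b - 1) \<in> C" using a by (intro inner) auto
    moreover have "R v (?w ! (b - 1))" using a 0 by (cases b) auto
    ultimately show False using vC by blast
  next
    case (Suc a')
    obtain b' where b: "b = Suc b'" using a(1) by (cases b) auto
    have R: "R (?w ! a') (?w ! b')" using a Suc b by simp
    have "\<not> (a' = 0 \<and> b' = length q + 1)" using R xy(2) last by auto
    moreover have "b' \<noteq> Suc a'" using a Suc b by auto
    ultimately show False using walk_through_shortcut[OF w, of a' b'] R a Suc b short by auto
  qed
  have "set ?c \<subseteq> A" using q(2) C A by auto
  then obtain i j where "i < ?n" "j < ?n" "i \<noteq> j" "j \<noteq> Suc i mod ?n" "i \<noteq> Suc j mod ?n" "R (?c ! i) (?c ! j)"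
    using hf[unfolded hole_free_def, rule_format, of ?c] d n(2) cyc by blast
  then show False using no[of i j] no[of j i] sym by (metis linorder_neqE_nat)
qed

lemma rtranclp_walk:
  assumes "rtranclp (\<lambda>a b. a \<in> C \<and> b \<in> C \<and> R a b) a b" "a \<in> C"
  shows "\<exists>q. q \<noteq> [] \<and> set q \<subseteq> C \<and> successively R q \<and> hd q = a \<and> last q = b"
  using assms
proof (induction rule: rtranclp_induct)
  case base
  then show ?case by (intro exI[of _ "[a]"]) auto
next
  case (step b c)
  then obtain q where "q \<noteq> []" "set q \<subseteq> C" "successively R q" "hd q = a" "last q = b" by blast
  then show ?case using step by (intro exI[of _ "q @ [c]"]) (auto simp: successively_append_iff)
qed

text \<open>
  A component \<open>C\<close> of the non-neighbours of \<open>v\<close> is attached to a clique \<open>T\<close>, because two nonadjacent vertices of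
  \<open>T\<close> would lie on a hole through \<open>v\<close> and \<open>C\<close>; now apply the induction hypothesis to \<open>C \<union> T\<close>.
\<close>

lemma simplicial_nonneighbour:
  assumes "finite A" "hole_free R A" and symR: "symp R"
    and "v \<in> A" "u \<in> A" "u \<noteq> v" "\<not> R v u"
  shows "\<exists>z\<in>A. z \<noteq> v \<and> \<not> R v z \<and> simplicial R A z"
  using assms(1,2,4-)
proof (induction "card A" arbitrary: A v u rule: less_induct)
  case less
  have sym: "\<And>x y. R x y \<Longrightarrow> R y x" using symR by (rule sympD)
  define N where "N = {x \<in> A. x \<noteq> v \<and> \<not> R v x}"
  let ?S = "\<lambda>a b. a \<in> N \<and> b \<in> N \<and> R a b"
  define C where "C = {x. rtranclp ?S u x}"
  define T where "T = {y \<in> A - C. \<exists>c\<in>C. R c y}"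
  have uN: "u \<in> N" using less.prems by (simp add: N_def)
  have uC: "u \<in> C" by (simp add: C_def)
  have CN: "C \<subseteq> N"
  proof
    fix x assume "x \<in> C"
    then have "rtranclp ?S u x" by (simp add: C_def)
    then show "x \<in> N" using uN by (induction rule: rtranclp_induct) auto
  qed
  have Cclosed: "y \<in> C" if "c \<in> C" "y \<in> N" "R c y" for c y
  proof -
    have "?S c y" using that CN by blast
    then show ?thesis using that(1) unfolding C_def by (auto intro: rtranclp.rtrancl_into_rtrancl)
  qed
  have CA: "C \<subseteq> A" using CN by (auto simp: N_def)
  have TN: "R v t \<and> t \<noteq> v" if t: "t \<in> T" for t
  proof -
    obtain c where c: "c \<in> C" "R c t" using t by (auto simp: T_def)
    have "t \<notin> N" using Cclosed[OF c(1) _ c(2)] t by (auto simp: T_def)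
    moreover have "t \<noteq> v" using c CN sym[OF c(2)] by (auto simp: N_def)
    ultimately show ?thesis using t by (auto simp: N_def T_def)
  qed
  have symS: "symp ?S" by (auto intro: sympI sym)
  have conn: "\<exists>q. q \<noteq> [] \<and> set q \<subseteq> C \<and> successively R q \<and> hd q = a \<and> last q = b"
    if ab: "a \<in> C" "b \<in> C" for a b
  proof -
    have "rtranclp ?S u a" "rtranclp ?S u b" using ab by (auto simp: C_def)
    then have ab': "rtranclp ?S a b"
      using symp_rtranclp[OF symS] by (metis (no_types, lifting) rtranclp_trans sympD)
    have "rtranclp (\<lambda>a b. a \<in> C \<and> b \<in> C \<and> R a b) a b" using ab'
    proof (induction rule: rtranclp_induct)
      case (step y z)
      have "rtranclp ?S u y" using \<open>rtranclp ?S u a\<close> step(1) by (rule rtranclp_trans)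
      then have "y \<in> C" by (simp add: C_def)
      then have "z \<in> C" using Cclosed[of y z] step(2) by blast
      then show ?case using step \<open>y \<in> C\<close> by (auto intro: rtranclp.rtrancl_into_rtrancl)
    qed simp
    then show ?thesis using rtranclp_walk ab(1) by fast
  qed
  have Tclique: "R x y" if xy: "x \<in> T" "y \<in> T" "x \<noteq> y" for x y
  proof (rule ccontr)
    assume nR: "\<not> R x y"
    obtain a b where ab: "a \<in> C" "R a x" "b \<in> C" "R b y" using xy by (auto simp: T_def)
    obtain q where q: "q \<noteq> []" "set q \<subseteq> C" "successively R q" "hd q = a" "last q = b"
      using conn[OF ab(1,3)] by blast
    then have w: "walk_through R C x y q"
      using ab sym[OF ab(2)] by (auto simp: walk_through_def successively_append_iff successively_Cons)
    show False
      by (rule hole_from_walk[OF less.prems(2) symR w, where v=v])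
        (use xy nR TN[OF xy(1)] TN[OF xy(2)] CA CN less.prems in \<open>auto simp: T_def N_def\<close>)
  qed
  \<comment> \<open>All neighbours in \<open>A\<close> of a vertex of \<open>C\<close> lie in
    \<open>C \<union> T\<close>, so it suffices to be simplicial there.\<close>
  have lift: "simplicial R A z" if z: "z \<in> C" "simplicial R (C \<union> T) z" for z
  proof -
    have "x \<in> C \<union> T" if "x \<in> A" "R z x" for x using that z(1) by (auto simp: T_def)
    then show ?thesis using z(2) unfolding simplicial_def by blast
  qed
  have goal: "z \<in> A \<and> z \<noteq> v \<and> \<not> R v z" if "z \<in> C" for z
    using that CN by (auto simp: N_def)
  have sub: "C \<union> T \<subseteq> A" "v \<notin> C \<union> T" using CA CN TN by (auto simp: N_def T_def)
  then have card: "card (C \<union> T) < card A"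
    using less.prems(1,3) by (intro psubset_card_mono) auto
  have fin: "finite (C \<union> T)" using sub(1) less.prems(1) by (rule finite_subset)
  \<comment> \<open>If some \<open>x\<close> in \<open>T\<close> misses a vertex of
    \<open>C \<union> T\<close>, induction yields a simplicial \<open>z\<close> not adjacent to
    \<open>x\<close>, which is in \<open>C\<close> because \<open>T\<close> is a clique. Otherwise
    \<open>T\<close> is completely joined to \<open>C \<union> T\<close>, and a simplicial vertex of
    \<open>C\<close> alone remains simplicial when \<open>T\<close> is added.\<close>
  show ?case
  proof (cases "\<exists>x\<in>T. \<exists>y\<in>C \<union> T. y \<noteq> x \<and> \<not> R x y")
    case True
    then obtain x y where xy: "x \<in> T" "y \<in> C \<union> T" "y \<noteq> x" "\<not> R x y" by blast
    then obtain z where z: "z \<in> C \<union> T" "z \<noteq> x" "\<not> R x z" "simplicial R (C \<union> T) z"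
      using less.hyps[OF card fin hole_free_subset[OF less.prems(2) sub(1)], of x y] by blast
    then have "z \<in> C" using Tclique xy(1) by blast
    then show ?thesis using lift z goal by blast
  next
    case False
    then have adj: "R x y" if "x \<in> T" "y \<in> C \<union> T" "y \<noteq> x" for x y using that by (metis (no_types))
    have "\<exists>z\<in>C. simplicial R C z"
    proof (cases "\<exists>x\<in>C. \<exists>y\<in>C. y \<noteq> x \<and> \<not> R x y")
      case True
      then obtain x y where xy: "x \<in> C" "y \<in> C" "y \<noteq> x" "\<not> R x y" by blast
      have "card C < card A" using card card_mono[OF fin, of C] by simp
      then show ?thesis
        using less.hyps[of C x y] fin hole_free_subset[OF less.prems(2) CA] xy by blast
    next
      case False
      then show ?thesis using uC unfolding simplicial_def by metis
    qed
    then obtain z where z: "z \<in> C" "simplicial R C z" by blast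
    have "simplicial R (C \<union> T) z"
      unfolding simplicial_def
    proof (intro ballI impI)
      fix x y assume xy: "x \<in> C \<union> T" "y \<in> C \<union> T" "R z x \<and> R z y \<and> x \<noteq> y"
      consider "x \<in> T" | "y \<in> T" | "x \<in> C" "y \<in> C" using xy by blast
      then show "R x y"
      proof cases
        case 1
        then show ?thesis using adj[of x y] xy by metis
      next
        case 2
        then have "R y x" using adj[of y x] xy by metis
        then show ?thesis by (rule sym)
      next
        case 3
        then show ?thesis using z(2) xy unfolding simplicial_def by blast
      qed
    qed
    then show ?thesis using lift z goal by blast
  qed
qed

text \<open>The only consequence of chordality that the algorithm needs.\<close>

definition dismantlable :: "('a \<Rightarrow> 'a \<Rightarrow> bool) \<Rightarrow> 'a set \<Rightarrow> bool" where
  "dismantlable R A \<longleftrightarrow> (\<forall>U \<subseteq> A. U \<noteq> {} \<longrightarrow> (\<exists>v\<in>U. simplicial R U v))"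

lemma dismantlable_subset: "dismantlable R A \<Longrightarrow> B \<subseteq> A \<Longrightarrow> dismantlable R B"
  unfolding dismantlable_def by (meson subset_trans)

lemma hole_free_dismantlable:
  assumes "finite A" "hole_free R A" and symR: "symp R"
  shows "dismantlable R A"
  unfolding dismantlable_def
proof (intro allI impI)
  fix U assume U: "U \<subseteq> A" "U \<noteq> {}"
  show "\<exists>v\<in>U. simplicial R U v"
  proof (cases "\<exists>x\<in>U. \<exists>y\<in>U. y \<noteq> x \<and> \<not> R x y")
    case True
    then show ?thesis
      using simplicial_nonneighbour[OF finite_subset[OF U(1) assms(1)] hole_free_subset[OF assms(2) U(1)] symR]
      by metis
  next
    case False
    then show ?thesis using U(2) unfolding simplicial_def by fastforce
  qed
qed

text \<open>
  The labels stand for connected components of \<open>U - Q\<close>.  In the induction, a simplicial vertex \<open>v\<close> is removed and each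
  clique through \<open>v\<close> is replaced by the neighbourhood of \<open>v\<close>.
\<close>

lemma balanced_labelling:
  assumes "finite U" "dismantlable R U" and symR: "symp R" and "finite I"
    and "\<forall>i\<in>I. K i \<subseteq> U \<and> clique R (K i)" and M: "sum wt I \<le> (M::nat)"
  shows "\<exists>Q lab. Q \<subseteq> U \<and> clique R Q \<and> (\<forall>x\<in>U - Q. \<forall>y\<in>U - Q. R x y \<longrightarrow> lab x = (lab y :: nat)) \<and>
    (\<forall>l. 2 * sum wt {i \<in> I. \<exists>x\<in>K i - Q. lab x = l} \<le> M)"
  using assms(1,2,5)
proof (induction "card U" arbitrary: U K rule: less_induct)
  case less
  have sym: "\<And>x y. R x y \<Longrightarrow> R y x" using symR by (rule sympD)
  show ?case
  proof (cases "U = {}")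
    case True
    then have e: "{i \<in> I. \<exists>x\<in>K i - {}. (0::nat) = l} = {}" for l using less.prems(3) by auto
    show ?thesis
      by (intro exI[of _ "{}"] exI[of _ "\<lambda>_. 0"], unfold e) (auto simp: clique_def)
  next
    case False
    then obtain v where v: "v \<in> U" "simplicial R U v"
      using less.prems(2) unfolding dismantlable_def by blast
    define N where "N = {x \<in> U - {v}. R v x}"
    define K' where "K' i = (if v \<in> K i then N else K i)" for i
    have Nc: "clique R N" using v(2) by (auto simp: N_def simplicial_def clique_def)
    have "R v x" "R x v" if "x \<in> N" for x using that sym[of v x] by (auto simp: N_def)
    then have vNc: "clique R (insert v N)" using Nc by (auto simp: clique_def)
    have KN: "K i \<subseteq> insert v N" if "i \<in> I" "v \<in> K i" for i
      using bspec[OF less.prems(3) that(1)] that(2) unfolding N_def clique_def by auto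
    have K': "K' i \<subseteq> U - {v} \<and> clique R (K' i)" if "i \<in> I" for i
      using bspec[OF less.prems(3) that] Nc by (auto simp: K'_def N_def)
    have "card (U - {v}) < card U" using v(1) less.prems(1) by (rule card_Diff1_less[rotated])
    then have "\<exists>Q lab. Q \<subseteq> U - {v} \<and> clique R Q \<and>
      (\<forall>x\<in>U - {v} - Q. \<forall>y\<in>U - {v} - Q. R x y \<longrightarrow> lab x = (lab y :: nat)) \<and>
      (\<forall>l. 2 * sum wt {i \<in> I. \<exists>x\<in>K' i - Q. lab x = l} \<le> M)"
      using dismantlable_subset[OF less.prems(2)] less.prems(1) K' by (intro less.hyps) auto
    then obtain Q lab where Q: "Q \<subseteq> U - {v}" "clique R Q"
      and lab: "\<And>x y. x \<in> U - {v} - Q \<Longrightarrow> y \<in> U - {v} - Q \<Longrightarrow> R x y \<Longrightarrow> lab x = (lab y :: nat)"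
      and bal: "\<And>l. 2 * sum wt {i \<in> I. \<exists>x\<in>K' i - Q. lab x = l} \<le> M"
      by meson
    have mono: "2 * sum wt J \<le> M" if "J \<subseteq> {i \<in> I. \<exists>x\<in>K' i - Q. lab x = l}" for J l
      using sum_mono2[OF _ that, of wt] bal[of l] \<open>finite I\<close> by simp
    show ?thesis
    proof (cases "N \<subseteq> Q")
      case False
      \<comment> \<open>A neighbour \<open>x0\<close> of \<open>v\<close> survives outside
        \<open>Q\<close>, so \<open>v\<close> joins its component. Since \<open>v\<close> is
        simplicial, all its neighbours outside \<open>Q\<close> carry the same label.\<close>
      then obtain x0 where x0: "x0 \<in> N" "x0 \<notin> Q" by blast
      let ?lab = "lab(v := lab x0)"
      have v_lab: "lab y = lab x0" if "y \<in> U - Q" "y \<noteq> v" "R v y" for y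
      proof (cases "y = x0")
        case False
        then have "R y x0" using v(2) that x0 by (auto simp: simplicial_def N_def)
        then show ?thesis using lab that x0 by (auto simp: N_def)
      qed simp
      have "\<forall>x\<in>U - Q. \<forall>y\<in>U - Q. R x y \<longrightarrow> ?lab x = ?lab y"
        using v_lab lab sym by (metis Diff_iff fun_upd_apply insertE empty_iff)
      moreover have "2 * sum wt {i \<in> I. \<exists>x\<in>K i - Q. ?lab x = l} \<le> M" for l
      proof (rule mono[of _ l], rule subsetI)
        fix i assume "i \<in> {i \<in> I. \<exists>x\<in>K i - Q. ?lab x = l}"
        then obtain x where x: "i \<in> I" "x \<in> K i - Q" "?lab x = l" by blast
        show "i \<in> {i \<in> I. \<exists>x\<in>K' i - Q. lab x = l}"
        proof (cases "x = v")
          case True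
          then show ?thesis using x x0 by (auto simp: K'_def)
        next
          case False
          then have "x \<in> K' i" using x KN[OF x(1)] by (auto simp: K'_def)
          then show ?thesis using x False by auto
        qed
      qed
      ultimately show ?thesis using Q by (intro exI[of _ Q] exI[of _ ?lab]) auto
    next
      case NQ: True
      \<comment> \<open>Now \<open>v\<close> is isolated outside \<open>Q\<close>. If the cliques
        through \<open>v\<close> weigh at most half of \<open>M\<close>, then \<open>v\<close>
        becomes a component of its own, with a fresh label, which only these cliques meet.\<close>
      let ?J = "{i \<in> I. v \<in> K i}"
      show ?thesis
      proof (cases "2 * sum wt ?J \<le> M")
        case True
        have "finite (lab ` U)" using less.prems(1) by simp
        then obtain l0 where l0: "l0 \<notin> lab ` U" using ex_new_if_finite[OF infinite_UNIV_nat] by blast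
        let ?lab = "lab(v := l0)"
        have "\<not> R v y" if "y \<in> U - Q" "y \<noteq> v" for y using NQ that by (auto simp: N_def)
        then have "\<forall>x\<in>U - Q. \<forall>y\<in>U - Q. R x y \<longrightarrow> ?lab x = ?lab y"
          using lab sym by (metis Diff_iff fun_upd_apply insertE empty_iff)
        moreover have "2 * sum wt {i \<in> I. \<exists>x\<in>K i - Q. ?lab x = l} \<le> M" for l
        proof (cases "l = l0")
          case True
          have "x = v" if "i \<in> I" "x \<in> K i" "?lab x = l0" for i x
          proof (rule ccontr)
            assume "x \<noteq> v"
            moreover have "x \<in> U" using bspec[OF less.prems(3) that(1)] that(2) by blast
            ultimately show False using l0 that(3) by auto
          qed
          then have "{i \<in> I. \<exists>x\<in>K i - Q. ?lab x = l} \<subseteq> ?J" unfolding True by blast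
          then have "sum wt {i \<in> I. \<exists>x\<in>K i - Q. ?lab x = l} \<le> sum wt ?J"
            using \<open>finite I\<close> by (intro sum_mono2) auto
          then show ?thesis using \<open>2 * sum wt ?J \<le> M\<close> by linarith
        next
          case False
          show ?thesis
          proof (rule mono[of _ l], rule subsetI)
            fix i assume "i \<in> {i \<in> I. \<exists>x\<in>K i - Q. ?lab x = l}"
            then obtain x where x: "i \<in> I" "x \<in> K i - Q" "?lab x = l" by blast
            then have "x \<noteq> v" using False by auto
            then have "v \<notin> K i" using KN[OF x(1)] x NQ by auto
            then show "i \<in> {i \<in> I. \<exists>x\<in>K' i - Q. lab x = l}" using x \<open>x \<noteq> v\<close> by (auto simp: K'_def)
          qed
        qed
        ultimately show ?thesis using Q by (intro exI[of _ Q] exI[of _ ?lab]) auto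
      next
        case False
        \<comment> \<open>Otherwise the closed neighbourhood of \<open>v\<close> is itself the
          separator: it swallows all cliques through \<open>v\<close>, and the others weigh less
          than half of \<open>M\<close>.\<close>
        have "2 * sum wt {i \<in> I. \<exists>x\<in>K i - insert v N. (0::nat) = l} \<le> M" for l
        proof -
          have "{i \<in> I. \<exists>x\<in>K i - insert v N. (0::nat) = l} \<subseteq> I - ?J" using KN by blast
          then have "sum wt {i \<in> I. \<exists>x\<in>K i - insert v N. (0::nat) = l} \<le> sum wt (I - ?J)"
            using \<open>finite I\<close> by (intro sum_mono2) auto
          moreover have "sum wt I = sum wt (I - ?J) + sum wt ?J"
            using \<open>finite I\<close> by (intro sum.subset_diff) auto
          ultimately show ?thesis using False M by linarith
        qed
        then show ?thesis using vNc v(1)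
          by (intro exI[of _ "insert v N"] exI[of _ "\<lambda>_. 0"]) (auto simp: N_def)
      qed
    qed
  qed
qed

text \<open>If some element has at least a third of \<open>M\<close>, it suffices alone, since it
  has at most half. Otherwise elements are collected until a third is reached, and the last one
  cannot overshoot two thirds. In both cases the complement has at most two thirds.\<close>

lemma balanced_bipartition:
  fixes g :: "'a \<Rightarrow> nat"
  assumes "finite X" "sum g X \<le> M" "\<And>x. x \<in> X \<Longrightarrow> 2 * g x \<le> M"
  shows "\<exists>Y \<subseteq> X. 3 * sum g Y \<le> 2 * M \<and> 3 * sum g (X - Y) \<le> 2 * M"
proof -
  have "\<exists>Y \<subseteq> X. 3 * sum g Y \<le> 2 * M \<and> (M \<le> 3 * sum g Y \<or> Y = X)"
  proof (cases "\<exists>x\<in>X. M \<le> 3 * g x")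
    case True
    then obtain x where x: "x \<in> X" "M \<le> 3 * g x" by blast
    then show ?thesis using assms(3)[OF x(1)] by (intro exI[of _ "{x}"]) auto
  next
    case False
    with assms(1) show ?thesis
    proof (induction X rule: finite_induct)
      case (insert a X)
      then obtain Y where Y: "Y \<subseteq> X" "3 * sum g Y \<le> 2 * M" "M \<le> 3 * sum g Y \<or> Y = X" by auto
      show ?case
      proof (cases "M \<le> 3 * sum g Y")
        case True
        then show ?thesis using Y by blast
      next
        case False
        then have "Y = X" "3 * sum g X < M" using Y by auto
        moreover have "3 * g a < M" using insert by auto
        ultimately show ?thesis using insert by (intro exI[of _ "insert a X"]) auto
      qed
    qed simp
  qed
  then obtain Y where Y: "Y \<subseteq> X" "3 * sum g Y \<le> 2 * M" "M \<le> 3 * sum g Y \<or> Y = X" by blast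
  have "sum g X = sum g (X - Y) + sum g Y" using Y(1) assms(1) by (rule sum.subset_diff)
  then have "3 * sum g (X - Y) \<le> 2 * M" using Y assms(2) by auto
  then show ?thesis using Y by blast
qed

text \<open>Outside \<open>Q\<close> each clique meets at most one component, and the cliques of one
  component weigh at most \<open>M / 2\<close>. So whole components can be distributed over two
  sides, each with at most two thirds of \<open>M\<close>.\<close>

lemma balanced_clique_separator:
  assumes fin: "finite U" "finite I" and dis: "dismantlable R U" and symR: "symp R"
    and K: "\<forall>i\<in>I. K i \<subseteq> U \<and> clique R (K i)"
    and M: "sum wt I \<le> (M::nat)" "\<And>i. i \<in> I \<Longrightarrow> 2 * wt i \<le> M"
  shows "\<exists>Q A B J. Q \<subseteq> U \<and> clique R Q \<and> A \<union> B = U - Q \<and> A \<inter> B = {} \<and> (\<forall>a\<in>A. \<forall>b\<in>B. \<not> R a b) \<and>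
    J \<subseteq> I \<and> (\<forall>i\<in>J. K i \<subseteq> A \<union> Q) \<and> (\<forall>i\<in>I - J. K i \<subseteq> B \<union> Q) \<and>
    3 * sum wt J \<le> 2 * M \<and> 3 * sum wt (I - J) \<le> 2 * M"
proof -
  have sym: "\<And>x y. R x y \<Longrightarrow> R y x" using symR by (rule sympD)
  obtain Q and lab :: "'a \<Rightarrow> nat" where Q: "Q \<subseteq> U" "clique R Q"
    and lab': "\<forall>x\<in>U - Q. \<forall>y\<in>U - Q. R x y \<longrightarrow> lab x = lab y"
    and bal': "\<forall>l. 2 * sum wt {i \<in> I. \<exists>x\<in>K i - Q. lab x = l} \<le> M"
    using balanced_labelling[where I=I and K=K and wt=wt, OF fin(1) dis symR fin(2) K M(1)]
    by (elim exE conjE) (rule that)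
  note lab = lab'[rule_format] and bal = bal'[rule_format]
  \<comment> \<open>A clique inside \<open>Q\<close> fits on either side and forms a class by itself
    (\<open>Inl\<close>); the others are grouped by the component that they meet
    (\<open>Inr\<close>).\<close>
  define key where "key i = (if K i \<subseteq> Q then Inl i else Inr (lab (SOME x. x \<in> K i - Q)))" for i
  have key: "key i = Inr (lab x)" if "i \<in> I" "x \<in> K i - Q" for i x
  proof -
    define y where "y = (SOME x. x \<in> K i - Q)"
    have y: "y \<in> K i - Q" unfolding y_def using that(2) by (rule someI)
    have "lab y = lab x"
    proof (cases "y = x")
      case False
      then have "R y x" using bspec[OF K that(1)] y that(2) unfolding clique_def by blast
      then show ?thesis using lab bspec[OF K that(1)] y that(2) by blast
    qed simp
    moreover have "\<not> K i \<subseteq> Q" using that(2) by blast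
    ultimately show ?thesis by (simp add: key_def y_def)
  qed
  let ?g = "\<lambda>x. sum wt {i \<in> I. key i = x}"
  have g: "sum ?g Y = sum wt {i \<in> I. key i \<in> Y}" if "Y \<subseteq> key ` I" for Y
  proof -
    have "sum ?g Y = (\<Sum>x\<in>Y. sum wt {i \<in> {i \<in> I. key i \<in> Y}. key i = x})"
      by (intro sum.cong) (auto intro: arg_cong[where f="sum wt"])
    also have "\<dots> = sum wt {i \<in> I. key i \<in> Y}"
      by (rule sum.group) (use fin finite_subset[OF that] in auto)
    finally show ?thesis .
  qed
  have "\<exists>Y \<subseteq> key ` I. 3 * sum ?g Y \<le> 2 * M \<and> 3 * sum ?g (key ` I - Y) \<le> 2 * M"
  proof (rule balanced_bipartition)
    have "{i \<in> I. key i \<in> key ` I} = I" by auto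
    then show "sum ?g (key ` I) \<le> M" using g[of "key ` I"] M(1) by simp
    fix x assume "x \<in> key ` I"
    then obtain i where i: "i \<in> I" "x = key i" by blast
    show "2 * ?g x \<le> M"
    proof (cases "K i \<subseteq> Q")
      case True
      then have "{j \<in> I. key j = x} = {i}" using i by (auto simp: key_def split: if_splits)
      then show ?thesis using M(2)[OF i(1)] by simp
    next
      case False
      then obtain l where l: "x = Inr l" using i by (auto simp: key_def)
      have "{j \<in> I. key j = x} \<subseteq> {j \<in> I. \<exists>y\<in>K j - Q. lab y = l}"
      proof
        fix j assume "j \<in> {j \<in> I. key j = x}"
        then have j: "j \<in> I" "key j = Inr l" using l by auto
        then obtain y where y: "y \<in> K j - Q" by (auto simp: key_def split: if_splits)
        then have "lab y = l" using key[OF j(1) y] j(2) by simp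
        then show "j \<in> {j \<in> I. \<exists>y\<in>K j - Q. lab y = l}" using j y by blast
      qed
      then have "?g x \<le> sum wt {j \<in> I. \<exists>y\<in>K j - Q. lab y = l}" using fin by (intro sum_mono2) auto
      then show ?thesis using bal[of l] by linarith
    qed
  qed (use fin in auto)
  then obtain Y where Y: "Y \<subseteq> key ` I" "3 * sum ?g Y \<le> 2 * M" "3 * sum ?g (key ` I - Y) \<le> 2 * M" by blast
  define J where "J = {i \<in> I. key i \<in> Y}"
  have J': "I - J = {i \<in> I. key i \<in> key ` I - Y}" by (auto simp: J_def)
  have w: "3 * sum wt J \<le> 2 * M" "3 * sum wt (I - J) \<le> 2 * M"
    using Y(2,3) g[OF Y(1)] g[of "key ` I - Y"] unfolding J' unfolding J_def by auto
  define A where "A = {x \<in> U - Q. Inr (lab x) \<in> Y}"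
  have "K i \<subseteq> A \<union> Q" if "i \<in> J" for i using that key[of i] K by (auto simp: J_def A_def)
  moreover have "K i \<subseteq> (U - Q - A) \<union> Q" if "i \<in> I - J" for i
    using that key[of i] K by (auto simp: J_def A_def)
  moreover have "\<forall>a\<in>A. \<forall>b\<in>U - Q - A. \<not> R a b" using lab by (fastforce simp: A_def)
  ultimately show ?thesis using Q w
    by (intro exI[of _ Q] exI[of _ A] exI[of _ "U - Q - A"] exI[of _ J]) (auto simp: A_def J_def)
qed

section \<open>Counting maximal cliques\<close>

definition maximal_clique :: "('a \<Rightarrow> 'a \<Rightarrow> bool) \<Rightarrow> 'a set \<Rightarrow> 'a set \<Rightarrow> bool" where
  "maximal_clique R A K \<longleftrightarrow> K \<subseteq> A \<and> clique R K \<and> (\<forall>x\<in>A - K. \<exists>y\<in>K. \<not> R x y)"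

lemma finite_maximal_cliques: "finite A \<Longrightarrow> finite {K. maximal_clique R A K}"
  by (rule finite_subset[of _ "Pow A"]) (auto simp: maximal_clique_def)

text \<open>A maximal clique through a simplicial vertex \<open>v\<close> is the closed
  neighbourhood of \<open>v\<close>; every other one stays maximal without \<open>v\<close>. So each
  vertex accounts for at most one maximal clique.\<close>

lemma card_maximal_cliques_dismantlable:
  assumes "finite A" "dismantlable R A" and symR: "symp R"
  shows "card {K. maximal_clique R A K} \<le> card A + 1"
  using assms(1,2)
proof (induction "card A" arbitrary: A rule: less_induct)
  case less
  have sym: "\<And>x y. R x y \<Longrightarrow> R y x" using symR by (rule sympD)
  show ?case
  proof (cases "A = {}")
    case True
    then have "{K. maximal_clique R A K} = {{}}" by (auto simp: maximal_clique_def clique_def)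
    then show ?thesis by simp
  next
    case False
    then obtain v where v: "v \<in> A" "simplicial R A v" using less.prems(2) unfolding dismantlable_def by blast
    define N where "N = {x \<in> A - {v}. R v x}"
    have "{K. maximal_clique R A K} \<subseteq> insert (insert v N) {K. maximal_clique R (A - {v}) K}"
    proof
      fix K assume "K \<in> {K. maximal_clique R A K}"
      then have K: "K \<subseteq> A" "clique R K" "\<And>x. x \<in> A - K \<Longrightarrow> \<exists>y\<in>K. \<not> R x y" by (auto simp: maximal_clique_def)
      show "K \<in> insert (insert v N) {K. maximal_clique R (A - {v}) K}"
      proof (cases "v \<in> K")
        case True
        then have sub: "K \<subseteq> insert v N" using K by (auto simp: clique_def N_def)
        have "x \<in> K" if xN: "x \<in> insert v N" for x
        proof (rule ccontr)
          assume x: "x \<notin> K"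
          then obtain y where y: "y \<in> K" "\<not> R x y" using K(3)[of x] xN v by (auto simp: N_def)
          then show False using xN x sub v(2) True sym[of v x]
            by (cases "y = v") (auto simp: N_def simplicial_def)
        qed
        then show ?thesis using sub by blast
      next
        case False
        then show ?thesis using K by (auto simp: maximal_clique_def)
      qed
    qed
    then have "card {K. maximal_clique R A K} \<le> card (insert (insert v N) {K. maximal_clique R (A - {v}) K})"
      using less.prems(1) by (intro card_mono) (auto intro: finite_maximal_cliques)
    also have "\<dots> \<le> Suc (card {K. maximal_clique R (A - {v}) K})"
      by (rule card_insert_le_m1) auto
    also have "card {K. maximal_clique R (A - {v}) K} \<le> card (A - {v}) + 1"
      using less.prems dismantlable_subset[OF less.prems(2)] card_Diff1_less[OF less.prems(1) v(1)]
      by (intro less.hyps) auto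
    finally show ?thesis using card_Diff1_less[OF less.prems(1) v(1)] by linarith
  qed
qed

text \<open>Fix the trace \<open>T = K \<inter> S\<close>. The rest \<open>K - S\<close> is a
  maximal clique among the common neighbours \<open>D T\<close> of \<open>T\<close> outside
  \<open>S\<close>, a dismantlable set. There are at most \<open>2 ^ k\<close> traces, and trace and
  rest determine \<open>K\<close>.\<close>

lemma card_maximal_cliques:
  assumes fin: "finite A" and S: "S \<subseteq> A" "card S \<le> k" "dismantlable R (A - S)"
    and symR: "symp R"
  shows "card {K. maximal_clique R A K} \<le> 2 ^ k * (card A + 1)"
proof -
  have sym: "\<And>x y. R x y \<Longrightarrow> R y x" using symR by (rule sympD)
  define D where "D T = {x \<in> A - S. \<forall>t\<in>T. R t x}" for T
  let ?X = "SIGMA T:Pow S. {K. maximal_clique R (D T) K}"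
  let ?f = "\<lambda>K. (K \<inter> S, K - S)"
  have finS: "finite S" using S(1) fin by (rule finite_subset)
  have finD: "finite (D T)" for T using fin by (simp add: D_def)
  have D: "card {K. maximal_clique R (D T) K} \<le> card A + 1" for T
  proof -
    have "card {K. maximal_clique R (D T) K} \<le> card (D T) + 1"
      by (rule card_maximal_cliques_dismantlable[OF finD dismantlable_subset[OF S(3)] symR]) (auto simp: D_def)
    also have "card (D T) \<le> card A" using fin by (intro card_mono) (auto simp: D_def)
    finally show ?thesis by simp
  qed
  have "card {K. maximal_clique R A K} \<le> card ?X"
  proof (rule card_inj_on_le[of ?f])
    show "inj_on ?f {K. maximal_clique R A K}" by (rule inj_onI) blast
    show "finite ?X" using finS finD by (intro finite_SigmaI finite_maximal_cliques) auto
    show "?f ` {K. maximal_clique R A K} \<subseteq> ?X"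
    proof (rule image_subsetI)
      fix K assume "K \<in> {K. maximal_clique R A K}"
      then have K: "K \<subseteq> A" "clique R K" "\<And>x. x \<in> A - K \<Longrightarrow> \<exists>y\<in>K. \<not> R x y" by (auto simp: maximal_clique_def)
      have "maximal_clique R (D (K \<inter> S)) (K - S)"
        unfolding maximal_clique_def
      proof (intro conjI ballI)
        fix x assume x: "x \<in> D (K \<inter> S) - (K - S)"
        then obtain y where y: "y \<in> K" "\<not> R x y" using K(3)[of x] by (auto simp: D_def)
        then have "y \<notin> S" using x sym[of y x] by (auto simp: D_def)
        then show "\<exists>y\<in>K - S. \<not> R x y" using y by blast
      qed (use K in \<open>auto simp: D_def clique_def\<close>)
      then show "(K \<inter> S, K - S) \<in> ?X" by auto
    qed
  qed
  also have "card ?X = (\<Sum>T\<in>Pow S. card {K. maximal_clique R (D T) K})"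
    using finS finD by (intro card_SigmaI) (auto intro: finite_maximal_cliques)
  also have "\<dots> \<le> (\<Sum>T\<in>Pow S. card A + 1)" by (rule sum_mono) (rule D)
  also have "\<dots> = 2 ^ card S * (card A + 1)" using finS by (simp add: card_Pow)
  also have "\<dots> \<le> 2 ^ k * (card A + 1)" using S(2) by (intro mult_le_mono1 power_increasing) auto
  finally show ?thesis .
qed

section \<open>Maximum bipartite matchings\<close>

text \<open>
  A search state is a list of pairs \<open>(u, M)\<close>: the left vertex \<open>u\<close> is reached by an alternating path from
  an unmatched left vertex, and \<open>M\<close> is the matching obtained by switching along that path, so that \<open>u\<close> is
  unmatched in \<open>M\<close>.  Storing the switched matching instead of the path makes augmentation immediate.
\<close>

type_synonym search_state = "(nat \<times> (nat \<times> nat) list) list"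

text \<open>A right vertex whose partner in the matching of \<open>u\<close> is already reached
  leads to nothing new. An unmatched one is kept: it ends an augmenting path.\<close>

definition extensions :: "(nat \<Rightarrow> nat \<Rightarrow> bool) \<Rightarrow> nat list \<Rightarrow> search_state \<Rightarrow> (nat \<times> (nat \<times> nat) list \<times> nat) list" where
  "extensions rel rs st = concat (map (\<lambda>p. map (\<lambda>r. (fst p, snd p, r))
     (filter (\<lambda>r. rel (fst p) r \<and> \<not> (\<exists>e\<in>set (snd p). snd e = r \<and> (\<exists>q\<in>set st. fst q = fst e))) rs)) st)"

definition restart :: "nat list \<Rightarrow> (nat \<times> nat) list \<Rightarrow> search_state" where
  "restart ls M = map (\<lambda>w. (w, M)) (filter (\<lambda>w. \<not> (\<exists>e\<in>set M. fst e = w)) ls)"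

text \<open>If \<open>r\<close> is unmatched, the edge to \<open>r\<close> augments the matching and
  the search starts afresh. Otherwise \<open>u\<close> takes over \<open>r\<close>, and the former
  partner of \<open>r\<close>, now unmatched, is newly reached.\<close>

definition search_step :: "(nat \<Rightarrow> nat \<Rightarrow> bool) \<Rightarrow> nat list \<Rightarrow> nat list \<Rightarrow> search_state \<Rightarrow> search_state" where
  "search_step rel ls rs st = (case extensions rel rs st of
      [] \<Rightarrow> st
    | c # _ \<Rightarrow> (case filter (\<lambda>e. snd e = snd (snd c)) (fst (snd c)) of
          [] \<Rightarrow> restart ls ((fst c, snd (snd c)) # fst (snd c))
        | e # _ \<Rightarrow> (fst e, (fst c, snd (snd c)) # filter (\<lambda>e. \<not> snd e = snd (snd c)) (fst (snd c))) # st))"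

definition search :: "(nat \<Rightarrow> nat \<Rightarrow> bool) \<Rightarrow> nat list \<Rightarrow> nat list \<Rightarrow> search_state" where
  "search rel ls rs =
     foldr (\<lambda>_. search_step rel ls rs) [0..<(length ls + 1) * (length ls + 1)] (restart ls [])"

definition reached :: "(nat \<Rightarrow> nat \<Rightarrow> bool) \<Rightarrow> nat list \<Rightarrow> nat list \<Rightarrow> nat list" where
  "reached rel ls rs = map fst (search rel ls rs)"

definition matching :: "(nat \<Rightarrow> nat \<Rightarrow> bool) \<Rightarrow> nat list \<Rightarrow> nat list \<Rightarrow> (nat \<times> nat) list \<Rightarrow> bool" where
  "matching rel ls rs M \<longleftrightarrow> distinct (map fst M) \<and> distinct (map snd M) \<and>
     (\<forall>e\<in>set M. fst e \<in> set ls \<and> snd e \<in> set rs \<and> rel (fst e) (snd e))"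

text \<open>\<open>M\<close> is the matching of the last restart. Its edges survive in a stored
  matching as long as their left end is unreached; this links the stored matchings to
  \<open>M\<close> in the optimality proof.\<close>

definition search_invariant ::
  "(nat \<Rightarrow> nat \<Rightarrow> bool) \<Rightarrow> nat list \<Rightarrow> nat list \<Rightarrow> (nat \<times> nat) list \<Rightarrow> search_state \<Rightarrow> bool" where
  "search_invariant rel ls rs M st \<longleftrightarrow> matching rel ls rs M \<and> distinct (map fst st) \<and>
     set ls - fst ` set M \<subseteq> fst ` set st \<and>
     (\<forall>(u, M')\<in>set st. matching rel ls rs M' \<and> u \<in> set ls \<and> u \<notin> fst ` set M' \<and> length M' = length M \<and>
        snd ` set M' = snd ` set M \<and> (\<forall>e\<in>set M. fst e \<in> fst ` set st \<or> e \<in> set M'))"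

lemma set_extensions:
  "(u, M, r) \<in> set (extensions rel rs st) \<longleftrightarrow> (u, M) \<in> set st \<and> r \<in> set rs \<and> rel u r \<and>
     \<not> (\<exists>w. (w, r) \<in> set M \<and> w \<in> fst ` set st)"
proof -
  have key: "(\<exists>e\<in>set M. snd e = r \<and> (\<exists>q\<in>set st. fst q = fst e)) \<longleftrightarrow> (\<exists>w. (w, r) \<in> set M \<and> w \<in> fst ` set st)" for M r
    by (auto simp: image_iff) force+
  show ?thesis
    unfolding key[symmetric] extensions_def by (auto simp: image_iff intro!: bexI[of _ "(u, M)"])
qed

lemma restart_invariant:
  assumes "matching rel ls rs M" "distinct ls" shows "search_invariant rel ls rs M (restart ls M)"
  using assms unfolding search_invariant_def restart_def
  by (auto simp: image_iff comp_def)

lemma length_matching: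
  assumes "matching rel ls rs M" shows "length M \<le> length ls"
proof -
  have "length M = card (set (map fst M))" using assms distinct_card[of "map fst M"] by (simp add: matching_def)
  also have "\<dots> \<le> card (set ls)" using assms by (intro card_mono) (auto simp: matching_def)
  also have "\<dots> \<le> length ls" by (rule card_length)
  finally show ?thesis .
qed

lemma length_search_state:
  assumes "search_invariant rel ls rs M st" shows "length st \<le> length ls"
proof -
  have "length st = card (set (map fst st))"
    using assms distinct_card[of "map fst st"] by (simp add: search_invariant_def)
  also have "\<dots> \<le> card (set ls)" using assms by (intro card_mono) (auto simp: search_invariant_def)
  also have "\<dots> \<le> length ls" by (rule card_length)
  finally show ?thesis .
qed

lemma distinct_map_unique:
  "distinct (map f M) \<Longrightarrow> e \<in> set M \<Longrightarrow> e' \<in> set M \<Longrightarrow> f e = f e' \<Longrightarrow> e = e'"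
  by (auto simp: distinct_map dest: inj_onD)

lemma length_filter_remove:
  "distinct (map snd M) \<Longrightarrow> e \<in> set M \<Longrightarrow> Suc (length (filter (\<lambda>e'. snd e' \<noteq> snd e) M)) = length M"
proof (induction M)
  case (Cons a M)
  show ?case
  proof (cases "e = a")
    case True
    then have "snd e' \<noteq> snd e" if "e' \<in> set M" for e' using Cons.prems that by auto (metis image_eqI snd_conv)
    then have "filter (\<lambda>e'. snd e' \<noteq> snd e) M = M" by (simp add: filter_id_conv)
    then show ?thesis using True by simp
  next
    case False
    then have "snd a \<noteq> snd e" using Cons.prems by (metis distinct.simps(2) imageI list.simps(9) list.set_map set_ConsD)
    then show ?thesis using Cons False by auto
  qed
qed simp

lemma search_step_progress:
  assumes inv: "search_invariant rel ls rs M st" and ls: "distinct ls" and ne: "extensions rel rs st \<noteq> []"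
  shows "\<exists>M'. search_invariant rel ls rs M' (search_step rel ls rs st) \<and>
    length M * (length ls + 1) + length st < length M' * (length ls + 1) + length (search_step rel ls rs st)"
proof -
  obtain u N r cs where c: "extensions rel rs st = (u, N, r) # cs"
    using ne by (metis list.exhaust prod_cases3)
  then have "(u, N, r) \<in> set (extensions rel rs st)" by simp
  then have uN: "(u, N) \<in> set st" and r: "r \<in> set rs" "rel u r"
    and new: "\<And>w. (w, r) \<in> set N \<Longrightarrow> w \<notin> fst ` set st"
    by (auto simp: set_extensions)
  have N: "matching rel ls rs N" "u \<in> set ls" "u \<notin> fst ` set N" "length N = length M"
    "snd ` set N = snd ` set M" "\<And>e. e \<in> set M \<Longrightarrow> fst e \<in> fst ` set st \<or> e \<in> set N"
    using inv uN unfolding search_invariant_def by blast+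
  show ?thesis
  proof (cases "filter (\<lambda>e. snd e = r) N")
    case Nil
    then have "r \<notin> snd ` set N" by (auto simp: filter_empty_conv)
    then have "matching rel ls rs ((u, r) # N)" using N r by (auto simp: matching_def)
    then have "search_invariant rel ls rs ((u, r) # N) (restart ls ((u, r) # N))"
      using ls by (rule restart_invariant)
    moreover have "search_step rel ls rs st = restart ls ((u, r) # N)"
      by (simp add: search_step_def c Nil)
    \<comment> \<open>The larger matching outweighs the loss of the reached vertices, of which there
      are at most \<open>length ls\<close>.\<close>
    moreover have "length st \<le> length ls" using inv by (rule length_search_state)
    ultimately show ?thesis using N(4) by (intro exI[of _ "(u, r) # N"]) auto
  next
    case (Cons e es)
    have "e \<in> set (filter (\<lambda>e. snd e = r) N)" unfolding Cons by simp
    then obtain w where e: "e = (w, r)" "(w, r) \<in> set N" unfolding set_filter by (cases e) auto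
    let ?N = "filter (\<lambda>e. snd e \<noteq> r) N"
    have step: "search_step rel ls rs st = (w, (u, r) # ?N) # st"
      by (simp add: search_step_def c Cons e(1))
    have w: "w \<notin> fst ` set st" using new e(2) by blast
    then have wu: "w \<noteq> u" using uN by force
    have d: "distinct (map fst N)" "distinct (map snd N)" using N(1) by (auto simp: matching_def)
    have only: "e' = (w, r)" if "e' \<in> set N" "snd e' = r \<or> fst e' = w" for e'
      using that distinct_map_unique[OF d(1) _ e(2), of e'] distinct_map_unique[OF d(2) _ e(2), of e'] by auto
    have "matching rel ls rs ((u, r) # ?N) \<and> w \<in> set ls \<and> w \<notin> fst ` set ((u, r) # ?N) \<and>
        length ((u, r) # ?N) = length M \<and> snd ` set ((u, r) # ?N) = snd ` set M \<and>
        (\<forall>e'\<in>set M. fst e' \<in> fst ` set ((w, (u, r) # ?N) # st) \<or> e' \<in> set ((u, r) # ?N))"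
    proof (intro conjI)
      show "matching rel ls rs ((u, r) # ?N)"
      using N r d by (auto simp: matching_def distinct_map inj_on_def)
      show "w \<in> set ls" using N(1) e(2) by (auto simp: matching_def)
      show "w \<notin> fst ` set ((u, r) # ?N)" using wu only by auto
      show "length ((u, r) # ?N) = length M" using length_filter_remove[OF d(2) e(2)] N(4) by simp
      show "snd ` set ((u, r) # ?N) = snd ` set M" using e(2) unfolding N(5)[symmetric] by force
      show "\<forall>e'\<in>set M. fst e' \<in> fst ` set ((w, (u, r) # ?N) # st) \<or> e' \<in> set ((u, r) # ?N)"
      proof
        fix e' assume e': "e' \<in> set M"
        show "fst e' \<in> fst ` set ((w, (u, r) # ?N) # st) \<or> e' \<in> set ((u, r) # ?N)"
          using N(6)[OF e'] only[of e'] by (cases "e' = (w, r)") auto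
      qed
    qed
    moreover have "\<forall>(x, M')\<in>set st. matching rel ls rs M' \<and> x \<in> set ls \<and> x \<notin> fst ` set M' \<and>
        length M' = length M \<and> snd ` set M' = snd ` set M \<and>
        (\<forall>e\<in>set M. fst e \<in> fst ` set ((w, (u, r) # ?N) # st) \<or> e \<in> set M')"
    proof (rule ballI)
      fix p assume p: "p \<in> set st"
      obtain u' M' where p': "p = (u', M')" by fastforce
      have "matching rel ls rs M' \<and> u' \<in> set ls \<and> u' \<notin> fst ` set M' \<and> length M' = length M \<and>
          snd ` set M' = snd ` set M \<and> (\<forall>e\<in>set M. fst e \<in> fst ` set st \<or> e \<in> set M')"
        using inv p unfolding p' search_invariant_def by blast
      then show "case p of (x, M') \<Rightarrow> matching rel ls rs M' \<and> x \<in> set ls \<and> x \<notin> fst ` set M' \<and>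
          length M' = length M \<and> snd ` set M' = snd ` set M \<and>
          (\<forall>e\<in>set M. fst e \<in> fst ` set ((w, (u, r) # ?N) # st) \<or> e \<in> set M')"
        unfolding p' by auto
    qed
    moreover have "distinct (map fst ((w, (u, r) # ?N) # st))" "set ls - fst ` set M \<subseteq> fst ` set ((w, (u, r) # ?N) # st)"
      "matching rel ls rs M"
      using inv w unfolding search_invariant_def by auto
    ultimately have "search_invariant rel ls rs M (search_step rel ls rs st)"
      unfolding step search_invariant_def by simp
    then show ?thesis unfolding step by (intro exI[of _ M]) auto
  qed
qed

lemma search_finished:
  assumes ls: "distinct ls"
  shows "\<exists>M. search_invariant rel ls rs M (search rel ls rs) \<and> extensions rel rs (search rel ls rs) = []"
proof -
  let ?P = "\<lambda>M st. length M * (length ls + 1) + length st"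
  have "\<exists>M. search_invariant rel ls rs M (foldr (\<lambda>_. search_step rel ls rs) (is :: nat list) (restart ls [])) \<and>
    (extensions rel rs (foldr (\<lambda>_. search_step rel ls rs) is (restart ls [])) = [] \<or>
      length is \<le> ?P M (foldr (\<lambda>_. search_step rel ls rs) is (restart ls [])))" for "is"
  proof (induction "is")
    case Nil
    have "search_invariant rel ls rs [] (restart ls [])"
      by (rule restart_invariant) (auto simp: matching_def ls)
    then show ?case by auto
  next
    case (Cons i "is")
    let ?st = "foldr (\<lambda>_. search_step rel ls rs) is (restart ls [])"
    obtain M where M: "search_invariant rel ls rs M ?st" "extensions rel rs ?st = [] \<or> length is \<le> ?P M ?st"
      using Cons.IH by blast
    show ?case
    proof (cases "extensions rel rs ?st = []")
      case True
      then have "search_step rel ls rs ?st = ?st" by (simp add: search_step_def)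
      then show ?thesis using M(1) True by auto
    next
      case False
      then obtain M' where "search_invariant rel ls rs M' (search_step rel ls rs ?st)"
        "?P M ?st < ?P M' (search_step rel ls rs ?st)"
        using search_step_progress[OF M(1) ls] by blast
      then show ?thesis using M(2) False by (intro exI[of _ M']) auto
    qed
  qed
  from this[of "[0..<(length ls + 1) * (length ls + 1)]"] obtain M where
    M: "search_invariant rel ls rs M (search rel ls rs)"
    "extensions rel rs (search rel ls rs) = [] \<or>
      (length ls + 1) * (length ls + 1) \<le> ?P M (search rel ls rs)"
    unfolding search_def by auto
  have "matching rel ls rs M" using M(1) by (simp add: search_invariant_def)
  then have "?P M (search rel ls rs) \<le> length ls * (length ls + 1) + length ls"
    by (intro add_le_mono mult_le_mono1 length_matching length_search_state[OF M(1)])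
  then show ?thesis using M by auto
qed

text \<open>
  Koenig's theorem: no such pair has more than \<open>|ls| + |rs| - |M|\<close> vertices, and the reached
  vertices together with their non-neighbours attain this bound.
\<close>

lemma reached_optimal:
  assumes ls: "distinct ls" and P0: "P0 \<subseteq> set ls" and Q0: "Q0 \<subseteq> set rs"
    and PQ: "\<And>p q. p \<in> P0 \<Longrightarrow> q \<in> Q0 \<Longrightarrow> \<not> rel p q"
  shows "card P0 + card Q0 \<le>
    card (set (reached rel ls rs)) + card {r \<in> set rs. \<forall>p\<in>set (reached rel ls rs). \<not> rel p r}"
proof -
  obtain M where inv: "search_invariant rel ls rs M (search rel ls rs)"
    and fin: "extensions rel rs (search rel ls rs) = []"
    using search_finished[OF ls] by blast
  define P where "P = set (reached rel ls rs)"
  define Q where "Q = {r \<in> set rs. \<forall>p\<in>P. \<not> rel p r}"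
  have P: "P = fst ` set (search rel ls rs)" by (simp add: P_def reached_def)
  have Pls: "P \<subseteq> set ls" using inv by (auto simp: P search_invariant_def)
  have M: "matching rel ls rs M" using inv by (simp add: search_invariant_def)
  have inj: "inj_on fst (set M)" "inj_on snd (set M)" using M by (auto simp: matching_def distinct_map)
  have split: "card {e \<in> set M. fst e \<in> X} + card {e \<in> set M. fst e \<notin> X} = card (set M)" for X
    by (subst card_Un_disjoint[symmetric]) (auto intro!: arg_cong[where f=card])
  \<comment> \<open>Weak duality: no edge of \<open>M\<close> joins \<open>P0\<close> to
    \<open>Q0\<close>. Each edge is charged to its right end outside \<open>Q0\<close> or to its
    left end outside \<open>P0\<close>.\<close>
  have "card {e \<in> set M. fst e \<in> P0} \<le> card (set rs - Q0)"
    by (rule card_inj_on_le[of snd]) (use M PQ inj(2) in \<open>auto simp: matching_def inj_on_def\<close>)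
  moreover have "card {e \<in> set M. fst e \<notin> P0} \<le> card (set ls - P0)"
    by (rule card_inj_on_le[of fst]) (use M inj(1) in \<open>auto simp: matching_def inj_on_def\<close>)
  moreover have "card (set rs - Q0) + card Q0 = card (set rs)"
    using Q0 by (metis List.finite_set add.commute card_mono card_Diff_subset finite_subset le_add_diff_inverse)
  moreover have "card (set ls - P0) + card P0 = card (set ls)"
    using P0 by (metis List.finite_set add.commute card_mono card_Diff_subset finite_subset le_add_diff_inverse)
  ultimately have weak: "card (set M) + card P0 + card Q0 \<le> card (set ls) + card (set rs)"
    using split[of P0] by linarith
  have "set ls - P \<subseteq> fst ` {e \<in> set M. fst e \<notin> P}"
  proof
    fix x assume x: "x \<in> set ls - P"
    then have "x \<in> fst ` set M" using inv by (auto simp: P search_invariant_def)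
    then show "x \<in> fst ` {e \<in> set M. fst e \<notin> P}" using x by auto
  qed
  then have "card (set ls - P) \<le> card (fst ` {e \<in> set M. fst e \<notin> P})" by (intro card_mono) auto
  also have "\<dots> \<le> card {e \<in> set M. fst e \<notin> P}" by (rule card_image_le) auto
  finally have 1: "card (set ls - P) \<le> card {e \<in> set M. fst e \<notin> P}" .
  have "set rs - Q \<subseteq> snd ` {e \<in> set M. fst e \<in> P}"
  proof
    fix r assume r: "r \<in> set rs - Q"
    then obtain u N where u: "(u, N) \<in> set (search rel ls rs)" "rel u r"
      by (auto simp: Q_def P)
    moreover have "(u, N, r) \<notin> set (extensions rel rs (search rel ls rs))" using fin by simp
    ultimately obtain w where w: "(w, r) \<in> set N" "w \<in> P"
      using r unfolding set_extensions P by blast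
    have N: "matching rel ls rs N" "snd ` set N = snd ` set M" "\<And>e. e \<in> set M \<Longrightarrow> fst e \<in> P \<or> e \<in> set N"
      using inv u(1) unfolding search_invariant_def P by blast+
    have "r \<in> snd ` set M" using w(1) N(2) by force
    then obtain w0 where w0: "(w0, r) \<in> set M" by auto
    \<comment> \<open>The finished search only says that the partner \<open>w\<close> of
      \<open>r\<close> in the stored matching \<open>N\<close> is reached. If the partner
      \<open>w0\<close> in \<open>M\<close> were unreached, its edge would survive in
      \<open>N\<close>, so that \<open>w0 = w\<close>.\<close>
    have "w0 \<in> P"
    proof (rule ccontr)
      assume "w0 \<notin> P"
      then have "(w0, r) \<in> set N" using N(3)[OF w0] by simp
      then have "(w0, r) = (w, r)"
        using w(1) N(1) distinct_map_unique[of snd N "(w0, r)" "(w, r)"] by (auto simp: matching_def)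
      then have "w0 = w" by simp
      then show False using w(2) \<open>w0 \<notin> P\<close> by simp
    qed
    then show "r \<in> snd ` {e \<in> set M. fst e \<in> P}" using w0 by force
  qed
  then have "card (set rs - Q) \<le> card (snd ` {e \<in> set M. fst e \<in> P})" by (intro card_mono) auto
  also have "\<dots> \<le> card {e \<in> set M. fst e \<in> P}" by (rule card_image_le) auto
  finally have 2: "card (set rs - Q) \<le> card {e \<in> set M. fst e \<in> P}" .
  have "card (set rs - Q) + card Q = card (set rs)" "card (set ls - P) + card P = card (set ls)"
    using Pls by (auto simp: card_Diff_subset card_mono finite_subset Q_def)
  then show ?thesis using weak 1 2 split[of P] unfolding P_def[symmetric] Q_def[symmetric] by linarith
qed

lemma reached_subset: "distinct ls \<Longrightarrow> set (reached rel ls rs) \<subseteq> set ls"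
  using search_finished[of ls rel rs] unfolding search_invariant_def reached_def by auto

section \<open>The algorithm\<close>

text \<open>The defaults make all positions outside the matrix non-edges, so \<open>adj\<close> is
  meaningful for ragged matrices too.\<close>

definition adj :: "bool list list \<Rightarrow> nat \<Rightarrow> nat \<Rightarrow> bool" where
  "adj G u v = nth_default False (nth_default [] G u) v"

text \<open>
  A cap bounds the running time on all inputs.  It takes effect only in the enumeration of cliques, and only if
  there is no small chordal vertex deletion set.
\<close>

definition cap :: "nat \<Rightarrow> 'a list \<Rightarrow> 'a list" where
  "cap L xs = (if length xs \<le> L then xs else [])"

text \<open>For a preorder this keeps one representative of each class of maximal elements. It
  serves twice: with inclusion for maximal cliques, and with \<open>dominated\<close> for the tables
  of the dynamic programme.\<close>

definition thin :: "('a \<Rightarrow> 'a \<Rightarrow> bool) \<Rightarrow> 'a list \<Rightarrow> 'a list" where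
  "thin le xs = foldr (\<lambda>x acc. if \<exists>y\<in>set acc. le x y then acc else x # filter (\<lambda>y. \<not> le y x) acc) xs []"

lemma thin_Nil [simp]: "thin le [] = []"
  by (simp add: thin_def)

lemma thin_Cons: "thin le (x # xs) = (if \<exists>y\<in>set (thin le xs). le x y then thin le xs
    else x # filter (\<lambda>y. \<not> le y x) (thin le xs))"
  by (simp add: thin_def)

lemma set_thin_subset: "set (thin le xs) \<subseteq> set xs"
  by (induction xs) (auto simp: thin_Cons)

lemma thin_dominates:
  assumes "reflp le" "transp le"
  shows "x \<in> set xs \<Longrightarrow> \<exists>y\<in>set (thin le xs). le x y"
proof (induction xs)
  case (Cons a xs)
  show ?case
  proof (cases "\<exists>y\<in>set (thin le xs). le a y")
    case True
    then show ?thesis using Cons by (auto simp: thin_Cons)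
  next
    case False
    have "le a a" using assms(1) by (rule reflpD)
    moreover have "le x a" if "le x y" "le y a" for y using assms(2) that by (rule transpD)
    ultimately show ?thesis using False Cons by (auto simp: thin_Cons)
  qed
qed simp

lemma thin_antichain: "sorted_wrt (\<lambda>x y. \<not> le x y \<and> \<not> le y x) (thin le xs)"
  by (induction xs) (auto simp: thin_Cons sorted_wrt_filter)

lemma thin_incomparable:
  assumes "x \<in> set (thin le xs)" "y \<in> set (thin le xs)" "x \<noteq> y" shows "\<not> le x y"
proof -
  have "\<not> le x y" if "sorted_wrt (\<lambda>x y. \<not> le x y \<and> \<not> le y x) ys" "x \<in> set ys" "y \<in> set ys" for ys
    using that assms(3) by (induction ys) auto
  then show ?thesis using thin_antichain assms by blast
qed

text \<open>The way to bound the length of a thinned list: its elements are incomparable, so they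
  have different values under \<open>h\<close>, and it is enough to count the possible
  values.\<close>

lemma distinct_map_thin:
  assumes "\<And>x y. x \<in> set xs \<Longrightarrow> y \<in> set xs \<Longrightarrow> h x = h y \<Longrightarrow> le x y \<or> le y x"
  shows "distinct (map h (thin le xs))"
proof -
  have "sorted_wrt (\<lambda>x y. h x \<noteq> h y) (thin le xs)"
    by (rule sorted_wrt_mono_rel[OF _ thin_antichain[of le xs]]) (use assms set_thin_subset[of le xs] in blast)
  moreover have "distinct (map h ys)" if "sorted_wrt (\<lambda>x y. h x \<noteq> h y) ys" for ys
    using that by (induction ys) auto
  ultimately show ?thesis by blast
qed

definition sublist_le :: "nat list \<Rightarrow> nat list \<Rightarrow> bool" where
  "sublist_le K K' \<longleftrightarrow> (\<forall>u\<in>set K. u \<in> set K')"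

definition cliques_step :: "bool list list \<Rightarrow> nat \<Rightarrow> nat \<Rightarrow> nat list list \<Rightarrow> nat list list" where
  "cliques_step G L v F = cap L (thin sublist_le (map (\<lambda>K. v # filter (\<lambda>u. adj G v u) K) F @ F))"

definition cliques :: "bool list list \<Rightarrow> nat \<Rightarrow> nat list list" where
  "cliques G L = foldr (cliques_step G L) [0..<length G] [[]]"

lemma sublist_le_iff: "sublist_le K K' \<longleftrightarrow> set K \<subseteq> set K'"
  by (auto simp: sublist_le_def)

lemma cliques_step_clique:
  assumes "symp (adj G)" "\<forall>K\<in>set F. clique (adj G) (set K) \<and> set K \<subseteq> X" "K \<in> set (cliques_step G L v F)"
  shows "clique (adj G) (set K) \<and> set K \<subseteq> insert v X"
proof -
  have "K \<in> set (thin sublist_le (map (\<lambda>K. v # filter (\<lambda>u. adj G v u) K) F @ F))"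
    using assms(3) unfolding cliques_step_def cap_def by (auto split: if_splits)
  then have "K \<in> set (map (\<lambda>K. v # filter (\<lambda>u. adj G v u) K) F @ F)" by (rule subsetD[OF set_thin_subset])
  then consider "K \<in> set F" | K' where "K' \<in> set F" "K = v # filter (\<lambda>u. adj G v u) K'" by auto
  then show ?thesis
  proof cases
    case 1
    then show ?thesis using assms(2) by auto
  next
    case 2
    then have "clique (adj G) (set K')" "set K' \<subseteq> X" using assms(2) by auto
    then show ?thesis unfolding 2 using sympD[OF assms(1)] by (auto simp: clique_def)
  qed
qed

lemma foldr_cliques_clique:
  assumes "symp (adj G)" "K \<in> set (foldr (cliques_step G L) vs [[]])"
  shows "clique (adj G) (set K) \<and> set K \<subseteq> set vs"
  using assms(2)
proof (induction vs arbitrary: K)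
  case Nil
  then show ?case by (simp add: clique_def)
next
  case (Cons v vs)
  then show ?case
    using cliques_step_clique[OF assms(1), of "foldr (cliques_step G L) vs [[]]" "set vs" K L v] by auto
qed

text \<open>After each vertex the thinned family represents only maximal cliques of the graph on the
  vertices seen so far, each at most once. \<open>S\<close> restricted to these vertices is still a
  deletion set, so there are at most \<open>2 ^ k * (card A + 1)\<close> of them and
  \<open>cap\<close> removes nothing.\<close>

lemma foldr_cliques_complete:
  assumes symp: "symp (adj G)" and S: "S \<subseteq> A" "finite A" "card S \<le> k" "dismantlable (adj G) (A - S)"
    and L: "2 ^ k * (card A + 1) \<le> L"
  shows "set vs \<subseteq> A \<Longrightarrow> clique (adj G) Q \<Longrightarrow> Q \<subseteq> set vs \<Longrightarrow>
    \<exists>K\<in>set (foldr (cliques_step G L) vs [[]]). Q \<subseteq> set K"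
proof (induction vs arbitrary: Q)
  case (Cons v vs)
  let ?F = "foldr (cliques_step G L) vs [[]]"
  let ?F' = "map (\<lambda>K. v # filter (\<lambda>u. adj G v u) K) ?F @ ?F"
  have cover: "\<exists>K\<in>set (thin sublist_le ?F'). Q \<subseteq> set K" if Q: "clique (adj G) Q" "Q \<subseteq> set (v # vs)" for Q
  proof -
    have "clique (adj G) (Q - {v})" using Q(1) by (auto simp: clique_def)
    moreover have "Q - {v} \<subseteq> set vs" using Q(2) by auto
    ultimately obtain K where K: "K \<in> set ?F" "Q - {v} \<subseteq> set K"
      using Cons.IH[of "Q - {v}"] Cons.prems(1) by auto
    have "\<exists>K'\<in>set ?F'. Q \<subseteq> set K'"
    proof (cases "v \<in> Q")
      case True
      then have "Q \<subseteq> set (v # filter (\<lambda>u. adj G v u) K)" using Q(1) K(2) by (auto simp: clique_def)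
      then show ?thesis using K(1) by (intro bexI[of _ "v # filter (\<lambda>u. adj G v u) K"]) auto
    next
      case False
      then show ?thesis using K by auto
    qed
    then obtain K' where K': "K' \<in> set ?F'" "Q \<subseteq> set K'" by blast
    have "\<exists>K''\<in>set (thin sublist_le ?F'). sublist_le K' K''"
      by (rule thin_dominates[OF _ _ K'(1)]) (auto simp: sublist_le_iff intro!: reflpI transpI)
    then show ?thesis using K'(2) by (auto simp: sublist_le_iff)
  qed
  have sub: "set K \<subseteq> set (v # vs) \<and> clique (adj G) (set K)" if K: "K \<in> set (thin sublist_le ?F')" for K
  proof -
    have "K \<in> set (cliques_step G (length (thin sublist_le ?F')) v ?F)"
      using K by (simp add: cliques_step_def cap_def)
    then show ?thesis
      using cliques_step_clique[OF symp, of ?F "set vs"] foldr_cliques_clique[OF symp] by auto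
  qed
  have "distinct (map set (thin sublist_le ?F'))"
    by (rule distinct_map_thin) (simp add: sublist_le_iff)
  then have "length (thin sublist_le ?F') = card (set ` set (thin sublist_le ?F'))"
    using distinct_card by fastforce
  also have "\<dots> \<le> card {K. maximal_clique (adj G) (set (v # vs)) K}"
  proof (rule card_mono)
    show "finite {K. maximal_clique (adj G) (set (v # vs)) K}" by (rule finite_maximal_cliques) simp
    show "set ` set (thin sublist_le ?F') \<subseteq> {K. maximal_clique (adj G) (set (v # vs)) K}"
    proof (rule image_subsetI)
      fix K assume K: "K \<in> set (thin sublist_le ?F')"
      have "\<exists>y\<in>set K. \<not> adj G x y" if x: "x \<in> set (v # vs) - set K" for x
      proof (rule ccontr)
        assume "\<not> (\<exists>y\<in>set K. \<not> adj G x y)"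
        then have "clique (adj G) (insert x (set K))"
          using sub[OF K] sympD[OF symp] by (auto simp: clique_def)
        then obtain K' where K': "K' \<in> set (thin sublist_le ?F')" "insert x (set K) \<subseteq> set K'"
          using cover[of "insert x (set K)"] x sub[OF K] by auto
        have "K \<noteq> K'" using K'(2) x by auto
        moreover have "sublist_le K K'" using K'(2) by (auto simp: sublist_le_iff)
        ultimately show False
          using thin_incomparable[OF K K'(1)] by blast
      qed
      then show "set K \<in> {K. maximal_clique (adj G) (set (v # vs)) K}"
        using sub[OF K] by (simp add: maximal_clique_def)
    qed
  qed
  also have "\<dots> \<le> 2 ^ k * (card (set (v # vs)) + 1)"
  proof (rule card_maximal_cliques[OF _ _ _ _ symp])
    have "card (S \<inter> set (v # vs)) \<le> card S" using S by (intro card_mono) (auto intro: finite_subset)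
    then show "card (S \<inter> set (v # vs)) \<le> k" using S by linarith
    show "dismantlable (adj G) (set (v # vs) - S \<inter> set (v # vs))"
      by (rule dismantlable_subset[OF S(4)]) (use Cons.prems(1) in auto)
  qed auto
  also have "card (set (v # vs)) \<le> card A" using S(2) Cons.prems(1) by (rule card_mono)
  then have "2 ^ k * (card (set (v # vs)) + 1) \<le> L" using L by (meson add_le_mono1 le_trans mult_le_mono2)
  finally have "foldr (cliques_step G L) (v # vs) [[]] = thin sublist_le ?F'"
    by (simp add: cliques_step_def cap_def)
  then show ?case using cover[OF Cons.prems(2,3)] by simp
qed auto

section \<open>Regions, bags and their splitting\<close>

type_synonym token = "bool \<times> nat list"
type_synonym region = "nat list \<times> token list"

text \<open>
  A region \<open>(D, ts)\<close> consists of vertices \<open>D\<close> that still have to be decomposed and of a bag, given as a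
  list of tokens.  A token is a clique, flagged \<open>True\<close>, or a single vertex, flagged \<open>False\<close>; with
  weight \<open>k + 1\<close> for cliques, one balanced separator controls both the number of cliques and the number of
  single vertices in a bag.
\<close>

definition verts :: "token list \<Rightarrow> nat list" where
  "verts ts = concat (map snd ts)"

definition weight :: "nat \<Rightarrow> token list \<Rightarrow> nat" where
  "weight k ts = sum_list (map (\<lambda>t. if fst t then k + 1 else 1) ts)"

definition splits :: "nat \<Rightarrow> 'a list \<Rightarrow> ('a list \<times> 'a list) list" where
  "splits L ts = foldr (\<lambda>t acc. cap L (map (\<lambda>p. (t # fst p, snd p)) acc @ map (\<lambda>p. (fst p, t # snd p)) acc)) ts [([], [])]"

text \<open>Reflexive, so that a pair without near vertices is both disjoint and without edges in
  between.\<close>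

definition near :: "bool list list \<Rightarrow> nat \<Rightarrow> nat \<Rightarrow> bool" where
  "near G u v \<longleftrightarrow> u = v \<or> adj G u v"

text \<open>A minimum separator as a matching problem: each vertex of \<open>V\<close> has a left
  copy unless it is bound to \<open>B\<close> and a right copy unless it is bound to
  \<open>A\<close>, and copies of near vertices are joined. A largest pair without near vertices
  leaves the fewest vertices as a separator.\<close>

definition near_side :: "bool list list \<Rightarrow> nat list \<Rightarrow> nat list \<Rightarrow> nat list \<Rightarrow> nat list" where
  "near_side G V A B = reached (near G) (filter (\<lambda>v. v \<notin> set B) V) (filter (\<lambda>v. v \<notin> set A) V)"

definition far_side :: "bool list list \<Rightarrow> nat list \<Rightarrow> nat list \<Rightarrow> nat list \<Rightarrow> nat list" where
  "far_side G V A P = filter (\<lambda>v. v \<notin> set A \<and> \<not> (\<exists>p\<in>set P. near G p v)) V"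

text \<open>The vertex \<open>v\<close> of the undecomposed part is sacrificed to the bag so that
  the recursion progresses even when the separator lies entirely inside the old bag.\<close>

definition new_tokens :: "nat list \<Rightarrow> nat list \<Rightarrow> nat \<Rightarrow> nat list \<Rightarrow> nat list \<Rightarrow> nat list \<Rightarrow> token list" where
  "new_tokens U C v V P Q = (True, filter (\<lambda>u. u \<in> set C) U) # (False, [v]) #
     map (\<lambda>z. (False, [z])) (filter (\<lambda>z. z \<notin> set P \<and> z \<notin> set Q) V)"

definition make_children :: "nat list \<Rightarrow> token list \<Rightarrow> token list \<Rightarrow> token list \<Rightarrow> nat list \<Rightarrow> nat list \<Rightarrow> region \<times> region" where
  "make_children D new ls rs P Q =
     ((filter (\<lambda>u. u \<in> set P) D, ls @ new), (filter (\<lambda>u. u \<in> set Q) D, rs @ new))"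

definition remaining :: "nat list \<Rightarrow> nat list \<Rightarrow> nat \<Rightarrow> nat list" where
  "remaining U C v = filter (\<lambda>u. u \<notin> set C \<and> u \<noteq> v) U"

definition children :: "bool list list \<Rightarrow> nat list \<Rightarrow> nat \<Rightarrow> nat list \<Rightarrow> nat list \<Rightarrow>
    token list \<times> token list \<Rightarrow> region \<times> region" where
  "children G U v D C lr =
     (let V = remaining U C v; P = near_side G V (verts (fst lr)) (verts (snd lr));
          Q = far_side G V (verts (fst lr)) P
      in make_children D (new_tokens U C v V P Q) (fst lr) (snd lr) P Q)"

definition region_verts :: "bool list list \<Rightarrow> region \<Rightarrow> nat list" where
  "region_verts G a = filter (\<lambda>v. v \<in> set (fst a) \<or> v \<in> set (verts (snd a))) [0..<length G]"

definition candidates :: "bool list list \<Rightarrow> nat \<Rightarrow> nat list list \<Rightarrow> region \<Rightarrow> nat \<Rightarrow> (region \<times> region) list" where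
  "candidates G L F a v = concat (map (\<lambda>C. map (children G (region_verts G a) v (fst a) C) (splits L (snd a))) F)"

definition light :: "nat \<Rightarrow> region \<times> region \<Rightarrow> bool" where
  "light k c \<longleftrightarrow> weight k (snd (fst c)) \<le> 6 * k + 6 \<and> weight k (snd (snd c)) \<le> 6 * k + 6"

definition split_region :: "bool list list \<Rightarrow> nat \<Rightarrow> nat \<Rightarrow> nat list list \<Rightarrow> region \<Rightarrow> (region \<times> region) option" where
  "split_region G k L F a = (case fst a of [] \<Rightarrow> None
     | v # _ \<Rightarrow> (case filter (light k) (candidates G L F a v) of [] \<Rightarrow> None | c # _ \<Rightarrow> Some c))"

text \<open>
  Minimum odd cycle transversals of \<open>G\<close> are the complements of maximum independent sets in the product of \<open>G\<close> with
  an edge, whose vertices are coloured vertices of \<open>G\<close>.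
\<close>

type_synonym coloured = "nat \<times> bool"

definition conflict :: "bool list list \<Rightarrow> coloured \<Rightarrow> coloured \<Rightarrow> bool" where
  "conflict G x y \<longleftrightarrow> (fst x = fst y \<and> snd x \<noteq> snd y) \<or> (adj G (fst x) (fst y) \<and> snd x = snd y)"

definition indep_sets :: "bool list list \<Rightarrow> nat \<Rightarrow> coloured list \<Rightarrow> coloured list list" where
  "indep_sets G L xs =
     foldr (\<lambda>x F. cap L (map (\<lambda>I. x # I) (filter (\<lambda>I. \<forall>y\<in>set I. \<not> conflict G x y) F) @ F)) xs [[]]"

definition colourings :: "bool list list \<Rightarrow> token list \<Rightarrow> coloured list" where
  "colourings G ts = concat (map (\<lambda>v. [(v, False), (v, True)]) (filter (\<lambda>v. v \<in> set (verts ts)) [0..<length G]))"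

definition leaf :: "bool list list \<Rightarrow> nat \<Rightarrow> region \<Rightarrow> coloured list list" where
  "leaf G L a = (case fst a of [] \<Rightarrow> indep_sets G L (colourings G (snd a)) | _ # _ \<Rightarrow> [])"

text \<open>The scopes of two regions meet only inside both bags, so comparing \<open>I\<close> on
  \<open>W2\<close> and \<open>J\<close> on \<open>W1\<close> compares them on all common vertices.
  For \<open>W1 = W2\<close> this is equality on one bag.\<close>

definition agree :: "nat list \<Rightarrow> nat list \<Rightarrow> coloured list \<Rightarrow> coloured list \<Rightarrow> bool" where
  "agree W1 W2 I J \<longleftrightarrow> (\<forall>x\<in>set I. fst x \<in> set W2 \<longrightarrow> x \<in> set J) \<and> (\<forall>x\<in>set J. fst x \<in> set W1 \<longrightarrow> x \<in> set I)"

definition joins :: "nat list \<Rightarrow> nat list \<Rightarrow> coloured list list \<Rightarrow> coloured list list \<Rightarrow> coloured list list" where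
  "joins W1 W2 F1 F2 =
     concat (map (\<lambda>I. map (\<lambda>J. I @ filter (\<lambda>y. y \<notin> set I) J) (filter (agree W1 W2 I) F2)) F1)"

text \<open>Partial solutions with the same trace on the bag have the same extensions outside the
  region, so only the largest of them matters.\<close>

definition dominated :: "nat list \<Rightarrow> coloured list \<Rightarrow> coloured list \<Rightarrow> bool" where
  "dominated W I J \<longleftrightarrow> length I \<le> length J \<and> agree W W I J"

definition combine :: "nat \<Rightarrow> region \<Rightarrow> region \<times> region \<Rightarrow> coloured list list \<Rightarrow> coloured list list \<Rightarrow> coloured list list" where
  "combine L a c F1 F2 =
     cap L (thin (dominated (verts (snd a))) (joins (verts (snd (fst c))) (verts (snd (snd c))) F1 F2))"

lemma near_side_subset: "distinct V \<Longrightarrow> set (near_side G V A B) \<subseteq> set V - set B"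
  unfolding near_side_def using reached_subset[of "filter (\<lambda>v. v \<notin> set B) V"] by fastforce

lemma set_verts_append [simp]: "set (verts (xs @ ys)) = set (verts xs) \<union> set (verts ys)"
  by (auto simp: verts_def)

lemma weight_append [simp]: "weight k (xs @ ys) = weight k xs + weight k ys"
  by (simp add: weight_def)

lemma length_filter_disjoint:
  "(\<And>x. x \<in> set xs \<Longrightarrow> \<not> (p x \<and> q x)) \<Longrightarrow> length (filter p xs) + length (filter q xs) \<le> length xs"
proof (induction xs)
  case (Cons a xs)
  have "\<not> (p a \<and> q a)" "length (filter p xs) + length (filter q xs) \<le> length xs" using Cons by simp_all
  then show ?case by auto
qed simp

lemma split_regionE:
  assumes "split_region G k L F a = Some c"
  obtains v D C lr where "fst a = v # D" "C \<in> set F" "lr \<in> set (splits L (snd a))"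
    "c = children G (region_verts G a) v (fst a) C lr" "light k c"
proof -
  obtain v D where v: "fst a = v # D"
    using assms by (auto simp: split_region_def split: list.splits)
  then obtain cs where "filter (light k) (candidates G L F a v) = c # cs"
    using assms by (auto simp: split_region_def split: list.splits)
  then have "c \<in> set (filter (light k) (candidates G L F a v))" by (metis list.set_intros(1))
  then show thesis using that v by (auto simp: candidates_def)
qed

text \<open>\<open>P\<close> and \<open>Q\<close> are disjoint and both avoid \<open>v\<close>,
  whatever split was accepted. Thus \<open>solve\<close> terminates on every input, and the sum of
  the two lengths is the measure that the time bound for divide and conquer asks for.\<close>

lemma split_region_decreasing:
  assumes "split_region G k L F a = Some c"
  shows "length (fst (fst c)) + length (fst (snd c)) < length (fst a)"
proof -
  obtain v D C lr where v: "fst a = v # D"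
    and c: "c = children G (region_verts G a) v (fst a) C lr"
    using assms by (rule split_regionE) blast
  let ?V = "remaining (region_verts G a) C v"
  define P where "P = near_side G ?V (verts (fst lr)) (verts (snd lr))"
  define Q where "Q = far_side G ?V (verts (fst lr)) P"
  have "distinct ?V" by (simp add: remaining_def region_verts_def)
  then have P: "set P \<subseteq> set ?V" unfolding P_def using near_side_subset by blast
  have Q: "set Q \<subseteq> set ?V" "\<And>x. x \<in> set Q \<Longrightarrow> x \<notin> set P" by (auto simp: Q_def far_side_def near_def)
  have "v \<notin> set ?V" by (simp add: remaining_def)
  then have "v \<notin> set P" "v \<notin> set Q" using P Q by auto
  moreover have "fst (fst c) = filter (\<lambda>u. u \<in> set P) (v # D)" "fst (snd c) = filter (\<lambda>u. u \<in> set Q) (v # D)"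
    by (simp_all add: c children_def make_children_def P_def Q_def v Let_def)
  moreover have "length (filter (\<lambda>u. u \<in> set P) D) + length (filter (\<lambda>u. u \<in> set Q) D) \<le> length D"
    by (rule length_filter_disjoint) (use Q in auto)
  ultimately show ?thesis by (simp add: v)
qed

text \<open>
  The empty table signals failure; a correct table is never empty, since the empty set is independent.
\<close>

function solve :: "bool list list \<Rightarrow> nat \<Rightarrow> nat \<Rightarrow> nat list list \<Rightarrow> region \<Rightarrow> coloured list list" where
  "solve G k L F a = (case split_region G k L F a of None \<Rightarrow> leaf G L a
     | Some c \<Rightarrow> combine L a c (solve G k L F (fst c)) (solve G k L F (snd c)))"
  by pat_completeness auto
termination
  by (relation "measure (\<lambda>(G, k, L, F, a). length (fst a))") (auto dest!: split_region_decreasing)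

declare solve.simps [simp del]

section \<open>Correctness of the decomposition\<close>

definition scope :: "region \<Rightarrow> nat set" where
  "scope a = set (fst a) \<union> set (verts (snd a))"

definition well_formed :: "bool list list \<Rightarrow> nat \<Rightarrow> region \<Rightarrow> bool" where
  "well_formed G k a \<longleftrightarrow> scope a \<subseteq> {..<length G} \<and> set (fst a) \<inter> set (verts (snd a)) = {} \<and>
     (\<forall>t\<in>set (snd a). clique (adj G) (set (snd t)) \<and> (\<not> fst t \<longrightarrow> (\<exists>v. snd t = [v]))) \<and>
     weight k (snd a) \<le> 6 * k + 6"

lemma splits_cover: "lr \<in> set (splits L ts) \<Longrightarrow> set (fst lr) \<union> set (snd lr) = set ts"
proof (induction ts arbitrary: lr)
  case (Cons t ts)
  have "splits L (t # ts) =
    cap L (map (\<lambda>p. (t # fst p, snd p)) (splits L ts) @ map (\<lambda>p. (fst p, t # snd p)) (splits L ts))"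
    by (simp add: splits_def)
  then obtain p where "p \<in> set (splits L ts)" "lr = (t # fst p, snd p) \<or> lr = (fst p, t # snd p)"
    using Cons.prems by (auto simp: cap_def split: if_splits)
  moreover from this(1) have "set (fst p) \<union> set (snd p) = set ts" by (rule Cons.IH)
  ultimately show ?case by (elim disjE) auto
qed (simp add: splits_def)

lemma set_verts: "set (verts ts) = (\<Union>t\<in>set ts. set (snd t))"
  by (auto simp: verts_def)

text \<open>Any clique \<open>C\<close> and any division of the tokens yield a correct separation,
  balanced or not. The deletion set enters only in \<open>light_children\<close>.\<close>

locale split_region_facts =
  fixes G :: "bool list list" and k :: nat and U :: "nat list" and a :: region and v :: nat and C :: "nat list"
    and lr :: "token list \<times> token list"
  assumes wf: "well_formed G k a" and v: "v \<in> set (fst a)" and C: "clique (adj G) (set C)"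
    and lr: "set (fst lr) \<union> set (snd lr) = set (snd a)" and U: "set U = scope a" and dU: "distinct U"
begin

definition "V = remaining U C v"
definition "P = near_side G V (verts (fst lr)) (verts (snd lr))"
definition "Q = far_side G V (verts (fst lr)) P"
definition "new = new_tokens U C v V P Q"

lemma children_eq: "children G U v (fst a) C lr = make_children (fst a) new (fst lr) (snd lr) P Q"
  by (simp add: children_def Let_def V_def P_def Q_def new_def)

lemma distinct_V: "distinct V" using dU by (simp add: V_def remaining_def)

lemma set_V: "set V = scope a - set C - {v}" using U by (auto simp: V_def remaining_def)

lemma P_subset: "set P \<subseteq> set V - set (verts (snd lr))"
  unfolding P_def by (rule near_side_subset[OF distinct_V])

lemma set_Q: "set Q = {u \<in> set V. u \<notin> set (verts (fst lr)) \<and> (\<forall>p\<in>set P. \<not> near G p u)}"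
  by (auto simp: Q_def far_side_def)

lemma PQ_disjoint: "set P \<inter> set Q = {}" by (auto simp: set_Q near_def)

lemma set_new: "set (verts new) = scope a \<inter> set C \<union> {v} \<union> (set V - set P - set Q)"
  using U by (auto simp: new_def new_tokens_def verts_def)

lemma verts_lr: "set (verts (fst lr)) \<union> set (verts (snd lr)) = set (verts (snd a))"
  using lr by (auto simp: set_verts)

abbreviation "c \<equiv> children G U v (fst a) C lr"

lemma scope_left: "scope (fst c) = set P \<union> set (verts new)"
proof -
  have "scope (fst c) = (set (fst a) \<inter> set P) \<union> set (verts (fst lr)) \<union> set (verts new)"
    by (auto simp: children_eq make_children_def scope_def)
  moreover have "set P \<subseteq> set (fst a) \<union> set (verts (fst lr))"
    using P_subset set_V verts_lr by (auto simp: scope_def)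
  \<comment> \<open>A vertex of a left token is excluded from \<open>Q\<close>. If it is not in
    \<open>P\<close> either, it belongs to the clique, is \<open>v\<close>, or became a
    single-vertex token.\<close>
  moreover have "set (verts (fst lr)) \<subseteq> set P \<union> set (verts new)"
    using set_V verts_lr set_Q by (auto simp: set_new scope_def)
  ultimately show ?thesis by blast
qed

lemma scope_right: "scope (snd c) = set Q \<union> set (verts new)"
proof -
  have "scope (snd c) = (set (fst a) \<inter> set Q) \<union> set (verts (snd lr)) \<union> set (verts new)"
    by (auto simp: children_eq make_children_def scope_def)
  moreover have "set Q \<subseteq> set (fst a) \<union> set (verts (snd lr))"
    using set_Q set_V verts_lr by (auto simp: scope_def)
  moreover have "set (verts (snd lr)) \<subseteq> set Q \<union> set (verts new)"
    using set_V verts_lr P_subset by (auto simp: set_new scope_def)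
  ultimately show ?thesis by blast
qed

lemma scope_children: "scope (fst c) \<union> scope (snd c) = scope a"
  using set_V set_Q P_subset v unfolding scope_left scope_right by (auto simp: set_new scope_def)

lemma new_subset: "set (verts new) \<subseteq> set (verts (snd (fst c))) \<inter> set (verts (snd (snd c)))"
  by (auto simp: children_eq make_children_def)

lemma scope_inter: "scope (fst c) \<inter> scope (snd c) \<subseteq> set (verts (snd (fst c))) \<inter> set (verts (snd (snd c)))"
  using PQ_disjoint new_subset unfolding scope_left scope_right by blast

lemma bag_subset: "set (verts (snd a)) \<subseteq> set (verts (snd (fst c))) \<union> set (verts (snd (snd c)))"
  using verts_lr by (auto simp: children_eq make_children_def)

lemma no_edges: "x \<in> scope (fst c) - scope (snd c) \<Longrightarrow> y \<in> scope (snd c) - scope (fst c) \<Longrightarrow> \<not> near G x y"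
  unfolding scope_left scope_right using set_Q by blast

lemma well_formed_children:
  assumes "light k c" shows "well_formed G k (fst c) \<and> well_formed G k (snd c)"
proof -
  have tok: "\<forall>t\<in>set (snd a). clique (adj G) (set (snd t)) \<and> (\<not> fst t \<longrightarrow> (\<exists>v. snd t = [v]))"
    using wf by (simp add: well_formed_def)
  have new: "\<forall>t\<in>set new. clique (adj G) (set (snd t)) \<and> (\<not> fst t \<longrightarrow> (\<exists>v. snd t = [v]))"
    using C by (auto simp: new_def new_tokens_def clique_def)
  have disj: "set (fst a) \<inter> set (verts (snd a)) = {}" and sc: "scope a \<subseteq> {..<length G}"
    using wf by (simp_all add: well_formed_def)
  have n: "set P \<inter> set (verts new) = {}" "set Q \<inter> set (verts new) = {}"
    using P_subset set_Q set_V by (auto simp: set_new)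
  have "set (fst (fst c)) \<inter> set (verts (snd (fst c))) = {}" "set (fst (snd c)) \<inter> set (verts (snd (snd c))) = {}"
    using disj n verts_lr by (auto simp: children_eq make_children_def)
  moreover have "\<forall>t\<in>set (snd (fst c)) \<union> set (snd (snd c)).
      clique (adj G) (set (snd t)) \<and> (\<not> fst t \<longrightarrow> (\<exists>v. snd t = [v]))"
    using tok new lr by (auto simp: children_eq make_children_def)
  ultimately show ?thesis
    using assms scope_children sc by (auto simp: well_formed_def light_def)
qed

text \<open>Here the unknown separation pays off. \<open>A\<close> and \<open>B\<close> within
  \<open>V\<close> form an admissible pair that misses only vertices of \<open>S\<close>. The
  computed pair is at least as large, so it also misses at most \<open>k\<close> vertices. The new
  tokens weigh at most \<open>(k + 1) + 1 + k\<close>, and the old ones on either side at most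
  \<open>4 * k + 4\<close>.\<close>

lemma light_children:
  assumes S: "card S \<le> k" "finite S" and A: "A \<union> B = scope a - S - Q0" "A \<inter> B = {}" "Q0 \<subseteq> set C"
    "\<forall>x\<in>A. \<forall>y\<in>B. \<not> adj G x y"
    and l: "\<forall>t\<in>set (fst lr). set (snd t) - S \<subseteq> A \<union> Q0" and r: "\<forall>t\<in>set (snd lr). set (snd t) - S \<subseteq> B \<union> Q0"
    and w: "weight k (fst lr) \<le> 4 * k + 4" "weight k (snd lr) \<le> 4 * k + 4"
  shows "light k c"
proof -
  let ?P = "A \<inter> set V" and ?Q = "B \<inter> set V"
  let ?X = "filter (\<lambda>u. u \<notin> set (verts (snd lr))) V" and ?Y = "filter (\<lambda>u. u \<notin> set (verts (fst lr))) V"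
  have AS: "A \<inter> S = {}" "B \<inter> S = {}" using A by auto
  have QV: "Q0 \<inter> set V = {}" using A(3) set_V by auto
  have "set (verts (snd lr)) \<subseteq> S \<union> B \<union> Q0" "set (verts (fst lr)) \<subseteq> S \<union> A \<union> Q0"
    using l r by (auto simp: set_verts)
  then have sub: "?P \<subseteq> set ?X" "?Q \<subseteq> set ?Y" using AS QV A(2) by auto
  have "card ?P + card ?Q \<le> card (set (reached (near G) ?X ?Y)) +
      card {u \<in> set ?Y. \<forall>p\<in>set (reached (near G) ?X ?Y). \<not> near G p u}"
    by (rule reached_optimal) (use sub distinct_V A(2,4) in \<open>auto simp: near_def\<close>)
  also have "reached (near G) ?X ?Y = P" by (simp add: P_def near_side_def)
  also have "{u \<in> set ?Y. \<forall>p\<in>set P. \<not> near G p u} = set Q" by (auto simp: set_Q)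
  finally have PQ: "card ?P + card ?Q \<le> card (set P) + card (set Q)" .
  have "set V \<subseteq> ?P \<union> ?Q \<union> S" using A(1) set_V QV by auto
  then have "card (set V) \<le> card (?P \<union> ?Q \<union> S)" using S by (intro card_mono) auto
  also have "\<dots> \<le> card ?P + card ?Q + card S" by (meson add_le_mono1 card_Un_le le_trans)
  finally have V: "card (set V) \<le> card ?P + card ?Q + k" using S by linarith
  let ?Z = "filter (\<lambda>z. z \<notin> set P \<and> z \<notin> set Q) V"
  have "set V = set ?Z \<union> (set P \<union> set Q)" using P_subset set_Q by auto
  then have "card (set V) = card (set ?Z \<union> (set P \<union> set Q))" by (rule arg_cong)
  moreover have "card (set ?Z \<union> (set P \<union> set Q)) = card (set ?Z) + card (set P \<union> set Q)"
    by (rule card_Un_disjoint) auto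
  moreover have "card (set P \<union> set Q) = card (set P) + card (set Q)"
    using PQ_disjoint by (intro card_Un_disjoint) auto
  ultimately have "card (set ?Z) \<le> k" using V PQ by linarith
  then have Z: "length ?Z \<le> k" using distinct_V distinct_card[of ?Z] by simp
  have "weight k (map (\<lambda>z. (False, [z])) zs) = length zs" for zs :: "nat list"
    by (induction zs) (auto simp: weight_def)
  then have "weight k new = k + 2 + length ?Z"
    by (simp add: new_def new_tokens_def weight_def)
  then show ?thesis using w Z by (simp add: light_def children_eq make_children_def)
qed

end

lemma split_region_decomposition:
  assumes wf: "well_formed G k a" and F: "\<forall>C\<in>set F. clique (adj G) (set C)"
    and s: "split_region G k L F a = Some c"
  obtains v C lr where "split_region_facts G k (region_verts G a) a v C lr"
    "c = children G (region_verts G a) v (fst a) C lr" "light k c"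
proof -
  obtain v D C lr where *: "fst a = v # D" "C \<in> set F" "lr \<in> set (splits L (snd a))"
    "c = children G (region_verts G a) v (fst a) C lr" "light k c"
    using s by (rule split_regionE)
  have "split_region_facts G k (region_verts G a) a v C lr"
    by unfold_locales
      (use wf F * splits_cover[OF *(3)] in \<open>auto simp: region_verts_def scope_def well_formed_def\<close>)
  then show thesis using that * by blast
qed

lemma length_le_weight: "length ts \<le> weight k ts"
  by (induction ts) (auto simp: weight_def)

text \<open>The exact length is part of the claim because it shows that \<open>cap\<close> does not
  act. Positions rather than tokens are distributed, so equal tokens may go to different
  sides.\<close>

lemma splits_complete:
  "2 ^ length ts \<le> L \<Longrightarrow> length (splits L ts) = 2 ^ length ts \<and> (nths ts J, nths ts (- J)) \<in> set (splits L ts)"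
proof (induction ts arbitrary: J)
  case (Cons t ts)
  let ?J = "{j. Suc j \<in> J}"
  have "(2::nat) ^ length ts \<le> L" using Cons.prems by simp
  then have IH: "length (splits L ts) = 2 ^ length ts"
    "(nths ts ?J, nths ts (- ?J)) \<in> set (splits L ts)"
    using Cons.IH by blast+
  have e: "splits L (t # ts) = map (\<lambda>p. (t # fst p, snd p)) (splits L ts) @ map (\<lambda>p. (fst p, t # snd p)) (splits L ts)"
    using Cons.prems IH(1) by (simp add: splits_def cap_def)
  have c: "- ?J = {j. Suc j \<notin> J}" by auto
  show ?case
    unfolding e using IH by (cases "0 \<in> J") (auto simp: nths_Cons c image_iff intro!: bexI[of _ "(nths ts ?J, nths ts {j. Suc j \<notin> J})"])
qed (simp add: splits_def)

lemma sum_list_nths: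
  "sum_list (map f (nths xs J)) = (\<Sum>i | i < length xs \<and> i \<in> J. f (xs ! i) :: nat)"
proof (induction xs arbitrary: J)
  case (Cons x xs)
  have "{i. i < length (x # xs) \<and> i \<in> J} =
    (if 0 \<in> J then {0} else {}) \<union> Suc ` {i. i < length xs \<and> i \<in> {j. Suc j \<in> J}}"
    by (auto simp: image_iff less_Suc_eq_0_disj)
  moreover have "(\<Sum>i\<in>Suc ` {i. i < length xs \<and> i \<in> {j. Suc j \<in> J}}. f ((x # xs) ! i)) = sum_list (map f (nths xs {j. Suc j \<in> J}))"
    by (simp add: sum.reindex Cons)
  ultimately show ?case by (auto simp: nths_Cons sum.union_disjoint)
qed simp

text \<open>The balanced separator is applied to the tokens without \<open>S\<close>, for
  \<open>M = 6 * k + 6\<close>. A clique weighs \<open>k + 1\<close>, less than half of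
  \<open>M\<close>, and two thirds of \<open>M\<close> are \<open>4 * k + 4\<close>. The separating
  clique need not be in \<open>F\<close>; some \<open>C\<close> in \<open>F\<close> contains it,
  which is enough for \<open>light_children\<close>.\<close>

lemma split_region_exists:
  assumes symp: "symp (adj G)" and wf: "well_formed G k a" and ne: "fst a \<noteq> []"
    and S: "S \<subseteq> {..<length G}" "card S \<le> k" "dismantlable (adj G) ({..<length G} - S)"
    and L: "2 ^ (6 * k + 6) \<le> L"
    and F: "\<forall>C\<in>set F. clique (adj G) (set C)"
      "\<And>Q. Q \<subseteq> {..<length G} \<Longrightarrow> clique (adj G) Q \<Longrightarrow> \<exists>C\<in>set F. Q \<subseteq> set C"
  shows "split_region G k L F a \<noteq> None"
proof -
  obtain v D where v: "fst a = v # D" using ne by (cases "fst a") auto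
  let ?ts = "snd a"
  let ?K = "\<lambda>i. set (snd (?ts ! i)) - S"
  let ?wt = "\<lambda>i. if fst (?ts ! i) then k + 1 else 1"
  let ?I = "{..<length ?ts}"
  have sc: "scope a \<subseteq> {..<length G}" and wt: "weight k ?ts \<le> 6 * k + 6"
    and tok: "\<forall>t\<in>set ?ts. clique (adj G) (set (snd t))"
    using wf by (auto simp: well_formed_def)
  have finS: "finite S" using S(1) by (rule finite_subset) simp
  have "\<exists>Q A B J. Q \<subseteq> scope a - S \<and> clique (adj G) Q \<and> A \<union> B = scope a - S - Q \<and> A \<inter> B = {} \<and>
    (\<forall>x\<in>A. \<forall>y\<in>B. \<not> adj G x y) \<and>
    J \<subseteq> ?I \<and> (\<forall>i\<in>J. ?K i \<subseteq> A \<union> Q) \<and> (\<forall>i\<in>?I - J. ?K i \<subseteq> B \<union> Q) \<and>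
    3 * sum ?wt J \<le> 2 * (6 * k + 6) \<and> 3 * sum ?wt (?I - J) \<le> 2 * (6 * k + 6)"
  proof (rule balanced_clique_separator[OF _ _ _ symp])
    show "finite (scope a - S)" by (simp add: scope_def)
    show "dismantlable (adj G) (scope a - S)" by (rule dismantlable_subset[OF S(3)]) (use sc in auto)
    show "\<forall>i\<in>?I. ?K i \<subseteq> scope a - S \<and> clique (adj G) (?K i)"
    proof
      fix i assume "i \<in> ?I"
      then have i: "?ts ! i \<in> set ?ts" by simp
      then show "?K i \<subseteq> scope a - S \<and> clique (adj G) (?K i)"
        using bspec[OF tok i] by (auto simp: scope_def set_verts clique_def)
    qed
    have "sum_list (map (\<lambda>t. if fst t then k + 1 else 1) ?ts) = sum ?wt ?I"
      by (simp add: sum_list_sum_nth atLeast0LessThan)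
    then show "sum ?wt ?I \<le> 6 * k + 6" using wt by (simp add: weight_def)
  qed auto
  then obtain Q A B J where Q: "Q \<subseteq> scope a - S" "clique (adj G) Q" and A: "A \<union> B = scope a - S - Q" "A \<inter> B = {}"
      "\<forall>x\<in>A. \<forall>y\<in>B. \<not> adj G x y"
    and J: "J \<subseteq> ?I" "\<forall>i\<in>J. ?K i \<subseteq> A \<union> Q" "\<forall>i\<in>?I - J. ?K i \<subseteq> B \<union> Q"
    and w: "3 * sum ?wt J \<le> 2 * (6 * k + 6)" "3 * sum ?wt (?I - J) \<le> 2 * (6 * k + 6)"
    by (elim exE conjE) (rule that)
  obtain C where C: "C \<in> set F" "Q \<subseteq> set C" using F(2)[of Q] Q sc by blast
  let ?lr = "(nths ?ts J, nths ?ts (- J))"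
  have "(2::nat) ^ length ?ts \<le> 2 ^ (6 * k + 6)"
    using wt length_le_weight[of ?ts k] by (intro power_increasing) auto
  then have lr: "?lr \<in> set (splits L ?ts)" using splits_complete[of ?ts L J] L le_trans by blast
  have J': "{i. i < length ?ts \<and> i \<in> J} = J" "{i. i < length ?ts \<and> i \<in> - J} = ?I - J" using J(1) by auto
  interpret facts: split_region_facts G k "region_verts G a" a v C ?lr
    by unfold_locales
      (use wf F(1) C(1) v splits_cover[OF lr] in \<open>auto simp: region_verts_def scope_def well_formed_def\<close>)
  have "light k (children G (region_verts G a) v (fst a) C ?lr)"
  proof (rule facts.light_children[OF S(2) finS A(1,2) C(2) A(3)])
    show "\<forall>t\<in>set (fst ?lr). set (snd t) - S \<subseteq> A \<union> Q"
    proof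
      fix t assume "t \<in> set (fst ?lr)"
      then obtain i where "i \<in> J" "t = ?ts ! i" unfolding fst_conv set_nths by blast
      then show "set (snd t) - S \<subseteq> A \<union> Q" using J(2) by blast
    qed
    show "\<forall>t\<in>set (snd ?lr). set (snd t) - S \<subseteq> B \<union> Q"
    proof
      fix t assume "t \<in> set (snd ?lr)"
      then obtain i where "i \<in> ?I - J" "t = ?ts ! i" unfolding snd_conv set_nths by blast
      then show "set (snd t) - S \<subseteq> B \<union> Q" using J(3) by blast
    qed
    have third: "X \<le> 4 * k + 4" if "3 * X \<le> 2 * (6 * k + 6)" for X :: nat using that by presburger
    show "weight k (fst ?lr) \<le> 4 * k + 4"
      unfolding weight_def fst_conv sum_list_nths J' by (rule third[OF w(1)])
    show "weight k (snd ?lr) \<le> 4 * k + 4"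
      unfolding weight_def snd_conv sum_list_nths J' by (rule third[OF w(2)])
  qed
  moreover have "children G (region_verts G a) v (fst a) C ?lr \<in> set (candidates G L F a v)"
    using C(1) lr by (auto simp: candidates_def)
  ultimately have "filter (light k) (candidates G L F a v) \<noteq> []"
    by (auto simp: filter_empty_conv)
  then show ?thesis by (simp add: split_region_def v split: list.splits)
qed

section \<open>Correctness of the dynamic programme\<close>

definition indep :: "bool list list \<Rightarrow> nat set \<Rightarrow> coloured set \<Rightarrow> bool" where
  "indep G U S \<longleftrightarrow> fst ` S \<subseteq> U \<and> (\<forall>x\<in>S. \<forall>y\<in>S. \<not> conflict G x y)"

lemma conflict_sym: "symp (adj G) \<Longrightarrow> conflict G x y \<Longrightarrow> conflict G y x"
  by (auto simp: conflict_def dest: sympD)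

lemma indep_mono: "indep G U S \<Longrightarrow> T \<subseteq> S \<Longrightarrow> fst ` T \<subseteq> X \<Longrightarrow> indep G X T"
  unfolding indep_def by blast

lemma finite_indep: "finite U \<Longrightarrow> finite {S. indep G U S}"
  by (rule finite_subset[of _ "Pow (U \<times> UNIV)"]) (auto simp: indep_def)

lemma indep_finite_set: "finite U \<Longrightarrow> indep G U S \<Longrightarrow> finite S"
  by (rule finite_subset[of _ "U \<times> UNIV"]) (auto simp: indep_def)

section \<open>Counting independent sets on a bag\<close>

lemma card_indep_union:
  assumes "finite A" "finite B"
  shows "card {S. indep G (A \<union> B) S} \<le> card {S. indep G A S} * card {S. indep G B S}"
proof -
  let ?f = "\<lambda>S :: coloured set. (S \<inter> A \<times> UNIV, S \<inter> B \<times> UNIV)"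
  have "card {S. indep G (A \<union> B) S} \<le> card ({S. indep G A S} \<times> {S. indep G B S})"
  proof (rule card_inj_on_le[of ?f])
    show "inj_on ?f {S. indep G (A \<union> B) S}"
    proof (rule inj_onI)
      fix S T assume S: "S \<in> {S. indep G (A \<union> B) S}" "T \<in> {S. indep G (A \<union> B) S}" and e: "?f S = ?f T"
      have "X = (X \<inter> A \<times> UNIV) \<union> (X \<inter> B \<times> UNIV)" if "X \<in> {S. indep G (A \<union> B) S}" for X
        using that by (force simp: indep_def)
      then show "S = T" using S e by (metis prod.inject)
    qed
    show "?f ` {S. indep G (A \<union> B) S} \<subseteq> {S. indep G A S} \<times> {S. indep G B S}"
    proof (rule image_subsetI)
      fix S assume "S \<in> {S. indep G (A \<union> B) S}"
      then have "indep G (A \<union> B) S" by simp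
      then have "indep G A (S \<inter> A \<times> UNIV)" "indep G B (S \<inter> B \<times> UNIV)" by (rule indep_mono; auto)+
      then show "?f S \<in> {S. indep G A S} \<times> {S. indep G B S}" by simp
    qed
  qed (use assms finite_indep in auto)
  then show ?thesis by (simp add: card_cartesian_product)
qed

text \<open>Vertices of equal colour are pairwise nonadjacent, so each of the two colours occurs on
  at most one vertex of the clique.\<close>

lemma card_indep_clique:
  assumes "clique (adj G) C" "finite C" shows "card {S. indep G C S} \<le> (card C + 1) ^ 2"
proof -
  let ?T = "insert {} ((\<lambda>v. {v}) ` C)"
  let ?f = "\<lambda>S :: coloured set. ({v. (v, True) \<in> S}, {v. (v, False) \<in> S})"
  have T: "{v. (v, b) \<in> S} \<in> ?T" if S: "indep G C S" for S b
  proof (cases "{v. (v, b) \<in> S} = {}")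
    case False
    then obtain v where v: "(v, b) \<in> S" by blast
    have "u = v" if "(u, b) \<in> S" for u
    proof (rule ccontr)
      assume "u \<noteq> v"
      moreover have "u \<in> C" "v \<in> C" using S v that by (force simp: indep_def)+
      ultimately have "adj G u v" using assms(1) by (simp add: clique_def)
      then have "conflict G (u, b) (v, b)" by (simp add: conflict_def)
      then show False using S v that by (auto simp: indep_def)
    qed
    then have "{v. (v, b) \<in> S} = {v}" using v by blast
    moreover have "v \<in> C" using S v by (force simp: indep_def)
    ultimately show ?thesis by blast
  qed blast
  have "card {S. indep G C S} \<le> card (?T \<times> ?T)"
  proof (rule card_inj_on_le[of ?f])
    show "inj_on ?f {S. indep G C S}"
    proof (rule inj_onI)
      fix S T assume "?f S = ?f T"
      then have "(v, b) \<in> S \<longleftrightarrow> (v, b) \<in> T" for v b by (cases b) auto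
      then show "S = T" by auto
    qed
    show "?f ` {S. indep G C S} \<subseteq> ?T \<times> ?T"
    proof (rule image_subsetI)
      fix S assume "S \<in> {S. indep G C S}"
      then have "{v. (v, True) \<in> S} \<in> ?T" "{v. (v, False) \<in> S} \<in> ?T" using T by blast+
      then show "?f S \<in> ?T \<times> ?T" by (rule SigmaI)
    qed
  qed (use assms in auto)
  also have "\<dots> = card ?T * card ?T" by (rule card_cartesian_product)
  also have "card ?T \<le> Suc (card ((\<lambda>v. {v}) ` C))" by (rule card_insert_le_m1) auto
  also have "card ((\<lambda>v. {v}) ` C) = card C" by (rule card_image) auto
  finally show ?thesis by (simp add: power2_eq_square mult_le_mono)
qed

lemma card_indep_single: "card {S. indep G {v} S} \<le> 4"
proof -
  have e: "{S. indep G {v} S} \<subseteq> Pow {(v, True), (v, False)}" by (force simp: indep_def)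
  have "card {S. indep G {v} S} \<le> card (Pow {(v, True), (v, False)})" by (rule card_mono[OF _ e]) simp
  also have "\<dots> = 4" by (simp add: card_Pow)
  finally show ?thesis .
qed

lemma card_indep_tokens:
  assumes "\<forall>t\<in>set ts. clique (adj G) (set (snd t)) \<and> (\<not> fst t \<longrightarrow> (\<exists>v. snd t = [v]))"
    and "set (verts ts) \<subseteq> {..<n}"
  shows "card {S. indep G (set (verts ts)) S} \<le>
    4 ^ length (filter (\<lambda>t. \<not> fst t) ts) * ((n + 1) ^ 2) ^ length (filter fst ts)"
  using assms
proof (induction ts)
  case Nil
  have "{S. indep G (set (verts [])) S} = {{}}" by (auto simp: indep_def verts_def)
  then show ?case by simp
next
  case (Cons t ts)
  have t: "clique (adj G) (set (snd t))" "\<not> fst t \<longrightarrow> (\<exists>v. snd t = [v])" using Cons.prems by auto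
  have sub: "set (snd t) \<subseteq> {..<n}" "set (verts ts) \<subseteq> {..<n}" using Cons.prems(2) by (auto simp: verts_def)
  let ?m = "if fst t then (n + 1) ^ 2 else 4"
  have "card {S. indep G (set (snd t)) S} \<le> ?m"
  proof (cases "fst t")
    case True
    have "card {S. indep G (set (snd t)) S} \<le> (card (set (snd t)) + 1) ^ 2"
      using t(1) by (intro card_indep_clique) auto
    also have "\<dots> \<le> (n + 1) ^ 2" using card_mono[OF _ sub(1)] by (intro power_mono) auto
    finally show ?thesis using True by simp
  next
    case False
    then obtain v where "snd t = [v]" using t by blast
    then show ?thesis using card_indep_single False by simp
  qed
  moreover have "card {S. indep G (set (verts ts)) S} \<le>
      4 ^ length (filter (\<lambda>t. \<not> fst t) ts) * ((n + 1) ^ 2) ^ length (filter fst ts)"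
    using Cons sub by auto
  moreover have "set (verts (t # ts)) = set (snd t) \<union> set (verts ts)" by (simp add: verts_def)
  then have "card {S. indep G (set (verts (t # ts))) S} \<le>
      card {S. indep G (set (snd t)) S} * card {S. indep G (set (verts ts)) S}"
    using card_indep_union[of "set (snd t)" "set (verts ts)" G] by simp
  ultimately have "card {S. indep G (set (verts (t # ts))) S} \<le>
      ?m * (4 ^ length (filter (\<lambda>t. \<not> fst t) ts) * ((n + 1) ^ 2) ^ length (filter fst ts))"
    by (meson le_trans mult_le_mono)
  then show ?case by (cases "fst t") (simp_all add: algebra_simps)
qed

text \<open>
  A bag of weight at most \<open>6 k + 6\<close> consists of at most six cliques, with at most \<open>(n + 1)^2\<close> independent
  sets of coloured vertices each, and of at most \<open>6 k + 6\<close> single vertices, with at most four each.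
\<close>

definition table_bound :: "nat \<Rightarrow> nat \<Rightarrow> nat" where
  "table_bound n k = 4 ^ (6 * k + 6) * (n + 1) ^ 12"

lemma card_indep_bag:
  assumes "well_formed G k a"
  shows "card {S. indep G (set (verts (snd a))) S} \<le> table_bound (length G) k"
proof -
  let ?s = "length (filter (\<lambda>t. \<not> fst t) (snd a))" and ?b = "length (filter fst (snd a))"
  have "weight k ts = length (filter (\<lambda>t. \<not> fst t) ts) + (k + 1) * length (filter fst ts)" for ts :: "token list"
    by (induction ts) (auto simp: weight_def)
  then have w: "?s + (k + 1) * ?b \<le> 6 * (k + 1)" using assms by (simp add: well_formed_def)
  then have "(k + 1) * ?b \<le> (k + 1) * 6" by linarith
  then have b: "?b \<le> 6" by (simp only: mult_le_cancel1)
  have s: "?s \<le> 6 * k + 6" using w by simp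
  have "card {S. indep G (set (verts (snd a))) S} \<le> 4 ^ ?s * ((length G + 1) ^ 2) ^ ?b"
    using assms by (intro card_indep_tokens) (auto simp: well_formed_def scope_def)
  also have "\<dots> \<le> 4 ^ (6 * k + 6) * ((length G + 1) ^ 2) ^ 6"
    using s b by (intro mult_le_mono power_increasing) auto
  also have "\<dots> = table_bound (length G) k" by (simp add: table_bound_def flip: power_mult)
  finally show ?thesis .
qed

text \<open>The lists represent pairwise different sets. So their number is the number of
  independent sets, and \<open>cap\<close> never acts.\<close>

lemma indep_sets_correct:
  assumes symp: "symp (adj G)" and irr: "\<And>v. \<not> adj G v v"
    and "distinct xs" "card {S. S \<subseteq> set xs \<and> (\<forall>x\<in>S. \<forall>y\<in>S. \<not> conflict G x y)} \<le> L"
  shows "distinct (map set (indep_sets G L xs)) \<and> (\<forall>I\<in>set (indep_sets G L xs). distinct I) \<and>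
    set ` set (indep_sets G L xs) = {S. S \<subseteq> set xs \<and> (\<forall>x\<in>S. \<forall>y\<in>S. \<not> conflict G x y)}"
  using assms(3,4)
proof (induction xs)
  case Nil
  then show ?case by (auto simp: indep_sets_def)
next
  case (Cons x xs)
  let ?free = "\<lambda>S. \<forall>x\<in>S. \<forall>y\<in>S. \<not> conflict G x y"
  let ?F = "indep_sets G L xs"
  let ?N = "filter (\<lambda>I. \<forall>y\<in>set I. \<not> conflict G x y) ?F"
  let ?F' = "map (\<lambda>I. x # I) ?N @ ?F"
  have fin: "finite {S. S \<subseteq> set (x # xs) \<and> ?free S}" by simp
  have "card {S. S \<subseteq> set xs \<and> ?free S} \<le> card {S. S \<subseteq> set (x # xs) \<and> ?free S}"
    by (rule card_mono[OF fin]) auto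
  then have IH: "distinct (map set ?F)" "\<forall>I\<in>set ?F. distinct I" "set ` set ?F = {S. S \<subseteq> set xs \<and> ?free S}"
    using Cons by auto
  have x: "x \<notin> set I" if "I \<in> set ?F" for I
    using that IH(3) Cons.prems(1) by auto
  have self: "\<not> conflict G x x" using irr by (simp add: conflict_def)
  have im: "set ` set ?F' = {S. S \<subseteq> set (x # xs) \<and> ?free S}"
  proof (intro equalityI subsetI)
    fix S assume "S \<in> set ` set ?F'"
    then consider "S \<in> set ` set ?F" | I where "I \<in> set ?N" "S = insert x (set I)" by auto
    then show "S \<in> {S. S \<subseteq> set (x # xs) \<and> ?free S}"
    proof cases
      case 1
      then show ?thesis using IH(3) by auto
    next
      case 2
      then have "set I \<in> {S. S \<subseteq> set xs \<and> ?free S}" using IH(3) by auto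
      moreover have "\<not> conflict G x y" "\<not> conflict G y x" if "y \<in> set I" for y
        using 2(1) that conflict_sym[OF symp, of y x] by auto
      ultimately show ?thesis using 2(2) self by auto
    qed
  next
    fix S assume S: "S \<in> {S. S \<subseteq> set (x # xs) \<and> ?free S}"
    show "S \<in> set ` set ?F'"
    proof (cases "x \<in> S")
      case True
      have "S - {x} \<in> set ` set ?F" unfolding IH(3) using S by auto
      then obtain I where I: "I \<in> set ?F" "S - {x} = set I" by auto
      then have "I \<in> set ?N" using S True by auto
      then have "x # I \<in> set ?F'" by simp
      moreover have "S = set (x # I)" using I True by auto
      ultimately show ?thesis by (rule rev_image_eqI)
    next
      case False
      then have "S \<in> set ` set ?F" unfolding IH(3) using S by auto
      then show ?thesis by auto
    qed
  qed
  have "inj_on set (set ?F)" using IH(1) by (simp add: distinct_map)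
  have "inj_on (set \<circ> (#) x) (set ?N)"
  proof (rule inj_onI)
    fix I J assume I: "I \<in> set ?N" and J: "J \<in> set ?N" and e: "(set \<circ> (#) x) I = (set \<circ> (#) x) J"
    have "insert x (set I) = insert x (set J)" using e by simp
    moreover have "x \<notin> set I" "x \<notin> set J" using x I J by simp_all
    ultimately have "set I = set J" by (simp add: insert_ident)
    then show "I = J" using \<open>inj_on set (set ?F)\<close> I J by (simp add: inj_onD)
  qed
  then have "distinct (map set (map (\<lambda>I. x # I) ?N))"
    using IH(1) by (auto simp: distinct_map comp_def)
  moreover have "set ` set (map (\<lambda>I. x # I) ?N) \<inter> set ` set ?F = {}" using x by force
  ultimately have d: "distinct (map set ?F')"
    using IH(1) by (simp only: map_append distinct_append set_map simp_thms)
  then have "length ?F' = card (set ` set ?F')" using distinct_card[of "map set ?F'"] by (simp only: length_map set_map)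
  then have "length ?F' \<le> L" unfolding im using Cons.prems(2) by simp
  then have "indep_sets G L (x # xs) = ?F'" by (simp add: indep_sets_def cap_def)
  moreover have "\<forall>I\<in>set ?F'. distinct I" using IH(2) x by auto
  ultimately show ?case using d im by simp
qed

section \<open>Soundness and completeness of tables\<close>

definition table_sound :: "bool list list \<Rightarrow> nat set \<Rightarrow> coloured list list \<Rightarrow> bool" where
  "table_sound G U F \<longleftrightarrow> (\<forall>I\<in>set F. distinct I \<and> indep G U (set I))"

definition same_on :: "nat set \<Rightarrow> coloured set \<Rightarrow> coloured set \<Rightarrow> bool" where
  "same_on W S T \<longleftrightarrow> (\<forall>x. fst x \<in> W \<longrightarrow> (x \<in> S \<longleftrightarrow> x \<in> T))"

text \<open>Every independent set needs a substitute, not only a largest one, because the rest of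
  the graph may force any trace on the bag \<open>W\<close>.\<close>

definition table_complete :: "bool list list \<Rightarrow> nat set \<Rightarrow> nat set \<Rightarrow> coloured list list \<Rightarrow> bool" where
  "table_complete G U W F \<longleftrightarrow>
     (\<forall>S. indep G U S \<longrightarrow> (\<exists>I\<in>set F. same_on W (set I) S \<and> card S \<le> length I))"

lemma same_on_sym: "same_on W S T \<Longrightarrow> same_on W T S"
  by (simp add: same_on_def)

lemma same_on_trans: "same_on W S T \<Longrightarrow> same_on W T X \<Longrightarrow> same_on W S X"
  by (simp add: same_on_def)

lemma agree_same_on: "agree W W I J \<longleftrightarrow> same_on (set W) (set I) (set J)"
  by (auto simp: agree_def same_on_def)

lemma leaf_correct:
  assumes symp: "symp (adj G)" and irr: "\<And>v. \<not> adj G v v" and wf: "well_formed G k a"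
    and L: "table_bound (length G) k \<le> L" and D: "fst a = []"
  shows "table_sound G (scope a) (leaf G L a) \<and> table_complete G (scope a) (set (verts (snd a))) (leaf G L a)"
proof -
  let ?W = "set (verts (snd a))"
  let ?xs = "colourings G (snd a)"
  have W: "?W \<subseteq> {..<length G}" "scope a = ?W" using wf D by (auto simp: well_formed_def scope_def)
  have xs: "set ?xs = ?W \<times> UNIV" using W(1) by (auto simp: colourings_def)
  have dist: "distinct (concat (map (\<lambda>v. [(v, False), (v, True)]) vs))" if "distinct vs" for vs :: "nat list"
    using that by (induction vs) auto
  then have d: "distinct ?xs" by (simp add: colourings_def)
  have e: "{S. S \<subseteq> set ?xs \<and> (\<forall>x\<in>S. \<forall>y\<in>S. \<not> conflict G x y)} = {S. indep G ?W S}"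
    unfolding xs indep_def by force
  have "distinct (map set (indep_sets G L ?xs)) \<and> (\<forall>I\<in>set (indep_sets G L ?xs). distinct I) \<and>
    set ` set (indep_sets G L ?xs) = {S. S \<subseteq> set ?xs \<and> (\<forall>x\<in>S. \<forall>y\<in>S. \<not> conflict G x y)}"
  proof (rule indep_sets_correct[OF symp irr d])
    show "card {S. S \<subseteq> set ?xs \<and> (\<forall>x\<in>S. \<forall>y\<in>S. \<not> conflict G x y)} \<le> L"
      unfolding e using card_indep_bag[OF wf] L by linarith
  qed
  then have F: "\<forall>I\<in>set (leaf G L a). distinct I" "set ` set (leaf G L a) = {S. indep G ?W S}"
    unfolding leaf_def D list.case e by blast+
  have "table_sound G (scope a) (leaf G L a)"
    unfolding table_sound_def W(2) using F by auto
  moreover have "\<exists>I\<in>set (leaf G L a). same_on ?W (set I) S \<and> card S \<le> length I" if "indep G (scope a) S" for S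
  proof -
    have "S \<in> set ` set (leaf G L a)" unfolding F(2) using that W(2) by simp
    then obtain I where "I \<in> set (leaf G L a)" "S = set I" by blast
    then show ?thesis using card_length by (auto simp: same_on_def)
  qed
  ultimately show ?thesis by (simp add: table_complete_def)
qed

text \<open>Take \<open>x\<close> in \<open>I\<close> and \<open>y\<close> in \<open>J\<close>. If
  one of them lies over a common vertex, \<open>agree\<close> puts it into the other set as well,
  which is independent. Otherwise their vertices are separated, hence neither equal nor
  adjacent.\<close>

lemma joins_sound:
  assumes symp: "symp (adj G)" and F: "table_sound G U1 F1" "table_sound G U2 F2"
    and inter: "U1 \<inter> U2 \<subseteq> set W1 \<inter> set W2"
    and edges: "\<And>x y. x \<in> U1 - U2 \<Longrightarrow> y \<in> U2 - U1 \<Longrightarrow> \<not> near G x y"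
  shows "table_sound G (U1 \<union> U2) (joins W1 W2 F1 F2)"
  unfolding table_sound_def
proof
  fix K assume "K \<in> set (joins W1 W2 F1 F2)"
  then obtain I J where IJ: "I \<in> set F1" "J \<in> set F2" "agree W1 W2 I J" "K = I @ filter (\<lambda>y. y \<notin> set I) J"
    by (auto simp: joins_def)
  have I: "distinct I" "indep G U1 (set I)" and J: "distinct J" "indep G U2 (set J)"
    using F IJ by (auto simp: table_sound_def)
  have setK: "set K = set I \<union> set J" using IJ(4) by auto
  have IJc: "\<not> conflict G x y" if x: "x \<in> set I" and y: "y \<in> set J" for x y
  proof
    assume c: "conflict G x y"
    have U: "fst x \<in> U1" "fst y \<in> U2" using x y I J by (auto simp: indep_def)
    show False
    proof (cases "fst y \<in> U1 \<or> fst x \<in> U2")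
      case True
      then have "y \<in> set I \<or> x \<in> set J" using U x y inter IJ(3) by (auto simp: agree_def)
      then show False using c x y I(2) J(2) by (auto simp: indep_def)
    next
      case False
      then have "\<not> near G (fst x) (fst y)" using edges U by blast
      then show False using c by (auto simp: near_def conflict_def)
    qed
  qed
  have "\<not> conflict G x y" if "x \<in> set I \<union> set J" "y \<in> set I \<union> set J" for x y
    using that I(2) J(2) IJc[of x y] IJc[of y x] conflict_sym[OF symp, of x y] unfolding indep_def by blast
  then have "indep G (U1 \<union> U2) (set K)"
    using I(2) J(2) unfolding setK indep_def by auto
  moreover have "distinct K" using I(1) J(1) IJ(4) by auto
  ultimately show "distinct K \<and> indep G (U1 \<union> U2) (set K)" by blast
qed

text \<open>The substitutes of the two restrictions of \<open>S\<close> coincide with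
  \<open>S\<close> on the common vertices, as these lie in both bags. Hence both pairs have the same
  intersection, and inclusion-exclusion carries the size comparison over to the unions.\<close>

lemma joins_complete:
  assumes F: "table_sound G U1 F1" "table_sound G U2 F2"
    and C: "table_complete G U1 (set W1) F1" "table_complete G U2 (set W2) F2"
    and inter: "U1 \<inter> U2 \<subseteq> set W1 \<inter> set W2" and sub: "set W1 \<subseteq> U1" "set W2 \<subseteq> U2"
    and fin: "finite U1" "finite U2"
  shows "table_complete G (U1 \<union> U2) (set W1 \<union> set W2) (joins W1 W2 F1 F2)"
  unfolding table_complete_def
proof (intro allI impI)
  fix S assume S: "indep G (U1 \<union> U2) S"
  let ?S1 = "S \<inter> U1 \<times> UNIV" and ?S2 = "S \<inter> U2 \<times> UNIV"
  have "indep G U1 ?S1" "indep G U2 ?S2" by (rule indep_mono[OF S]; auto)+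
  then obtain I J where I: "I \<in> set F1" "same_on (set W1) (set I) ?S1" "card ?S1 \<le> length I"
    and J: "J \<in> set F2" "same_on (set W2) (set J) ?S2" "card ?S2 \<le> length J"
    using C unfolding table_complete_def by meson
  have d: "distinct I" "distinct J" and IU: "fst ` set I \<subseteq> U1" and JU: "fst ` set J \<subseteq> U2"
    using F I(1) J(1) by (auto simp: table_sound_def indep_def)
  have I': "x \<in> set I \<longleftrightarrow> x \<in> S" if "fst x \<in> set W1" for x
    using I(2) that sub by (cases x) (auto simp: same_on_def)
  have J': "x \<in> set J \<longleftrightarrow> x \<in> S" if "fst x \<in> set W2" for x
    using J(2) that sub by (cases x) (auto simp: same_on_def)
  have ag: "agree W1 W2 I J"
    unfolding agree_def
  proof (intro conjI ballI impI)
    fix x assume "x \<in> set I" "fst x \<in> set W2"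
    moreover from this have "fst x \<in> set W1" using IU sub inter by blast
    ultimately show "x \<in> set J" using I' J' by blast
  next
    fix x assume "x \<in> set J" "fst x \<in> set W1"
    moreover from this have "fst x \<in> set W2" using JU sub inter by blast
    ultimately show "x \<in> set I" using I' J' by blast
  qed
  let ?K = "I @ filter (\<lambda>y. y \<notin> set I) J"
  have K: "?K \<in> set (joins W1 W2 F1 F2)" using I(1) J(1) ag by (auto simp: joins_def)
  have "same_on (set W1 \<union> set W2) (set ?K) S"
    unfolding same_on_def
  proof (intro allI impI)
    fix x :: coloured assume "fst x \<in> set W1 \<union> set W2"
    then consider "fst x \<in> set W1" "fst x \<in> set W2" | "fst x \<in> set W1" "fst x \<notin> set W2" | "fst x \<in> set W2" "fst x \<notin> set W1"
      by blast
    then show "x \<in> set ?K \<longleftrightarrow> x \<in> S"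
    proof cases
      case 1
      then show ?thesis using I' J' by auto
    next
      case 2
      then have "x \<notin> set J" using sub inter JU by blast
      then show ?thesis using 2 I' by auto
    next
      case 3
      then have "x \<notin> set I" using sub inter IU by blast
      then show ?thesis using 3 J' by auto
    qed
  qed
  moreover have "card S \<le> length ?K"
  proof -
    have finS: "finite S" using indep_finite_set[OF _ S] fin by blast
    have "distinct ?K" using d by auto
    moreover have "set ?K = set I \<union> set J" by auto
    ultimately have "length ?K = card (set I \<union> set J)" using distinct_card[of ?K] by metis
    then have 1: "length ?K + card (set I \<inter> set J) = length I + length J"
      using card_Un_Int[of "set I" "set J"] distinct_card[OF d(1)] distinct_card[OF d(2)] by simp
    have "S = ?S1 \<union> ?S2" using S by (force simp: indep_def)
    then have 2: "card S + card (?S1 \<inter> ?S2) = card ?S1 + card ?S2"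
      using card_Un_Int[of ?S1 ?S2] finS by simp
    have "set I \<inter> set J \<subseteq> ?S1 \<inter> ?S2"
    proof
      fix x assume x: "x \<in> set I \<inter> set J"
      then have "fst x \<in> U1 \<inter> U2" using IU JU by auto
      then show "x \<in> ?S1 \<inter> ?S2" using x I' inter by (cases x) auto
    qed
    then have "card (set I \<inter> set J) \<le> card (?S1 \<inter> ?S2)" using finS by (intro card_mono) auto
    moreover have "?S1 \<inter> ?S2 \<subseteq> set I \<inter> set J"
    proof
      fix x assume x: "x \<in> ?S1 \<inter> ?S2"
      then have "fst x \<in> set W1 \<inter> set W2" using inter by auto
      then show "x \<in> set I \<inter> set J" using x I' J' by auto
    qed
    then have "card (?S1 \<inter> ?S2) \<le> card (set I \<inter> set J)" by (intro card_mono) auto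
    ultimately show ?thesis using 1 2 I(3) J(3) by linarith
  qed
  ultimately show "\<exists>K\<in>set (joins W1 W2 F1 F2). same_on (set W1 \<union> set W2) (set K) S \<and> card S \<le> length K"
    using K by blast
qed

text \<open>Entries with equal traces on \<open>W\<close> are comparable under
  \<open>dominated\<close>, so after thinning the traces differ. They are independent sets on
  \<open>W\<close>, so \<open>cap\<close> keeps them all.\<close>

lemma thin_table:
  assumes F: "table_sound G U F" and L: "card {S. indep G (set W) S} \<le> L"
  shows "table_sound G U (cap L (thin (dominated W) F)) \<and>
    (table_complete G U (set W) F \<longrightarrow> table_complete G U (set W) (cap L (thin (dominated W) F)))"
proof -
  let ?T = "thin (dominated W) F"
  let ?h = "\<lambda>I :: coloured list. set I \<inter> set W \<times> UNIV"
  have d: "distinct (map ?h ?T)"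
  proof (rule distinct_map_thin)
    fix I J :: "coloured list" assume e: "?h I = ?h J"
    have same: "same_on (set W) (set I) (set J)"
      unfolding same_on_def
    proof (intro allI impI)
      fix x :: coloured assume "fst x \<in> set W"
      then have "x \<in> set W \<times> UNIV" by (cases x) auto
      then show "x \<in> set I \<longleftrightarrow> x \<in> set J" using e by blast
    qed
    then have "same_on (set W) (set J) (set I)" by (simp add: same_on_def)
    then show "dominated W I J \<or> dominated W J I"
      using same by (auto simp: dominated_def agree_same_on)
  qed
  have "length ?T = card (?h ` set ?T)" using distinct_card[OF d] by simp
  also have "\<dots> \<le> card {S. indep G (set W) S}"
  proof (rule card_mono[OF finite_indep], simp, rule image_subsetI)
    fix I assume "I \<in> set ?T"
    then have "indep G U (set I)" using F set_thin_subset[of "dominated W" F] by (auto simp: table_sound_def)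
    then have "indep G (set W) (?h I)" by (rule indep_mono) auto
    then show "?h I \<in> {S. indep G (set W) S}" by simp
  qed
  finally have c: "cap L ?T = ?T" using L by (simp add: cap_def)
  have "table_sound G U ?T" using F set_thin_subset[of "dominated W" F] by (auto simp: table_sound_def)
  moreover have "table_complete G U (set W) ?T" if C: "table_complete G U (set W) F"
    unfolding table_complete_def
  proof (intro allI impI)
    fix S assume "indep G U S"
    then obtain I where I: "I \<in> set F" "same_on (set W) (set I) S" "card S \<le> length I"
      using C unfolding table_complete_def by blast
    have "\<exists>J\<in>set ?T. dominated W I J"
    proof (rule thin_dominates[OF _ _ I(1)])
      show "reflp (dominated W)" by (rule reflpI) (simp add: dominated_def agree_same_on same_on_def)
      show "transp (dominated W)"
        by (rule transpI) (unfold dominated_def agree_same_on, blast intro: same_on_trans le_trans)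
    qed
    then obtain J where J: "J \<in> set ?T" "length I \<le> length J" "same_on (set W) (set I) (set J)"
      by (auto simp: dominated_def agree_same_on)
    have "same_on (set W) (set J) S" using same_on_trans J(3) I(2) by (metis same_on_sym)
    then show "\<exists>J\<in>set ?T. same_on (set W) (set J) S \<and> card S \<le> length J"
      using J(1) le_trans[OF I(3) J(2)] by blast
  qed
  ultimately show ?thesis by (simp add: c)
qed

lemma table_complete_mono: "table_complete G U W F \<Longrightarrow> W' \<subseteq> W \<Longrightarrow> table_complete G U W' F"
  unfolding table_complete_def same_on_def by (meson subsetD)

text \<open>The premise of completeness has two sources. A nonempty table has nonempty tables at
  both children, so no failure occurred below it and its entries can be trusted for any graph.
  Otherwise splits are guaranteed to exist, and no failure occurs at all.\<close>

lemma solve_correct: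
  assumes symp: "symp (adj G)" and irr: "\<And>v. \<not> adj G v v"
    and L: "table_bound (length G) k \<le> L" and F: "\<forall>C\<in>set F. clique (adj G) (set C)"
  shows "well_formed G k a \<Longrightarrow> table_sound G (scope a) (solve G k L F a) \<and>
    (solve G k L F a \<noteq> [] \<or> (\<forall>b. well_formed G k b \<and> fst b \<noteq> [] \<longrightarrow> split_region G k L F b \<noteq> None) \<longrightarrow>
      table_complete G (scope a) (set (verts (snd a))) (solve G k L F a))"
proof (induction "length (fst a)" arbitrary: a rule: less_induct)
  case less
  show ?case
  proof (cases "split_region G k L F a")
    case None
    then have e: "solve G k L F a = leaf G L a" by (simp add: solve.simps)
    show ?thesis
    proof (cases "fst a = []")
      case True
      then show ?thesis using leaf_correct[OF symp irr less.prems L] e by simp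
    next
      case False
      then have "leaf G L a = []" by (auto simp: leaf_def split: list.splits)
      then have "solve G k L F a = []" using e by simp
      moreover have "\<not> (\<forall>b. well_formed G k b \<and> fst b \<noteq> [] \<longrightarrow> split_region G k L F b \<noteq> None)"
        using None False less.prems by blast
      ultimately show ?thesis by (simp add: table_sound_def) blast
    qed
  next
    case (Some c)
    obtain v C lr where facts: "split_region_facts G k (region_verts G a) a v C lr"
      and c: "c = children G (region_verts G a) v (fst a) C lr" "light k c"
      using split_region_decomposition[OF less.prems F Some] by blast
    interpret facts: split_region_facts G k "region_verts G a" a v C lr by (rule facts)
    let ?F1 = "solve G k L F (fst c)" and ?F2 = "solve G k L F (snd c)"
    let ?U1 = "scope (fst c)" and ?U2 = "scope (snd c)"
    let ?W = "verts (snd a)" and ?W1 = "verts (snd (fst c))" and ?W2 = "verts (snd (snd c))"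
    let ?J = "joins ?W1 ?W2 ?F1 ?F2"
    have e: "solve G k L F a = cap L (thin (dominated ?W) ?J)"
      by (subst solve.simps) (simp add: Some combine_def)
    have wf: "well_formed G k (fst c)" "well_formed G k (snd c)"
      using facts.well_formed_children c by simp_all
    have len: "length (fst (fst c)) < length (fst a)" "length (fst (snd c)) < length (fst a)"
      using split_region_decreasing[OF Some] by simp_all
    note IH1 = less.hyps[OF len(1) wf(1)] and IH2 = less.hyps[OF len(2) wf(2)]
    have U: "?U1 \<union> ?U2 = scope a" using facts.scope_children c(1) by simp
    have inter: "?U1 \<inter> ?U2 \<subseteq> set ?W1 \<inter> set ?W2" using facts.scope_inter c(1) by simp
    have W: "set ?W \<subseteq> set ?W1 \<union> set ?W2" using facts.bag_subset c(1) by simp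
    have sound: "table_sound G (scope a) ?J"
      unfolding U[symmetric]
      by (rule joins_sound[OF symp conjunct1[OF IH1] conjunct1[OF IH2] inter]) (use facts.no_edges c(1) in simp)
    have bound: "card {S. indep G (set ?W) S} \<le> L" using card_indep_bag[OF less.prems] L by linarith
    have complete: "table_complete G (scope a) (set ?W) ?J"
      if "table_complete G ?U1 (set ?W1) ?F1" "table_complete G ?U2 (set ?W2) ?F2"
      unfolding U[symmetric]
      by (rule table_complete_mono[OF _ W], rule joins_complete)
        (use that IH1 IH2 inter in \<open>auto simp: scope_def\<close>)
    have ne: "?F1 \<noteq> [] \<and> ?F2 \<noteq> []" if "solve G k L F a \<noteq> []"
    proof -
      have "?J \<noteq> []" using that unfolding e by (auto simp: cap_def)
      then show ?thesis by (auto simp: joins_def)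
    qed
    show ?thesis
      using thin_table[OF sound bound] complete ne IH1 IH2 unfolding e[symmetric] by blast
  qed
qed

lemma root_well_formed: "well_formed G k ([0..<length G], [])"
  by (auto simp: well_formed_def scope_def verts_def weight_def)

lemma cliques_clique: "symp (adj G) \<Longrightarrow> \<forall>C\<in>set (cliques G L). clique (adj G) (set C)"
  unfolding cliques_def using foldr_cliques_clique by blast

definition root_table :: "bool list list \<Rightarrow> nat \<Rightarrow> nat \<Rightarrow> coloured list list" where
  "root_table G k L = solve G k L (cliques G L) ([0..<length G], [])"

text \<open>The bag of the root is empty, so all traces agree and completeness says that some entry
  is at least as large as any independent set.\<close>

lemma root_table_correct:
  assumes symp: "symp (adj G)" and irr: "\<And>v. \<not> adj G v v" and L: "table_bound (length G) k \<le> L"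
  shows "table_sound G {..<length G} (root_table G k L)"
    and "root_table G k L \<noteq> [] \<or> (\<exists>S \<subseteq> {..<length G}. card S \<le> k \<and> dismantlable (adj G) ({..<length G} - S)) \<Longrightarrow>
      table_complete G {..<length G} {} (root_table G k L)"
proof -
  let ?a = "([0..<length G], []) :: region"
  have sc: "scope ?a = {..<length G}" "set (verts (snd ?a)) = {}" by (auto simp: scope_def verts_def)
  note main = solve_correct[OF symp irr L cliques_clique[OF symp, of L] root_well_formed, unfolded sc root_table_def[symmetric]]
  show "table_sound G {..<length G} (root_table G k L)" using main by blast
  assume "root_table G k L \<noteq> [] \<or> (\<exists>S \<subseteq> {..<length G}. card S \<le> k \<and> dismantlable (adj G) ({..<length G} - S))"
  then show "table_complete G {..<length G} {} (root_table G k L)"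
  proof
    assume "\<exists>S \<subseteq> {..<length G}. card S \<le> k \<and> dismantlable (adj G) ({..<length G} - S)"
    then obtain S where S: "S \<subseteq> {..<length G}" "card S \<le> k" "dismantlable (adj G) ({..<length G} - S)" by blast
    \<comment> \<open>The bound on the table size also covers the two other uses of
      \<open>L\<close>, the number of maximal cliques and the number of splits of a bag.\<close>
    have "(2::nat) ^ k * (length G + 1) \<le> 4 ^ (6 * k + 6) * (length G + 1) ^ 12"
    proof (rule mult_le_mono)
      have "(2::nat) ^ k \<le> 4 ^ k" by (rule power_mono) auto
      also have "\<dots> \<le> 4 ^ (6 * k + 6)" by (rule power_increasing) auto
      finally show "(2::nat) ^ k \<le> 4 ^ (6 * k + 6)" .
      show "length G + 1 \<le> (length G + 1) ^ 12" by (rule self_le_power) auto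
    qed
    then have L1: "2 ^ k * (card {..<length G} + 1) \<le> L" using L by (simp add: table_bound_def)
    have "(2::nat) ^ (6 * k + 6) \<le> 4 ^ (6 * k + 6)" by (rule power_mono) auto
    also have "\<dots> \<le> 4 ^ (6 * k + 6) * (length G + 1) ^ 12" by simp
    finally have L2: "2 ^ (6 * k + 6) \<le> L" using L by (simp add: table_bound_def)
    have "\<exists>C\<in>set (cliques G L). Q \<subseteq> set C" if "Q \<subseteq> {..<length G}" "clique (adj G) Q" for Q
      unfolding cliques_def
      by (rule foldr_cliques_complete[OF symp S(1) _ S(2,3) L1]) (use that in \<open>auto simp: atLeast0LessThan\<close>)
    then have "\<forall>b. well_formed G k b \<and> fst b \<noteq> [] \<longrightarrow> split_region G k L (cliques G L) b \<noteq> None"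
      using split_region_exists[OF symp _ _ S L2 cliques_clique[OF symp]] by blast
    then show ?thesis using main by blast
  qed (use main in blast)
qed

section \<open>From the root table to an odd cycle transversal\<close>

definition longest :: "'a list list \<Rightarrow> 'a list list" where
  "longest T = filter (\<lambda>I. \<forall>J\<in>set T. length J \<le> length I) T"

definition uncoloured :: "nat \<Rightarrow> coloured list \<Rightarrow> nat list" where
  "uncoloured n I = filter (\<lambda>v. \<not> (v, True) \<in> set I \<and> \<not> (v, False) \<in> set I) [0..<n]"

definition transversal :: "bool list list \<Rightarrow> nat \<Rightarrow> nat \<Rightarrow> nat list option" where
  "transversal G k L = (case longest (root_table G k L) of [] \<Rightarrow> None | I # _ \<Rightarrow> Some (uncoloured (length G) I))"

lemma longest_nonempty: "T \<noteq> [] \<Longrightarrow> longest T \<noteq> []"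
proof -
  assume "T \<noteq> []"
  then have "Max (length ` set T) \<in> length ` set T" by (intro Max_in) auto
  then obtain I where I: "I \<in> set T" "length I = Max (length ` set T)" by auto
  then have "\<forall>J\<in>set T. length J \<le> length I" by simp
  then show "longest T \<noteq> []" using I(1) by (auto simp: longest_def filter_empty_conv)
qed

definition matrix :: "nat \<Rightarrow> nat set set \<Rightarrow> bool list list" where
  "matrix n E = map (\<lambda>u. map (\<lambda>v. {u, v} \<in> E) [0..<n]) [0..<n]"

lemma length_matrix [simp]: "length (matrix n E) = n"
  by (simp add: matrix_def)

lemma nth_default_beyond: "length xs \<le> i \<Longrightarrow> nth_default d xs i = d"
  by (simp add: nth_default_def)

lemma adj_matrix:
  assumes "simple_graph {..<n} E" shows "adj (matrix n E) u v \<longleftrightarrow> {u, v} \<in> E"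
proof (cases "u < n \<and> v < n")
  case True
  then show ?thesis by (simp add: adj_def nth_default_eq matrix_def)
next
  case False
  then have "\<not> {u, v} \<in> E" using assms by (auto simp: simple_graph_def)
  then show ?thesis using False
    by (cases "u < n") (auto simp: adj_def nth_default_eq nth_default_beyond matrix_def)
qed

lemma matrix_graph:
  assumes "simple_graph {..<n} E"
  shows "symp (adj (matrix n E))" "\<not> adj (matrix n E) v v"
  using assms unfolding symp_def adj_matrix[OF assms] by (auto simp: insert_commute simple_graph_def)

lemma chordal_dismantlable:
  assumes g: "simple_graph {..<n} E" and S: "chordal_vertex_deletion_set {..<n} E S"
  shows "dismantlable (adj (matrix n E)) ({..<n} - S)"
proof (rule hole_free_dismantlable[OF _ _ matrix_graph(1)[OF g]])
  show "hole_free (adj (matrix n E)) ({..<n} - S)"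
    unfolding hole_free_def adj_matrix[OF g]
  proof (intro allI impI)
    fix c assume c: "4 \<le> length c \<and> distinct c \<and> set c \<subseteq> {..<n} - S \<and>
      (\<forall>i<length c. {c ! i, c ! (Suc i mod length c)} \<in> E)"
    have "{c ! i, c ! (Suc i mod length c)} \<in> del_edges E S" if i: "i < length c" for i
    proof -
      have "c ! i \<in> set c" "c ! (Suc i mod length c) \<in> set c" using i by (auto intro!: nth_mem mod_less_divisor)
      then have "c ! i \<notin> S" "c ! (Suc i mod length c) \<notin> S" using c by blast+
      then show ?thesis using c i by (auto simp: del_edges_def)
    qed
    then have "is_cycle ({..<n} - S) (del_edges E S) c" using c by (auto simp: is_cycle_def)
    then have "has_chord (del_edges E S) c"
      using S c by (auto simp: chordal_vertex_deletion_set_def chordal_def)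
    then show "\<exists>i<length c. \<exists>j<length c. i \<noteq> j \<and> j \<noteq> Suc i mod length c \<and> i \<noteq> Suc j mod length c \<and> {c ! i, c ! j} \<in> E"
      unfolding has_chord_def del_edges_def by blast
  qed
qed simp

text \<open>The two colours form the bipartition of the remaining graph. No vertex has both colours,
  so \<open>length I\<close> counts the coloured vertices, and a larger \<open>I\<close> means a
  smaller transversal.\<close>

lemma uncoloured_transversal:
  assumes g: "simple_graph {..<n} E" and I: "distinct I" "indep (matrix n E) {..<n} (set I)"
  shows "odd_cycle_transversal {..<n} E (set (uncoloured n I)) \<and> length I + card (set (uncoloured n I)) = n"
proof -
  let ?X = "set (uncoloured n I)"
  let ?A = "{v. (v, True) \<in> set I}" and ?B = "{v. (v, False) \<in> set I}"
  have sub: "?A \<subseteq> {..<n}" "?B \<subseteq> {..<n}" using I(2) by (force simp: indep_def)+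
  have X: "?X = {..<n} - (?A \<union> ?B)" by (auto simp: uncoloured_def)
  have AB: "?A \<inter> ?B = {}"
  proof (rule ccontr)
    assume "?A \<inter> ?B \<noteq> {}"
    then obtain v where "(v, True) \<in> set I" "(v, False) \<in> set I" by blast
    moreover have "conflict (matrix n E) (v, True) (v, False)" by (simp add: conflict_def)
    ultimately show False using I(2) unfolding indep_def by blast
  qed
  have mono: "\<not> e \<subseteq> {v. (v, b) \<in> set I}" if e: "e \<in> E" for e b
  proof
    assume sub: "e \<subseteq> {v. (v, b) \<in> set I}"
    have "card e = 2" using g e by (auto simp: simple_graph_def)
    then obtain u w where uw: "e = {u, w}" by (auto simp: card_2_iff)
    then have "(u, b) \<in> set I" "(w, b) \<in> set I" using sub by auto
    moreover have "conflict (matrix n E) (u, b) (w, b)" using e uw adj_matrix[OF g] by (simp add: conflict_def)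
    ultimately show False using I(2) unfolding indep_def by blast
  qed
  have "bipartite ({..<n} - ?X) (del_edges E ?X)"
    unfolding bipartite_def
    by (rule exI[of _ ?A], rule exI[of _ ?B]) (use X AB sub mono in \<open>auto simp: del_edges_def\<close>)
  then have oct: "odd_cycle_transversal {..<n} E ?X" using X by (auto simp: odd_cycle_transversal_def)
  have IAB: "set I = (\<lambda>v. (v, True)) ` ?A \<union> (\<lambda>v. (v, False)) ` ?B"
  proof (rule set_eqI)
    fix x :: coloured
    show "x \<in> set I \<longleftrightarrow> x \<in> (\<lambda>v. (v, True)) ` ?A \<union> (\<lambda>v. (v, False)) ` ?B"
      by (cases x; cases "snd x") auto
  qed
  have fin: "finite ?A" "finite ?B" using sub by (auto intro: finite_subset)
  have "card (set I) = card ((\<lambda>v. (v, True)) ` ?A \<union> (\<lambda>v. (v, False)) ` ?B)" using IAB by (rule arg_cong)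
  also have "\<dots> = card ((\<lambda>v. (v, True)) ` ?A) + card ((\<lambda>v. (v, False)) ` ?B)"
    using fin by (intro card_Un_disjoint) auto
  also have "\<dots> = card ?A + card ?B" by (simp add: card_image inj_on_def)
  also have "\<dots> = card (?A \<union> ?B)" using card_Un_disjoint[OF fin AB] by simp
  finally have "length I = card (?A \<union> ?B)" using distinct_card[OF I(1)] by simp
  moreover have "card (?A \<union> ?B) \<le> card {..<n}" using sub by (intro card_mono) auto
  then have "card ?X + card (?A \<union> ?B) = card {..<n}"
    unfolding X using sub fin by (subst card_Diff_subset) auto
  ultimately show ?thesis using oct by simp
qed

lemma transversal_indep:
  assumes g: "simple_graph {..<n} E" and Y: "odd_cycle_transversal {..<n} E Y"
  shows "\<exists>S. indep (matrix n E) {..<n} S \<and> card S + card Y = n"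
proof -
  obtain A B where AB: "A \<union> B = {..<n} - Y" "A \<inter> B = {}"
    and e: "\<And>e. e \<in> del_edges E Y \<Longrightarrow> \<not> e \<subseteq> A \<and> \<not> e \<subseteq> B" and YV: "Y \<subseteq> {..<n}"
    using Y by (auto simp: odd_cycle_transversal_def bipartite_def)
  let ?S = "(\<lambda>v. (v, True)) ` A \<union> (\<lambda>v. (v, False)) ` B"
  have "\<not> adj (matrix n E) u v" if "u \<in> A \<and> v \<in> A \<or> u \<in> B \<and> v \<in> B" for u v
  proof
    assume "adj (matrix n E) u v"
    then have "{u, v} \<in> del_edges E Y" using that AB(1) by (auto simp: adj_matrix[OF g] del_edges_def)
    then show False using e that by blast
  qed
  then have "indep (matrix n E) {..<n} ?S"
    using AB unfolding indep_def conflict_def by auto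
  moreover have fin: "finite A" "finite B" using AB(1) by (metis finite_Diff finite_Un finite_lessThan)+
  have "card ?S = card ((\<lambda>v. (v, True)) ` A) + card ((\<lambda>v. (v, False)) ` B)"
    using fin by (intro card_Un_disjoint) auto
  then have "card ?S = card A + card B" by (simp add: card_image inj_on_def)
  then have "card ?S + card Y = n"
    using card_Un_disjoint[OF fin AB(2)] YV card_mono[OF _ YV] unfolding AB(1) by (simp add: card_Diff_subset finite_subset[OF YV])
  ultimately show ?thesis by blast
qed

lemma transversal_correct:
  assumes g: "simple_graph {..<n} E" and L: "table_bound n k \<le> L"
  shows "case transversal (matrix n E) k L of
      Some xs \<Rightarrow> distinct xs \<and> minimum_odd_cycle_transversal {..<n} E (set xs)
    | None \<Rightarrow> \<not> (\<exists>S. chordal_vertex_deletion_set {..<n} E S \<and> card S \<le> k)"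
proof -
  let ?G = "matrix n E"
  let ?T = "root_table ?G k L"
  have L': "table_bound (length ?G) k \<le> L" using L by simp
  note T = root_table_correct[OF matrix_graph[OF g] L', unfolded length_matrix]
  show ?thesis
  proof (cases "longest ?T")
    case Nil
    then have e: "?T = []" using longest_nonempty by blast
    have "\<not> (\<exists>S. chordal_vertex_deletion_set {..<n} E S \<and> card S \<le> k)"
    proof
      assume "\<exists>S. chordal_vertex_deletion_set {..<n} E S \<and> card S \<le> k"
      then obtain S where S: "chordal_vertex_deletion_set {..<n} E S" "card S \<le> k" by blast
      then have "S \<subseteq> {..<n}" by (simp add: chordal_vertex_deletion_set_def)
      then have "table_complete ?G {..<n} {} ?T" using T(2) S chordal_dismantlable[OF g S(1)] by blast
      moreover have "indep ?G {..<n} {}" by (simp add: indep_def)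
      ultimately show False using e by (auto simp: table_complete_def)
    qed
    then show ?thesis by (simp add: transversal_def Nil)
  next
    case (Cons I Is)
    have "I \<in> set (longest ?T)" by (simp add: Cons)
    then have I: "I \<in> set ?T" "\<And>J. J \<in> set ?T \<Longrightarrow> length J \<le> length I" by (auto simp: longest_def)
    then have sound: "distinct I" "indep ?G {..<n} (set I)" using T(1) by (auto simp: table_sound_def)
    note X = uncoloured_transversal[OF g sound]
    have "?T \<noteq> []" using I(1) by auto
    then have complete: "table_complete ?G {..<n} {} ?T" using T(2) by blast
    have "card (set (uncoloured n I)) \<le> card Y" if Y: "odd_cycle_transversal {..<n} E Y" for Y
    proof -
      obtain S where S: "indep ?G {..<n} S" "card S + card Y = n" using transversal_indep[OF g Y] by blast
      then obtain J where "J \<in> set ?T" "card S \<le> length J" using complete unfolding table_complete_def by blast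
      then show ?thesis using I(2)[of J] X S(2) by linarith
    qed
    then have "minimum_odd_cycle_transversal {..<n} E (set (uncoloured n I))"
      using X by (simp add: minimum_odd_cycle_transversal_def)
    moreover have "distinct (uncoloured n I)" by (simp add: uncoloured_def)
    ultimately show ?thesis by (simp add: transversal_def Cons)
  qed
qed

section \<open>The algorithm runs in polynomial time\<close>

text \<open>\<open>polytime\<close> speaks of unary functions. A curried function is therefore
  treated once on the tuple of its arguments, and rules of this kind then make it available for
  arbitrary arguments.\<close>

lemma polytime_app2:
  assumes "polytime (\<lambda>p. f (fst p) (snd p))" "polytime a" "polytime b"
  shows "polytime (\<lambda>x. f (a x) (b x))"
  using polytime_comp[OF polytime_Pair[OF assms(2,3)] assms(1)] by simp

lemma polytime_app3:
  assumes "polytime (\<lambda>p. f (fst p) (fst (snd p)) (snd (snd p)))" "polytime a" "polytime b" "polytime c"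
  shows "polytime (\<lambda>x. f (a x) (b x) (c x))"
  using polytime_comp[OF polytime_Pair[OF assms(2) polytime_Pair[OF assms(3,4)]] assms(1)] by simp

lemma polytime_app4:
  assumes "polytime (\<lambda>p. f (fst p) (fst (snd p)) (fst (snd (snd p))) (snd (snd (snd p))))"
    "polytime a" "polytime b" "polytime c" "polytime d"
  shows "polytime (\<lambda>x. f (a x) (b x) (c x) (d x))"
  using polytime_comp[OF polytime_Pair[OF assms(2) polytime_Pair[OF assms(3) polytime_Pair[OF assms(4,5)]]] assms(1)]
  by simp

lemma polytime_app5:
  assumes "polytime (\<lambda>p. f (fst p) (fst (snd p)) (fst (snd (snd p))) (fst (snd (snd (snd p)))) (snd (snd (snd (snd p)))))"
    "polytime a" "polytime b" "polytime c" "polytime d" "polytime e"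
  shows "polytime (\<lambda>x. f (a x) (b x) (c x) (d x) (e x))"
  using polytime_comp[OF polytime_Pair[OF assms(2) polytime_Pair[OF assms(3) polytime_Pair[OF assms(4)
        polytime_Pair[OF assms(5,6)]]]] assms(1)] by simp

lemma polytime_app6:
  assumes "polytime (\<lambda>p. f (fst p) (fst (snd p)) (fst (snd (snd p))) (fst (snd (snd (snd p))))
      (fst (snd (snd (snd (snd p))))) (snd (snd (snd (snd (snd p))))))"
    "polytime a" "polytime b" "polytime c" "polytime d" "polytime e" "polytime g"
  shows "polytime (\<lambda>x. f (a x) (b x) (c x) (d x) (e x) (g x))"
  using polytime_comp[OF polytime_Pair[OF assms(2) polytime_Pair[OF assms(3) polytime_Pair[OF assms(4)
        polytime_Pair[OF assms(5) polytime_Pair[OF assms(6,7)]]]]] assms(1)] by simp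

lemma polytime_Let [polytime_intros]:
  assumes "polytime s" "polytime (\<lambda>p. f (fst p) (snd p))"
  shows "polytime (\<lambda>x. let y = s x in f x y)"
  unfolding Let_def by (rule polytime_app2[OF assms(2) polytime_id assms(1)])

declare polytime_eq_bool [polytime_intros]

lemma polytime_sum_list [polytime_intros]:
  assumes xs: "polytime xs" shows "polytime (\<lambda>x. sum_list (xs x) :: nat)"
proof -
  have e: "foldr (\<lambda>y acc. y + acc) ys 0 = sum_list ys" for ys :: "nat list" by (induction ys) auto
  have s: "sum_list ys \<le> sz ys" for ys :: "nat list" by (induction ys) auto
  have "polytime (\<lambda>x. foldr (\<lambda>y acc. y + acc) (xs x) (0::nat))"
  proof (rule polytime_foldr[where B="\<lambda>x. sz (xs x)"])
    fix x ys zs assume "xs x = ys @ zs"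
    then show "sz (foldr (\<lambda>y acc. y + acc) zs (0::nat)) \<le> sz (xs x)" using s[of zs] by (simp add: e)
  qed (intro polytime_intros poly_bounded_intros xs)+
  then show ?thesis by (simp add: e)
qed

lemma set_cap_subset: "set (cap L xs) \<subseteq> set xs"
  by (auto simp: cap_def)

lemma polytime_cap [polytime_intros]:
  assumes "polytime L" "polytime xs" shows "polytime (\<lambda>x. cap (L x) (xs x))"
  unfolding cap_def by (intro polytime_intros assms)

lemma sz_thin: "sz (thin le xs) \<le> sz xs"
proof (induction xs)
  case (Cons x xs)
  then show ?case using sz_filter[of "\<lambda>y. \<not> le y x" "thin le xs"] by (auto simp: thin_Cons)
qed simp

lemma polytime_thin [polytime_intros]:
  assumes xs: "polytime xs" and le: "polytime (\<lambda>p. le (fst p) (fst (snd p)) (snd (snd p)))"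
  shows "polytime (\<lambda>x. thin (le x) (xs x))"
  unfolding thin_def
proof (rule polytime_foldr[where B="\<lambda>x. sz (xs x)"])
  fix x ys zs assume "xs x = ys @ zs"
  then show "sz (foldr (\<lambda>y acc. if \<exists>z\<in>set acc. le x y z then acc else y # filter (\<lambda>z. \<not> le x z y) acc) zs []) \<le> sz (xs x)"
    using sz_thin[of "le x" zs] by (simp add: thin_def)
qed (intro polytime_intros poly_bounded_intros polytime_app3[OF le] xs)+

text \<open>\<open>cap\<close> bounds the number of entries, and every entry grows in each step by
  at most the size of the processed element and 1. The initial list has passed no cap; hence
  \<open>L + 1\<close>.\<close>

lemma sz_foldr_cap:
  assumes f: "\<And>y acc. f y acc = cap L (g y acc)"
    and g: "\<And>y acc z. z \<in> set (g y acc) \<Longrightarrow> \<exists>w\<in>set acc. sz z \<le> sz w + sz y + 1"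
  shows "sz (foldr f ys [e]) \<le> (L + 1) * (sz ys + sz e + 1)"
proof -
  have "length (foldr f ys [e]) \<le> L + 1" by (cases ys) (auto simp: f cap_def)
  moreover have "sz z \<le> sz ys + sz e" if "z \<in> set (foldr f ys [e])" for z
    using that
  proof (induction ys arbitrary: z)
    case (Cons y ys)
    have "foldr f (y # ys) [e] = cap L (g y (foldr f ys [e]))" by (simp only: foldr.simps o_apply f)
    then have "z \<in> set (g y (foldr f ys [e]))" using Cons.prems by (simp add: cap_def split: if_splits)
    then obtain w where "w \<in> set (foldr f ys [e])" "sz z \<le> sz w + sz y + 1" using g by blast
    then show ?case using Cons.IH[of w] by simp
  qed simp
  then have "sz (foldr f ys [e]) \<le> length (foldr f ys [e]) * (sz ys + sz e + 1)" by (rule sz_list_le)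
  ultimately show ?thesis by (meson le_trans mult_le_mono1)
qed

lemma polytime_foldr_cap:
  assumes "polytime xs" and L: "polytime L" and g: "polytime (\<lambda>p. g (fst p) (fst (snd p)) (snd (snd p)))"
    and s: "\<And>x y acc z. z \<in> set (g x y acc) \<Longrightarrow> \<exists>w\<in>set acc. sz z \<le> sz w + sz y + 1"
  shows "polytime (\<lambda>x. foldr (\<lambda>y acc. cap (L x) (g x y acc)) (xs x) [e])"
proof (rule polytime_foldr[where B="\<lambda>x. (L x + 1) * (sz (xs x) + sz e + 1)"])
  show "poly_bounded (\<lambda>x. (L x + 1) * (sz (xs x) + sz e + 1))"
    using polytime_sz[OF L] by (intro poly_bounded_intros assms) simp
  fix x ys zs assume "xs x = ys @ zs"
  then have "(L x + 1) * (sz zs + sz e + 1) \<le> (L x + 1) * (sz (xs x) + sz e + 1)" by (intro mult_le_mono) auto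
  moreover have "sz (foldr (\<lambda>y acc. cap (L x) (g x y acc)) zs [e]) \<le> (L x + 1) * (sz zs + sz e + 1)"
    by (rule sz_foldr_cap[OF refl s])
  ultimately show "sz (foldr (\<lambda>y acc. cap (L x) (g x y acc)) zs [e]) \<le> (L x + 1) * (sz (xs x) + sz e + 1)"
    by linarith
qed (intro polytime_intros polytime_comp[OF _ L] polytime_app3[OF g] assms(1))+

lemma polytime_adj_tuple: "polytime (\<lambda>p. adj (fst p) (fst (snd p)) (snd (snd p)))"
  unfolding adj_def by (intro polytime_intros)
lemmas polytime_adj [polytime_intros] = polytime_app3[OF polytime_adj_tuple]

lemma polytime_sublist_le_tuple: "polytime (\<lambda>p. sublist_le (fst p) (snd p))"
  unfolding sublist_le_def by (intro polytime_intros)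
lemmas polytime_sublist_le [polytime_intros] = polytime_app2[OF polytime_sublist_le_tuple]

lemma polytime_cliques_tuple: "polytime (\<lambda>p. cliques (fst p) (snd p))"
  unfolding cliques_def cliques_step_def
proof (rule polytime_foldr_cap)
  fix x :: "bool list list \<times> nat" and v :: nat and acc :: "nat list list" and K
  assume "K \<in> set (thin sublist_le (map (\<lambda>K. v # filter (adj (fst x) v) K) acc @ acc))"
  then have "K \<in> set (map (\<lambda>K. v # filter (adj (fst x) v) K) acc @ acc)" by (rule subsetD[OF set_thin_subset])
  then consider "K \<in> set acc" | K' where "K' \<in> set acc" "K = v # filter (adj (fst x) v) K'" by auto
  then show "\<exists>w\<in>set acc. sz K \<le> sz w + sz v + 1"
  proof cases
    case 1
    then show ?thesis by (intro bexI[of _ K]) auto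
  next
    case 2
    then show ?thesis using sz_filter[of "adj (fst x) v" K'] by (intro bexI[of _ K']) auto
  qed
qed (intro polytime_intros)+
lemmas polytime_cliques [polytime_intros] = polytime_app2[OF polytime_cliques_tuple]

lemma polytime_verts [polytime_intros]: "polytime ts \<Longrightarrow> polytime (\<lambda>x. verts (ts x))"
  unfolding verts_def by (intro polytime_intros)

lemma polytime_weight_tuple: "polytime (\<lambda>p. weight (fst p) (snd p))"
  unfolding weight_def by (intro polytime_intros)
lemmas polytime_weight [polytime_intros] = polytime_app2[OF polytime_weight_tuple]

lemma polytime_splits_tuple: "polytime (\<lambda>p. splits (fst p) (snd p :: 'a::encodable list))"
  unfolding splits_def
proof (rule polytime_foldr_cap)
  fix x :: "nat \<times> 'a list" and t :: 'a and acc :: "('a list \<times> 'a list) list" and q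
  assume "q \<in> set (map (\<lambda>p. (t # fst p, snd p)) acc @ map (\<lambda>p. (fst p, t # snd p)) acc)"
  then obtain p where "p \<in> set acc" "q = (t # fst p, snd p) \<or> q = (fst p, t # snd p)" by auto
  then show "\<exists>w\<in>set acc. sz q \<le> sz w + sz t + 1" by (intro bexI[of _ p]) (auto simp: sz_prod)
qed (intro polytime_intros)+
lemmas polytime_splits [polytime_intros] = polytime_app2[OF polytime_splits_tuple]

lemma polytime_near_tuple: "polytime (\<lambda>p. near (fst p) (fst (snd p)) (snd (snd p)))"
  unfolding near_def by (intro polytime_intros)
lemmas polytime_near [polytime_intros] = polytime_app3[OF polytime_near_tuple]

lemma polytime_extensions [polytime_intros]:
  assumes "polytime rs" "polytime st" "polytime (\<lambda>p. rel (fst p) (fst (snd p)) (snd (snd p)))"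
  shows "polytime (\<lambda>x. extensions (rel x) (rs x) (st x))"
  unfolding extensions_def
  by (intro polytime_intros polytime_comp[OF _ assms(1)] polytime_comp[OF _ assms(2)] polytime_app3[OF assms(3)])

lemma polytime_restart_tuple: "polytime (\<lambda>p. restart (fst p) (snd p))"
  unfolding restart_def by (intro polytime_intros)
lemmas polytime_restart [polytime_intros] = polytime_app2[OF polytime_restart_tuple]

lemma polytime_search_step:
  assumes ls: "polytime ls" and rs: "polytime rs" and st: "polytime st"
    and rel: "polytime (\<lambda>p. rel (fst p) (fst (snd p)) (snd (snd p)))"
  shows "polytime (\<lambda>x. search_step (rel x) (ls x) (rs x) (st x))"
  unfolding search_step_def
  by (intro polytime_intros polytime_comp[OF _ ls] polytime_comp[OF _ rs] polytime_comp[OF _ st] polytime_app3[OF rel])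

definition small_state :: "nat list \<Rightarrow> nat list \<Rightarrow> nat \<Rightarrow> search_state \<Rightarrow> bool" where
  "small_state ls rs i st \<longleftrightarrow> length st \<le> length ls + i \<and>
     (\<forall>(u, M)\<in>set st. u \<in> set ls \<and> length M \<le> i \<and> set M \<subseteq> set ls \<times> set rs)"

lemma small_state_step:
  assumes st: "small_state ls rs i st" shows "small_state ls rs (Suc i) (search_step rel ls rs st)"
proof (cases "extensions rel rs st")
  case Nil
  then show ?thesis using st by (fastforce simp: search_step_def small_state_def)
next
  case (Cons c cs)
  obtain u M r where c: "c = (u, M, r)" by (cases c)
  have "c \<in> set (extensions rel rs st)" by (simp add: Cons)
  then have uM: "(u, M) \<in> set st" and r: "r \<in> set rs" unfolding c set_extensions by blast+
  then have M: "u \<in> set ls" "length M \<le> i" "set M \<subseteq> set ls \<times> set rs" using st by (auto simp: small_state_def)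
  show ?thesis
  proof (cases "filter (\<lambda>e. snd e = r) M")
    case Nil
    have "length (filter p ls) \<le> length ls + Suc i" for p
      by (rule le_trans[OF length_filter_le]) simp
    then show ?thesis
      using M r by (auto simp: search_step_def Cons c Nil restart_def small_state_def)
  next
    case C2: (Cons e es)
    have "e \<in> set (filter (\<lambda>e. snd e = r) M)" unfolding C2 by simp
    then have "fst e \<in> set ls" using M(3) by auto
    moreover have "length (filter (\<lambda>e. snd e \<noteq> r) M) \<le> i" using M(2) by (meson length_filter_le le_trans)
    moreover have "set (filter (\<lambda>e. snd e \<noteq> r) M) \<subseteq> set ls \<times> set rs" using M(3) by auto
    moreover have "\<forall>(u, M)\<in>set st. u \<in> set ls \<and> length M \<le> Suc i \<and> set M \<subseteq> set ls \<times> set rs"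
      using st by (fastforce simp: small_state_def)
    ultimately show ?thesis
      using st M r by (simp add: search_step_def Cons c C2 small_state_def)
  qed
qed

lemma small_state_search:
  "small_state ls rs (length is) (foldr (\<lambda>_. search_step rel ls rs) is (restart ls []))"
proof (induction "is")
  case Nil
  have "length (filter p ls) \<le> length ls" for p by (rule length_filter_le)
  then show ?case by (auto simp: small_state_def restart_def)
qed (simp add: small_state_step)

lemma sz_small_state:
  assumes "small_state ls rs i st"
  shows "sz st \<le> (length ls + i) * (sz ls + i * (sz ls + sz rs + 2) + 2)"
proof -
  have "sz p \<le> sz ls + i * (sz ls + sz rs + 2) + 1" if p: "p \<in> set st" for p
  proof -
    obtain u M where uM: "p = (u, M)" by fastforce
    then have M: "u \<in> set ls" "length M \<le> i" "set M \<subseteq> set ls \<times> set rs"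
      using assms p by (auto simp: small_state_def)
    have "sz e \<le> sz ls + sz rs + 1" if "e \<in> set M" for e
    proof -
      have "fst e \<in> set ls" "snd e \<in> set rs" using that M(3) by auto
      then show ?thesis using sz_member[of "fst e" ls] sz_member[of "snd e" rs] by (simp add: sz_prod)
    qed
    then have "sz M \<le> length M * (sz ls + sz rs + 2)" using sz_list_le[of M "sz ls + sz rs + 1"] by simp
    also have "\<dots> \<le> i * (sz ls + sz rs + 2)" using M(2) by (rule mult_le_mono1)
    finally show ?thesis using sz_member[OF M(1)] by (simp add: uM)
  qed
  then have "sz st \<le> length st * (sz ls + i * (sz ls + sz rs + 2) + 2)"
    using sz_list_le[of st "sz ls + i * (sz ls + sz rs + 2) + 1"] by simp
  also have "\<dots> \<le> (length ls + i) * (sz ls + i * (sz ls + sz rs + 2) + 2)"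
    using assms by (intro mult_le_mono1) (simp add: small_state_def)
  finally show ?thesis .
qed

lemma polytime_reached [polytime_intros]:
  fixes ls rs :: "'a::encodable \<Rightarrow> nat list"
  assumes ls: "polytime ls" and rs: "polytime rs" and rel: "polytime (\<lambda>p. rel (fst p) (fst (snd p)) (snd (snd p)))"
  shows "polytime (\<lambda>x. reached (rel x) (ls x) (rs x))"
proof -
  let ?n = "\<lambda>x. (length (ls x) + 1) * (length (ls x) + 1)"
  let ?B = "\<lambda>x. (sz (length (ls x)) + sz (?n x)) * (sz (ls x) + sz (?n x) * (sz (ls x) + sz (rs x) + 2) + 2)"
  have "polytime (\<lambda>x. foldr (\<lambda>_. search_step (rel x) (ls x) (rs x)) [0..<?n x] (restart (ls x) []))"
  proof (rule polytime_foldr[where B="?B"])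
    show "polytime (\<lambda>p :: 'a \<times> nat \<times> search_state. search_step (rel (fst p)) (ls (fst p)) (rs (fst p)) (snd (snd p)))"
      by (rule polytime_search_step)
        (intro polytime_intros polytime_comp[OF _ ls] polytime_comp[OF _ rs] polytime_app3[OF rel])+
    show "poly_bounded ?B" by (intro poly_bounded_intros polytime_intros ls rs)
    fix x ys and zs :: "nat list" assume "[0..<?n x] = ys @ zs"
    then have "length [0..<?n x] = length ys + length zs" by (metis length_append)
    then have len: "length zs \<le> ?n x" by simp
    let ?st = "foldr (\<lambda>_. search_step (rel x) (ls x) (rs x)) zs (restart (ls x) [])"
    have "sz ?st \<le> (length (ls x) + length zs) * (sz (ls x) + length zs * (sz (ls x) + sz (rs x) + 2) + 2)"
      by (rule sz_small_state[OF small_state_search])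
    also have "\<dots> \<le> (length (ls x) + ?n x) * (sz (ls x) + ?n x * (sz (ls x) + sz (rs x) + 2) + 2)"
      using len by (intro mult_le_mono add_le_mono) auto
    finally show "sz ?st \<le> ?B x" by simp
  qed (intro polytime_intros ls)+
  then show ?thesis unfolding reached_def search_def by (intro polytime_intros)
qed

lemma polytime_near_side_tuple:
  "polytime (\<lambda>p. near_side (fst p) (fst (snd p)) (fst (snd (snd p))) (snd (snd (snd p))))"
  unfolding near_side_def by (intro polytime_intros)
lemmas polytime_near_side [polytime_intros] = polytime_app4[OF polytime_near_side_tuple]

lemma polytime_far_side_tuple:
  "polytime (\<lambda>p. far_side (fst p) (fst (snd p)) (fst (snd (snd p))) (snd (snd (snd p))))"
  unfolding far_side_def by (intro polytime_intros)
lemmas polytime_far_side [polytime_intros] = polytime_app4[OF polytime_far_side_tuple]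

lemma polytime_new_tokens_tuple:
  "polytime (\<lambda>p. new_tokens (fst p) (fst (snd p)) (fst (snd (snd p))) (fst (snd (snd (snd p))))
      (fst (snd (snd (snd (snd p))))) (snd (snd (snd (snd (snd p))))))"
  unfolding new_tokens_def by (intro polytime_intros)
lemmas polytime_new_tokens [polytime_intros] = polytime_app6[OF polytime_new_tokens_tuple]

lemma polytime_make_children_tuple:
  "polytime (\<lambda>p. make_children (fst p) (fst (snd p)) (fst (snd (snd p))) (fst (snd (snd (snd p))))
      (fst (snd (snd (snd (snd p))))) (snd (snd (snd (snd (snd p))))))"
  unfolding make_children_def by (intro polytime_intros)
lemmas polytime_make_children [polytime_intros] = polytime_app6[OF polytime_make_children_tuple]

lemma polytime_remaining_tuple: "polytime (\<lambda>p. remaining (fst p) (fst (snd p)) (snd (snd p)))"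
  unfolding remaining_def by (intro polytime_intros)
lemmas polytime_remaining [polytime_intros] = polytime_app3[OF polytime_remaining_tuple]

lemma polytime_children_tuple:
  "polytime (\<lambda>p. children (fst p) (fst (snd p)) (fst (snd (snd p))) (fst (snd (snd (snd p))))
      (fst (snd (snd (snd (snd p))))) (snd (snd (snd (snd (snd p))))))"
  unfolding children_def by (intro polytime_intros)
lemmas polytime_children [polytime_intros] = polytime_app6[OF polytime_children_tuple]

lemma polytime_region_verts_tuple: "polytime (\<lambda>p. region_verts (fst p) (snd p))"
  unfolding region_verts_def by (intro polytime_intros)
lemmas polytime_region_verts [polytime_intros] = polytime_app2[OF polytime_region_verts_tuple]

lemma polytime_candidates_tuple:
  "polytime (\<lambda>p. candidates (fst p) (fst (snd p)) (fst (snd (snd p))) (fst (snd (snd (snd p)))) (snd (snd (snd (snd p)))))"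
  unfolding candidates_def by (intro polytime_intros)
lemmas polytime_candidates [polytime_intros] = polytime_app5[OF polytime_candidates_tuple]

lemma polytime_light_tuple: "polytime (\<lambda>p. light (fst p) (snd p))"
  unfolding light_def by (intro polytime_intros)
lemmas polytime_light [polytime_intros] = polytime_app2[OF polytime_light_tuple]

lemma polytime_split_region_tuple:
  "polytime (\<lambda>p. split_region (fst p) (fst (snd p)) (fst (snd (snd p))) (fst (snd (snd (snd p)))) (snd (snd (snd (snd p)))))"
  unfolding split_region_def by (intro polytime_intros)
lemmas polytime_split_region [polytime_intros] = polytime_app5[OF polytime_split_region_tuple]

lemma polytime_conflict_tuple: "polytime (\<lambda>p. conflict (fst p) (fst (snd p)) (snd (snd p)))"
  unfolding conflict_def by (intro polytime_intros)
lemmas polytime_conflict [polytime_intros] = polytime_app3[OF polytime_conflict_tuple]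

lemma polytime_indep_sets_tuple: "polytime (\<lambda>p. indep_sets (fst p) (fst (snd p)) (snd (snd p)))"
  unfolding indep_sets_def
proof (rule polytime_foldr_cap)
  fix g :: "bool list list \<times> nat \<times> coloured list" and x :: coloured and acc :: "coloured list list" and I
  assume "I \<in> set (map ((#) x) (filter (\<lambda>I. \<forall>y\<in>set I. \<not> conflict (fst g) x y) acc) @ acc)"
  then obtain J where "J \<in> set acc" "I = J \<or> I = x # J" by auto
  then show "\<exists>w\<in>set acc. sz I \<le> sz w + sz x + 1" by (intro bexI[of _ J]) auto
qed (intro polytime_intros)+
lemmas polytime_indep_sets [polytime_intros] = polytime_app3[OF polytime_indep_sets_tuple]

lemma polytime_colourings_tuple: "polytime (\<lambda>p. colourings (fst p) (snd p))"
  unfolding colourings_def by (intro polytime_intros)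
lemmas polytime_colourings [polytime_intros] = polytime_app2[OF polytime_colourings_tuple]

lemma polytime_leaf_tuple: "polytime (\<lambda>p. leaf (fst p) (fst (snd p)) (snd (snd p)))"
  unfolding leaf_def by (intro polytime_intros)
lemmas polytime_leaf [polytime_intros] = polytime_app3[OF polytime_leaf_tuple]

lemma polytime_agree_tuple: "polytime (\<lambda>p. agree (fst p) (fst (snd p)) (fst (snd (snd p))) (snd (snd (snd p))))"
  unfolding agree_def by (intro polytime_intros)
lemmas polytime_agree [polytime_intros] = polytime_app4[OF polytime_agree_tuple]

lemma polytime_joins_tuple: "polytime (\<lambda>p. joins (fst p) (fst (snd p)) (fst (snd (snd p))) (snd (snd (snd p))))"
  unfolding joins_def by (intro polytime_intros)
lemmas polytime_joins [polytime_intros] = polytime_app4[OF polytime_joins_tuple]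

lemma polytime_dominated_tuple: "polytime (\<lambda>p. dominated (fst p) (fst (snd p)) (snd (snd p)))"
  unfolding dominated_def by (intro polytime_intros)
lemmas polytime_dominated [polytime_intros] = polytime_app3[OF polytime_dominated_tuple]

lemma polytime_combine_tuple:
  "polytime (\<lambda>p. combine (fst p) (fst (snd p)) (fst (snd (snd p))) (fst (snd (snd (snd p)))) (snd (snd (snd (snd p)))))"
  unfolding combine_def by (intro polytime_intros)
lemmas polytime_combine [polytime_intros] = polytime_app5[OF polytime_combine_tuple]


text \<open>
  Polynomial time is claimed for all inputs, so the following size bounds must not assume that the matrix
  is symmetric, as the correctness proof does.
\<close>

definition small_region :: "nat \<Rightarrow> nat \<Rightarrow> region \<Rightarrow> bool" where
  "small_region n k a \<longleftrightarrow> scope a \<subseteq> {..<n} \<and> length (fst a) \<le> n \<and>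
     (\<forall>t\<in>set (snd a). length (snd t) \<le> n) \<and> weight k (snd a) \<le> 6 * k + 6"

lemma small_region_children:
  assumes a: "small_region (length G) k a" and s: "split_region G k L F a = Some c"
  shows "small_region (length G) k (fst c) \<and> small_region (length G) k (snd c)"
proof -
  obtain v D C lr where v: "fst a = v # D" and lr: "lr \<in> set (splits L (snd a))"
    and c: "c = children G (region_verts G a) v (fst a) C lr" and light: "light k c"
    using s by (rule split_regionE)
  let ?n = "length G"
  let ?U = "region_verts G a"
  let ?V = "remaining ?U C v"
  define P where "P = near_side G ?V (verts (fst lr)) (verts (snd lr))"
  define Q where "Q = far_side G ?V (verts (fst lr)) P"
  define N where "N = new_tokens ?U C v ?V P Q"
  have c': "c = make_children (fst a) N (fst lr) (snd lr) P Q"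
    by (simp add: c children_def Let_def P_def Q_def N_def)
  have U: "set ?U \<subseteq> {..<?n}" "length ?U \<le> ?n"
    using length_filter_le[of _ "[0..<?n]"] by (auto simp: region_verts_def)
  have V: "set ?V \<subseteq> {..<?n}" using U(1) by (auto simp: remaining_def)
  have sc: "set (fst a) \<subseteq> {..<?n}" "set (verts (snd a)) \<subseteq> {..<?n}" "length (fst a) \<le> ?n"
    "\<forall>t\<in>set (snd a). length (snd t) \<le> ?n"
    using a by (auto simp: small_region_def scope_def)
  have vn: "v < ?n" using sc(1) v by auto
  have N: "set (verts N) \<subseteq> {..<?n}" "\<forall>t\<in>set N. length (snd t) \<le> ?n"
    using U V vn le_trans[OF length_filter_le U(2)] by (auto simp: N_def new_tokens_def verts_def)
  have lr': "set (fst lr) \<union> set (snd lr) = set (snd a)" using splits_cover[OF lr] .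
  then have "set (verts (fst lr)) \<subseteq> {..<?n}" "set (verts (snd lr)) \<subseteq> {..<?n}"
    using sc(2) by (auto simp: set_verts)
  moreover have "\<forall>t\<in>set (fst lr) \<union> set (snd lr). length (snd t) \<le> ?n" using sc(4) lr' by simp
  moreover have "length (filter p (fst a)) \<le> ?n" for p by (rule le_trans[OF length_filter_le sc(3)])
  ultimately show ?thesis
    using light sc(1) N by (auto simp: c' make_children_def small_region_def scope_def light_def)
qed

lemma sz_nat_list_le: "set xs \<subseteq> {..<n} \<Longrightarrow> length xs \<le> m \<Longrightarrow> sz xs \<le> m * (n + 1)"
proof -
  assume "set xs \<subseteq> {..<n}" "length xs \<le> m"
  then have "sz xs \<le> length xs * (n + 1)" by (intro sz_list_le) auto
  also have "\<dots> \<le> m * (n + 1)" using \<open>length xs \<le> m\<close> by (rule mult_le_mono1)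
  finally show ?thesis .
qed

lemma sz_small_region:
  assumes "small_region n k a"
  shows "sz a \<le> n * (n + 1) + (6 * k + 6) * (n * (n + 1) + 3) + 1"
proof -
  have D: "sz (fst a) \<le> n * (n + 1)"
    using assms by (intro sz_nat_list_le) (auto simp: small_region_def scope_def)
  have "sz t \<le> n * (n + 1) + 2" if t: "t \<in> set (snd a)" for t
  proof -
    have "sz (snd t) \<le> n * (n + 1)"
      using assms t by (intro sz_nat_list_le) (auto simp: small_region_def scope_def set_verts)
    then show ?thesis using sz_bool[of "fst t"] by (simp add: sz_prod)
  qed
  then have "sz (snd a) \<le> length (snd a) * (n * (n + 1) + 2 + 1)" by (rule sz_list_le)
  also have "\<dots> \<le> (6 * k + 6) * (n * (n + 1) + 2 + 1)"
    using assms length_le_weight[of "snd a" k] by (intro mult_le_mono1) (simp add: small_region_def)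
  finally have "sz (snd a) \<le> (6 * k + 6) * (n * (n + 1) + 2 + 1)" .
  moreover have "n * (n + 1) + 2 + 1 = n * (n + 1) + 3" by simp
  ultimately have "sz (snd a) \<le> (6 * k + 6) * (n * (n + 1) + 3)" by (simp only:)
  then show ?thesis using D unfolding sz_prod by (intro add_le_mono) auto
qed

definition coloured_table :: "nat \<Rightarrow> coloured list list \<Rightarrow> bool" where
  "coloured_table n F \<longleftrightarrow> (\<forall>I\<in>set F. distinct I \<and> fst ` set I \<subseteq> {..<n})"

lemma coloured_indep_sets:
  assumes "distinct xs" "fst ` set xs \<subseteq> {..<n}" shows "coloured_table n (indep_sets G L xs)"
proof -
  have "\<forall>I\<in>set (indep_sets G L xs). distinct I \<and> set I \<subseteq> set xs"
    using assms(1)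
  proof (induction xs)
    case (Cons x xs)
    have "indep_sets G L (x # xs) = cap L (map (\<lambda>I. x # I)
        (filter (\<lambda>I. \<forall>y\<in>set I. \<not> conflict G x y) (indep_sets G L xs)) @ indep_sets G L xs)"
      by (simp add: indep_sets_def)
    then have "set (indep_sets G L (x # xs)) \<subseteq> set (map (\<lambda>I. x # I)
        (filter (\<lambda>I. \<forall>y\<in>set I. \<not> conflict G x y) (indep_sets G L xs)) @ indep_sets G L xs)"
      by (simp only: set_cap_subset)
    then have "I \<in> set (indep_sets G L xs) \<or> (\<exists>J\<in>set (indep_sets G L xs). I = x # J)"
      if "I \<in> set (indep_sets G L (x # xs))" for I
      using that by auto
    moreover have "distinct J \<and> set J \<subseteq> set xs" if "J \<in> set (indep_sets G L xs)" for J
      using Cons that by auto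
    moreover have "x \<notin> set xs" using Cons.prems by simp
    ultimately show ?case by fastforce
  qed (simp add: indep_sets_def)
  then show ?thesis using assms(2) by (fastforce simp: coloured_table_def)
qed

lemma coloured_solve: "coloured_table (length G) (solve G k L F a)"
proof (induction G k L F a rule: solve.induct)
  case (1 G k L F a)
  show ?case
  proof (cases "split_region G k L F a")
    case None
    have dist: "distinct (concat (map (\<lambda>v. [(v, False), (v, True)]) vs))" if "distinct vs" for vs :: "nat list"
      using that by (induction vs) auto
    have "coloured_table (length G) (leaf G L a)"
    proof (cases "fst a")
      case Nil
      have "coloured_table (length G) (indep_sets G L (colourings G (snd a)))"
        by (rule coloured_indep_sets) (auto simp: colourings_def intro!: dist)
      then show ?thesis by (simp add: leaf_def Nil)
    qed (simp add: leaf_def coloured_table_def)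
    then show ?thesis by (simp add: solve.simps[of G k L F a] None)
  next
    case (Some c)
    let ?F1 = "solve G k L F (fst c)" and ?F2 = "solve G k L F (snd c)"
    let ?J = "joins (verts (snd (fst c))) (verts (snd (snd c))) ?F1 ?F2"
    have F: "coloured_table (length G) ?F1" "coloured_table (length G) ?F2" using 1 Some by blast+
    have "coloured_table (length G) ?J"
      unfolding coloured_table_def
    proof
      fix K assume "K \<in> set ?J"
      then obtain I J where IJ: "I \<in> set ?F1" "J \<in> set ?F2" "K = I @ filter (\<lambda>y. y \<notin> set I) J"
        by (auto simp: joins_def)
      then have "distinct I" "distinct J" "fst ` set I \<subseteq> {..<length G}" "fst ` set J \<subseteq> {..<length G}"
        using F by (auto simp: coloured_table_def)
      then show "distinct K \<and> fst ` set K \<subseteq> {..<length G}" using IJ(3) by auto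
    qed
    moreover have "set (combine L a c ?F1 ?F2) \<subseteq> set ?J"
      unfolding combine_def by (rule subset_trans[OF set_cap_subset set_thin_subset])
    moreover have "solve G k L F a = combine L a c ?F1 ?F2" by (simp add: solve.simps[of G k L F a] Some)
    ultimately show ?thesis by (auto simp: coloured_table_def)
  qed
qed

lemma length_solve: "length (solve G k L F a) \<le> L + 1"
proof -
  have "length (leaf G L a) \<le> L + 1"
  proof (cases "fst a")
    case Nil
    have "length (indep_sets G L xs) \<le> L + 1" for xs
      by (cases xs) (auto simp: indep_sets_def cap_def)
    then show ?thesis by (simp add: leaf_def Nil)
  qed (simp add: leaf_def)
  moreover have "length (combine L a c F1 F2) \<le> L + 1" for c F1 F2
    by (simp add: combine_def cap_def)
  ultimately show ?thesis by (simp add: solve.simps[of G k L F a] split: option.split)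
qed

text \<open>An entry is a list of distinct coloured vertices, of which there are \<open>2 n\<close>.
  The number of entries is at most \<open>L\<close>, or 1 for an independent set table over no
  vertices.\<close>

lemma sz_solve: "sz (solve G k L F a) \<le> (L + 1) * (2 * length G * (length G + 3) + 1)"
proof -
  let ?n = "length G"
  have "sz I \<le> 2 * ?n * (?n + 3)" if I: "I \<in> set (solve G k L F a)" for I
  proof -
    have I': "distinct I" "fst ` set I \<subseteq> {..<?n}"
      using I coloured_solve[of G k L F a] by (auto simp: coloured_table_def)
    have "set I \<subseteq> {..<?n} \<times> UNIV" using I'(2) by force
    then have "card (set I) \<le> card ({..<?n} \<times> (UNIV :: bool set))" by (intro card_mono) auto
    then have len: "length I \<le> 2 * ?n" using distinct_card[OF I'(1)] by (simp add: card_cartesian_product)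
    have "sz x \<le> ?n + 2" if "x \<in> set I" for x
    proof -
      have "fst x < ?n" using that I'(2) by auto
      then show ?thesis using sz_bool[of "snd x"] by (simp add: sz_prod)
    qed
    then have "sz I \<le> length I * (?n + 2 + 1)" by (rule sz_list_le)
    also have "\<dots> \<le> 2 * ?n * (?n + 2 + 1)" using len by (rule mult_le_mono1)
    finally show ?thesis by (simp add: numeral_3_eq_3)
  qed
  then have "sz (solve G k L F a) \<le> length (solve G k L F a) * (2 * ?n * (?n + 3) + 1)" by (rule sz_list_le)
  also have "\<dots> \<le> (L + 1) * (2 * ?n * (?n + 3) + 1)" by (intro mult_le_mono1 length_solve)
  finally show ?thesis .
qed

type_synonym instance_data = "bool list list \<times> nat \<times> nat \<times> nat list list"

text \<open>The sum of the three bounds that \<open>polytime_divide\<close> requires: on the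
  measure, on a region and on its table.\<close>

definition recursion_bound :: "nat \<Rightarrow> nat \<Rightarrow> nat \<Rightarrow> nat" where
  "recursion_bound n k L = n + (n * (n + 1) + (6 * k + 6) * (n * (n + 1) + 3) + 1)
     + (L + 1) * (2 * n * (n + 3) + 1)"

lemma poly_bounded_nat: "polytime f \<Longrightarrow> poly_bounded (\<lambda>x. f x :: nat)"
  using polytime_sz[of f] by simp

lemma polytime_solve_root:
  "polytime (\<lambda>g :: instance_data.
     solve (fst g) (fst (snd g)) (fst (snd (snd g))) (snd (snd (snd g))) ([0..<length (fst g)], []))"
proof (rule polytime_divide[where I="\<lambda>g. {a. small_region (length (fst g)) (fst (snd g)) a}"
      and split="\<lambda>g a. split_region (fst g) (fst (snd g)) (fst (snd (snd g))) (snd (snd (snd g))) a"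
      and base="\<lambda>g a. leaf (fst g) (fst (snd (snd g))) a"
      and comb="\<lambda>g a c F1 F2. combine (fst (snd (snd g))) a c F1 F2" and \<mu>="\<lambda>a. length (fst a)"
      and B="\<lambda>g. recursion_bound (length (fst g)) (fst (snd g)) (fst (snd (snd g)))"])
  show "poly_bounded (\<lambda>g :: instance_data. recursion_bound (length (fst g)) (fst (snd g)) (fst (snd (snd g))))"
    unfolding recursion_bound_def by (intro poly_bounded_intros poly_bounded_nat polytime_intros)
next
  fix g :: instance_data and a
  let ?G = "fst g" and ?k = "fst (snd g)" and ?L = "fst (snd (snd g))" and ?F = "snd (snd (snd g))"
  show "([0..<length ?G], []) \<in> {a. small_region (length ?G) ?k a}"
    by (auto simp: small_region_def scope_def verts_def weight_def)
  assume a: "a \<in> {a. small_region (length ?G) ?k a}"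
  show "solve ?G ?k ?L ?F a = (case split_region ?G ?k ?L ?F a of None \<Rightarrow> leaf ?G ?L a
     | Some lr \<Rightarrow> combine ?L a lr (solve ?G ?k ?L ?F (fst lr)) (solve ?G ?k ?L ?F (snd lr)))"
    by (rule solve.simps)
  have "length (fst a) \<le> length ?G" using a by (simp add: small_region_def)
  moreover have "sz a \<le> length ?G * (length ?G + 1) + (6 * ?k + 6) * (length ?G * (length ?G + 1) + 3) + 1"
    by (rule sz_small_region) (use a in simp)
  moreover have "sz (solve ?G ?k ?L ?F a) \<le> (?L + 1) * (2 * length ?G * (length ?G + 3) + 1)" by (rule sz_solve)
  ultimately show "length (fst a) \<le> recursion_bound (length ?G) ?k ?L \<and> sz a \<le> recursion_bound (length ?G) ?k ?L \<and>
      sz (solve ?G ?k ?L ?F a) \<le> recursion_bound (length ?G) ?k ?L"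
    unfolding recursion_bound_def by (meson le_add1 le_add2 le_trans trans_le_add1)
  fix l r assume s: "split_region ?G ?k ?L ?F a = Some (l, r)"
  show "l \<in> {a. small_region (length ?G) ?k a} \<and> r \<in> {a. small_region (length ?G) ?k a} \<and>
    length (fst l) + length (fst r) < length (fst a)"
    using small_region_children[OF _ s] split_region_decreasing[OF s] a by simp
qed (intro polytime_intros)+

lemma polytime_longest [polytime_intros]: "polytime T \<Longrightarrow> polytime (\<lambda>x. longest (T x))"
  unfolding longest_def by (intro polytime_intros polytime_comp[OF polytime_fst_prim])

lemma polytime_uncoloured_tuple: "polytime (\<lambda>p. uncoloured (fst p) (snd p))"
  unfolding uncoloured_def by (intro polytime_intros)
lemmas polytime_uncoloured [polytime_intros] = polytime_app2[OF polytime_uncoloured_tuple]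

lemma polytime_root_table_tuple: "polytime (\<lambda>p. root_table (fst p) (fst (snd p)) (snd (snd p)))"
proof -
  have "polytime (\<lambda>p. (fst p, fst (snd p), snd (snd p), cliques (fst p) (snd (snd p))) :: instance_data)"
    by (intro polytime_intros)
  from polytime_comp[OF this polytime_solve_root] show ?thesis by (simp add: root_table_def)
qed
lemmas polytime_root_table [polytime_intros] = polytime_app3[OF polytime_root_table_tuple]

lemma polytime_transversal_tuple: "polytime (\<lambda>p. transversal (fst p) (fst (snd p)) (snd (snd p)))"
  unfolding transversal_def by (intro polytime_intros)
lemmas polytime_transversal [polytime_intros] = polytime_app3[OF polytime_transversal_tuple]

section \<open>Padding and the total running time\<close>

definition transversal_with_pad :: "bool list list \<times> nat \<times> nat \<Rightarrow> nat list option" where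
  "transversal_with_pad p =
     transversal (fst p) (fst (snd p)) (snd (snd p) ^ 12 * 4096 * (length (fst p) + 1) ^ 12)"

lemma polytime_transversal_with_pad: "polytime transversal_with_pad"
  unfolding transversal_with_pad_def by (intro polytime_intros polytime_power)

text \<open>With \<open>2 ^ k\<close> as padding the cap is exactly the bound on the tables:
  \<open>4 ^ (6 k + 6)\<close> is the twelfth power of the padding times
  \<open>4 ^ 6 = 4096\<close>.\<close>

lemma table_bound_pad: "table_bound n k = (2 ^ k) ^ 12 * 4096 * (n + 1) ^ 12"
proof -
  have "((2::nat) ^ k) ^ 12 = (2 ^ 12) ^ k" by (metis power_mult mult.commute)
  moreover have "(4::nat) ^ (6 * k + 6) = (4 ^ 6) ^ k * 4 ^ 6" by (simp only: power_add power_mult)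
  ultimately show ?thesis by (simp add: table_bound_def)
qed

lemma sz_matrix: "sz (matrix n E) \<le> n * (2 * n + 1)"
proof -
  have "sz (map (\<lambda>v. {u, v} \<in> E) [0..<n]) \<le> 2 * n" for u
    using sz_list_le[of "map (\<lambda>v. {u, v} \<in> E) [0..<n]" 1] sz_bool by fastforce
  then show ?thesis using sz_list_le[of "matrix n E" "2 * n"] by (auto simp: matrix_def)
qed

lemma code_matrix: "enc_graph n E = code (matrix n E)"
  by (simp add: enc_graph_def matrix_def code_list_def code_bool_def)

lemma code_result: "code (r :: nat list option) = enc_option (enc_list enc_nat) r"
  by (simp add: code_option_def code_list_def code_nat_def)

lemma foldr_double: "foldr (\<lambda>_ a. a + a) (us :: unit list) (1::nat) = 2 ^ length us"
  by (induction us) auto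

text \<open>\<open>2 ^ k\<close> in unary is not polynomial in the size of \<open>k\<close>, so no
  closure property yields it. It is computed by \<open>k\<close> doublings, whose cost comes
  directly from \<open>eval_foldr\<close>, with every accumulator at most
  \<open>2 ^ k\<close>.\<close>

lemma eval_with_pad:
  assumes f: "polytime (f :: bool list list \<times> nat \<times> nat \<Rightarrow> 'b::encodable)"
  shows "\<exists>P main c d. \<forall>G k. \<exists>t. eval P [code G, code k] main (code (f (G, k, 2 ^ k))) t \<and>
    t \<le> (k + 1) * ((2 ^ k + 4) ^ c + 23) + (sz G + k + 2 ^ k + 4) ^ d + 20"
proof -
  have "polytime (\<lambda>p :: unit \<times> unit \<times> nat. snd (snd p) + snd (snd p))" by (intro polytime_intros)
  then obtain P1 e1 T1 where 1: "poly_bounded T1"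
    "runs ([] @ P1) e1 (\<lambda>p :: unit \<times> unit \<times> nat. snd (snd p) + snd (snd p)) T1"
    by (rule polytimeE)
  obtain c where c: "\<And>p. T1 p \<le> (sz p + 2) ^ c" using 1(1) unfolding poly_bounded_def by blast
  let ?m = "length P1"
  let ?body = "Case (Var 0) (LetIn (Var 1) (quote (code (1::nat))))
      (LetIn (Call ?m [Var 1, Var 3]) (LetIn (NodeE (Var 4) (NodeE (Var 1) (Var 0))) e1))"
  obtain P3 e3 T3 where 3: "poly_bounded T3" "runs ((P1 @ [?body]) @ P3) e3 f T3"
    using f by (rule polytimeE)
  obtain d where d: "\<And>p. T3 p \<le> (sz p + 2) ^ d" using 3(1) unfolding poly_bounded_def by blast
  let ?P = "P1 @ [?body] @ P3"
  let ?main = "LetIn (Call ?m [Var 1, LeafE]) (LetIn (NodeE (Var 1) (NodeE (Var 2) (Var 0))) e3)"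
  have "\<exists>t. eval ?P [code G, code k] ?main (code (f (G, k, 2 ^ k))) t \<and>
    t \<le> (k + 1) * ((2 ^ k + 4) ^ c + 23) + (sz G + k + 2 ^ k + 4) ^ d + 20" for G k
  proof -
    let ?us = "replicate k ()"
    let ?K = "(2 ^ k + 4) ^ c + 3 :: nat"
    have m: "?m < length ?P" "?P ! ?m = ?body" by (auto simp: nth_append)
    have "\<exists>t \<le> (length ?us + 1) * (?K + 20). eval ?P [code ?us, code ()] (?P ! ?m) (code (foldr (\<lambda>_ a. a + a) ?us (1::nat))) t"
    proof (rule eval_foldr[OF m])
      show "eval ?P [code ()] (quote (code (1::nat))) (code (1::nat)) 3"
        using eval_quote[of ?P "[code ()]" "code (1::nat)"] by (simp add: numeral_3_eq_3)
      fix ys h zs assume "?us = ys @ h # zs"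
      then have "length ?us = length ys + Suc (length zs)" by (metis length_append length_Cons)
      then have len: "length zs \<le> k" by simp
      let ?acc = "foldr (\<lambda>_ a. a + a) zs (1::nat)"
      obtain t where t: "t \<le> T1 ((), h, ?acc)" "eval (([] @ P1) @ [?body] @ P3) [code ((), h, ?acc)] e1 (code (?acc + ?acc)) t"
        using runsE[OF 1(2), of "((), h, ?acc)" "[?body] @ P3"] by auto
      have "?acc \<le> 2 ^ k" unfolding foldr_double using len by (intro power_increasing) auto
      then have "(sz ((), h, ?acc) + 2) ^ c \<le> (2 ^ k + 4) ^ c" by (intro power_mono) auto
      then have "t \<le> ?K" using t(1) c[of "((), h, ?acc)"] by linarith
      then show "\<exists>t\<le>?K. eval ?P [code ((), h, ?acc)] e1 (code (?acc + ?acc)) t" using t(2) by auto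
    qed simp
    then obtain t1 where t1: "t1 \<le> (k + 1) * (?K + 20)" "eval ?P [code k, Leaf] (?P ! ?m) (code (2 ^ k :: nat)) t1"
      unfolding foldr_double length_replicate code_nat_replicate[of k, symmetric] by auto
    obtain t3 where t3: "t3 \<le> T3 (G, k, 2 ^ k)"
      "eval (((P1 @ [?body]) @ P3) @ []) [code (G, k, 2 ^ k :: nat)] e3 (code (f (G, k, 2 ^ k))) t3"
      using 3(2) by (rule runsE)
    have call: "eval ?P [code G, code k] (Call ?m [Var 1, LeafE]) (code (2 ^ k :: nat)) (5 + t1 + 1)"
      by (rule eval_CallI[OF _ m(1) t1(2)], (rule evals_ConsI evals_NilI eval_VarI eval_LeafI refl | simp)+)
    have tup: "eval ?P [code (2 ^ k :: nat), code G, code k] (NodeE (Var 1) (NodeE (Var 2) (Var 0))) (code (G, k, 2 ^ k :: nat)) 5"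
      by (rule eval_NodeI[OF eval_VarI eval_NodeI[OF eval_VarI eval_VarI]]) auto
    have "eval ?P [code G, code k] ?main (code (f (G, k, 2 ^ k))) ((5 + t1 + 1) + (5 + t3 + 1) + 1)"
      by (rule eval_LetI[OF call eval_LetI[OF tup eval_in_singleton refl] refl]) (use t3(2) in simp)
    moreover have "t3 \<le> (sz G + k + 2 ^ k + 4) ^ d"
    proof -
      have "sz (G, k, 2 ^ k :: nat) + 2 = sz G + k + 2 ^ k + 4" by simp
      then show ?thesis using t3(1) d[of "(G, k, 2 ^ k)"] by (metis le_trans)
    qed
    moreover have "?K + 20 = (2 ^ k + 4) ^ c + 23" by simp
    then have "t1 \<le> (k + 1) * ((2 ^ k + 4) ^ c + 23)" using t1(1) by (simp only:)
    ultimately show ?thesis by (intro exI[of _ "(5 + t1 + 1) + (5 + t3 + 1) + 1"]) auto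
  qed
  then show ?thesis by blast
qed

text \<open>With \<open>q = 2 ^ k \<ge> k + 1\<close> and \<open>m = max 1 n\<close>, each summand
  is at most a constant times \<open>q ^ (c + 1 + d) * m ^ (2 * d)\<close>. Here \<open>c\<close>
  and \<open>d\<close> stem from the fixed program; \<open>2 * d\<close> reflects the quadratic size
  of the matrix.\<close>

lemma time_bound:
  fixes n k c d s :: nat
  assumes s: "s \<le> n * (2 * n + 1)"
  shows "(k + 1) * ((2 ^ k + 4) ^ c + 23) + (s + k + 2 ^ k + 4) ^ d + 20 \<le>
    (24 * 5 ^ c + 9 ^ d + 20) * 2 ^ ((c + 1 + d) * k) * max 1 n ^ (2 * d)"
proof -
  define q :: nat where "q = 2 ^ k"
  define m where "m = max 1 n"
  have q: "q \<ge> 1" "k + 1 \<le> q" using less_exp[of k] by (auto simp: q_def Suc_le_eq)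
  have m: "m \<ge> 1" "n \<le> m" by (auto simp: m_def)
  let ?X = "q ^ (c + 1 + d) * m ^ (2 * d)"
  have X: "1 \<le> ?X" using q m by (simp add: Suc_le_eq)
  have A: "(k + 1) * ((q + 4) ^ c + 23) \<le> 24 * 5 ^ c * ?X"
  proof -
    have "(q + 4) ^ c \<le> (5 * q) ^ c" using q by (intro power_mono) auto
    moreover have "1 \<le> (5 * q) ^ c" using q by (intro one_le_power) auto
    ultimately have "(q + 4) ^ c + 23 \<le> 24 * (5 * q) ^ c" by linarith
    then have "(k + 1) * ((q + 4) ^ c + 23) \<le> q * (24 * (5 * q) ^ c)" using q by (intro mult_le_mono) auto
    also have "\<dots> = 24 * 5 ^ c * (q ^ (c + 1) * 1)" by (simp add: power_mult_distrib)
    also have "\<dots> \<le> 24 * 5 ^ c * ?X"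
      using q m by (intro mult_le_mono2 mult_le_mono power_increasing one_le_power) auto
    finally show ?thesis .
  qed
  have B: "(s + k + q + 4) ^ d \<le> 9 ^ d * ?X"
  proof -
    have "n * (2 * n + 1) \<le> m * (3 * m)" using m by (intro mult_le_mono) auto
    then have "s + k + q + 4 \<le> 3 * (m * m) + 2 * q + 4" using s q by linarith
    also have "\<dots> \<le> 9 * (q * (m * m))"
    proof -
      have "1 \<le> m * m" using m by (simp add: Suc_le_eq)
      then have "q * 1 \<le> q * (m * m)" "1 * (m * m) \<le> q * (m * m)" using q by (intro mult_le_mono; simp)+
      then show ?thesis using q by linarith
    qed
    finally have "(s + k + q + 4) ^ d \<le> (9 * (q * (m * m))) ^ d" by (rule power_mono) simp
    also have "\<dots> = 9 ^ d * (q ^ d * m ^ (2 * d))"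
      by (simp add: power_mult_distrib power_mult power2_eq_square)
    also have "\<dots> \<le> 9 ^ d * ?X" using q by (intro mult_le_mono2 mult_le_mono1 power_increasing) auto
    finally show ?thesis .
  qed
  have "(k + 1) * ((q + 4) ^ c + 23) + (s + k + q + 4) ^ d + 20 \<le> 24 * 5 ^ c * ?X + 9 ^ d * ?X + 20 * ?X"
    using A B X by linarith
  also have "\<dots> = (24 * 5 ^ c + 9 ^ d + 20) * q ^ (c + 1 + d) * m ^ (2 * d)" by (simp add: algebra_simps)
  also have "q ^ (c + 1 + d) = 2 ^ ((c + 1 + d) * k)" unfolding q_def by (metis power_mult mult.commute)
  finally show ?thesis unfolding q_def m_def .
qed

theorem theorem4p3:
  "\<exists>(P :: expr list) (main :: expr) (a :: nat) (b :: nat) (c :: nat).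
     \<forall>(n :: nat) (E :: nat set set) (k :: nat). simple_graph {..<n} E \<longrightarrow>
       (\<exists>out t. eval P [enc_graph n E, enc_nat k] main out t \<and>
          t \<le> a * 2 ^ (b * k) * (max 1 n) ^ c \<and>
          ((\<exists>xs. out = enc_option (enc_list enc_nat) (Some xs) \<and> distinct xs \<and>
                 minimum_odd_cycle_transversal {..<n} E (set xs)) \<or>
           (out = enc_option (enc_list enc_nat) None \<and>
             \<not> (\<exists>S. chordal_vertex_deletion_set {..<n} E S \<and> card S \<le> k))))"
proof -
  obtain P main c d where eval: "\<And>G k. \<exists>t. eval P [code G, code k] main (code (transversal_with_pad (G, k, 2 ^ k))) t \<and>
    t \<le> (k + 1) * ((2 ^ k + 4) ^ c + 23) + (sz G + k + 2 ^ k + 4) ^ d + 20"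
    using eval_with_pad[OF polytime_transversal_with_pad] by metis
  have "\<exists>out t. eval P [enc_graph n E, enc_nat k] main out t \<and>
      t \<le> (24 * 5 ^ c + 9 ^ d + 20) * 2 ^ ((c + 1 + d) * k) * (max 1 n) ^ (2 * d) \<and>
      ((\<exists>xs. out = enc_option (enc_list enc_nat) (Some xs) \<and> distinct xs \<and>
             minimum_odd_cycle_transversal {..<n} E (set xs)) \<or>
       (out = enc_option (enc_list enc_nat) None \<and>
         \<not> (\<exists>S. chordal_vertex_deletion_set {..<n} E S \<and> card S \<le> k)))"
    if g: "simple_graph {..<n} E" for n E k
  proof -
    let ?r = "transversal_with_pad (matrix n E, k, 2 ^ k)"
    obtain t where t: "eval P [code (matrix n E), code k] main (code ?r) t"
      "t \<le> (k + 1) * ((2 ^ k + 4) ^ c + 23) + (sz (matrix n E) + k + 2 ^ k + 4) ^ d + 20"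
      using eval by blast
    have "?r = transversal (matrix n E) k (table_bound n k)"
      by (simp add: transversal_with_pad_def table_bound_pad)
    then have r: "case ?r of Some xs \<Rightarrow> distinct xs \<and> minimum_odd_cycle_transversal {..<n} E (set xs)
        | None \<Rightarrow> \<not> (\<exists>S. chordal_vertex_deletion_set {..<n} E S \<and> card S \<le> k)"
      using transversal_correct[OF g order_refl] by simp
    have "eval P [enc_graph n E, enc_nat k] main (enc_option (enc_list enc_nat) ?r) t"
      using t(1) by (simp add: code_matrix code_result code_nat_def)
    moreover have "t \<le> (24 * 5 ^ c + 9 ^ d + 20) * 2 ^ ((c + 1 + d) * k) * (max 1 n) ^ (2 * d)"
      by (rule le_trans[OF t(2) time_bound[OF sz_matrix]])
    ultimately show ?thesis using r by (cases ?r) auto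
  qed
  then show ?thesis by blast
qed

end
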